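(* Suppose that $0<\lambda<1$, $p>1$, and $g$ is analytic on $\mathbb{D}$. Then (i) $I_g:\mathcal{L}^{2,\lambda}\to B$ is compact if and only if $g=0$; (ii) $T_g:\mathcal{L}^{2,\lambda}\to B$ is compact if and only if $g\in B\mathcal{L}^{p,\lambda}_0$.
   Context: $\mathbb{D}$ is the open unit disc in $\mathbb{C}$, $\partial\mathbb{D}$ the unit circle, $H(\mathbb{D})$ the space of analytic functions on $\mathbb{D}$, $dm(z)=\frac1\pi dx\,dy$. For an arc $I\subset\partial\mathbb{D}$, $|I|=\frac1{2\pi}\int_I|d\zeta|$ is its normalized length, $f_I=\frac1{|I|}\int_I f(\zeta)\frac{|d\zeta|}{2\pi}$, and $S(I)=\{z\in\mathbb{D}:1-|I|\le|z|<1,\ z/|z|\in I\}$ is its Carleson box (with $S(\partial\mathbb{D})=\mathbb{D}$). Analytic Morrey space: $\mathcal{L}^{2,\lambda}$ is the set of $f$ in the Hardy space $H^2$ (boundary values are used on $\partial\mathbb{D}$) with $\sup_{I\subset\partial\mathbb{D}}\frac1{|I|^\lambda}\int_I|f(\zeta)-f_I|^2\frac{|d\zeta|}{2\pi}<\infty$. For $0<\lambda<1$ it is known that $f\in H(\mathbb{D})$ lies in $\mathcal{L}^{2,\lambda}$ iff $\|f\|_{\mathcal{L}^{2,\lambda}}=|f(0)|+\sup_{I\subset\partial\mathbb{D}}\big(\frac1{|I|^\lambda}\int_{S(I)}|f'(z)|^2(1-|z|^2)\,dm(z)\big)^{1/2}<\infty$, and this is the norm used. Bloch space: $B=\{f\in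 H(\mathbb{D}):\|f\|_B=\sup_{z\in\mathbb{D}}(1-|z|^2)|f'(z)|<\infty\}$, a Banach space with norm $|f(0)|+\|f\|_B$. Bloch–Morrey type spaces: for $p>1$, $B\mathcal{L}^{p,\lambda}$ is the set of $g\in H(\mathbb{D})$ with $\sup_{I\subset\partial\mathbb{D}}\frac1{|I|^{p-\lambda+1}}\int_{S(I)}|g'(z)|^2(1-|z|^2)^p\,dm(z)<\infty$, and $B\mathcal{L}^{p,\lambda}_0$ is the set of $g\in B\mathcal{L}^{p,\lambda}$ with $\lim_{|I|\to0}\frac1{|I|^{p-\lambda+1}}\int_{S(I)}|g'(z)|^2(1-|z|^2)^p\,dm(z)=0$. For $g,f\in H(\mathbb{D})$ and $z\in\mathbb{D}$: $I_gf(z)=\int_0^z f'(w)g(w)\,dw$ and $T_gf(z)=\int_0^z f(w)g'(w)\,dw$. That such an operator $X\to Y$ is compact means that it maps $X$ into $Y$ and is a compact (bounded) linear operator. *)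

theory Defs
  imports "HOL-Complex_Analysis.Complex_Analysis"
begin

text \<open>
  Analytic functions on the unit disc are total functions that are holomorphic on
  \<open>ball 0 1\<close>; their values outside the disc are irrelevant in everything below.
\<close>

abbreviation unit_disc :: "complex set" where
  "unit_disc \<equiv> ball 0 1"

text \<open>Normalized arc length $|d\zeta|/2\pi$ on the unit circle, as a Borel measure on the plane.\<close>

definition circle_measure :: "complex measure" where
  "circle_measure = distr (uniform_measure lborel {0..<2 * pi}) borel cis"

text \<open>The normalized area measure $dm = \frac{1}{\pi}\,dx\,dy$.\<close>

definition area_measure :: "complex measure" where
  "area_measure = scale_measure (ennreal (1 / pi)) lborel"

text \<open>
  Nondegenerate closed arcs, the full circle (\<open>b = a + 2 * pi\<close>) included. Whether end points
  belong to an arc is immaterial, since they affect all integrals only by null sets.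
\<close>

definition circle_arcs :: "complex set set" where
  "circle_arcs = {cis ` {a..b} | a b. a < b \<and> b \<le> a + 2 * pi}"

definition arc_length :: "complex set \<Rightarrow> real" where
  "arc_length I = measure circle_measure I"

lemma cis_borel_measurable: "cis \<in> borel_measurable borel"
  by (intro borel_measurable_continuous_onI continuous_intros)

lemma arc_length_cis_image:
  assumes "a < b" "b \<le> a + 2*pi"
  shows "arc_length (cis ` {a..b}) = (b - a) / (2*pi)"
proof -
  let ?B = "cis ` {a..b}"
  have cB: "compact ?B" by (intro compact_continuous_image continuous_intros) auto
  hence B: "?B \<in> sets borel" by (simp add: borel_compact)
  define n where "n = \<lfloor>a / (2*pi)\<rfloor>"
  define a' where "a' = a - 2*pi * of_int n"
  define b' where "b' = b - 2*pi * of_int n"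
  have fl: "of_int n \<le> a/(2*pi)" "a/(2*pi) < of_int n + 1" unfolding n_def by linarith+
  have a0: "0 \<le> a'" "a' < 2*pi"
    using fl by (auto simp: a'_def field_simps)
  have ab: "a' < b'" "b' \<le> a' + 2*pi" "b - a = b' - a'" using assms by (auto simp: a'_def b'_def)
  have cp: "cis (t + 2*pi * of_int m) = cis t" for t m
    by (metis cis_mult cis_multiple_2pi Ints_of_int mult.right_neutral)
  have key: "cis t \<in> ?B \<longleftrightarrow> t \<in> {a'..b'} \<union> {..b' - 2*pi}" if t: "t \<in> {0..<2*pi}" for t
  proof
    assume "cis t \<in> ?B"
    then obtain s where s: "s \<in> {a..b}" "cis t = cis s" by auto
    hence "sin s = sin t \<and> cos s = cos t" by (metis cis.sel)
    then obtain k::int where k: "s = t + 2*pi * of_int k"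
      using sin_cos_eq_iff[of s t] by (metis mult.commute mult.left_commute mult.assoc)
    define m where "m = k - n"
    have m: "a' \<le> t + 2*pi * of_int m" "t + 2*pi * of_int m \<le> b'"
      using s k by (auto simp: a'_def b'_def m_def algebra_simps)
    have "m = 0 \<or> m = 1 \<or> m \<ge> 2 \<or> m \<le> -1" by auto
    moreover have "\<not> m \<le> -1"
    proof
      assume "m \<le> -1"
      hence "2*pi * of_int m \<le> 2*pi*(-1)" by (intro mult_left_mono) auto
      with m t a0 show False by auto
    qed
    moreover have "\<not> m \<ge> 2"
    proof
      assume "m \<ge> 2"
      hence "2*pi * of_int m \<ge> 2*pi*2" by (intro mult_left_mono) auto
      with m t a0 ab show False by auto
    qed
    ultimately show "t \<in> {a'..b'} \<union> {..b' - 2*pi}" using m by auto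
  next
    assume "t \<in> {a'..b'} \<union> {..b' - 2*pi}"
    hence "t + 2*pi * of_int n \<in> {a..b} \<or> t + 2*pi * of_int (n+1) \<in> {a..b}"
      using t a0 by (auto simp: a'_def b'_def algebra_simps)
    thus "cis t \<in> ?B" using cp by (metis image_eqI)
  qed
  have eq: "{0..<2*pi} \<inter> cis -` ?B = ({a'..b'} \<inter> {0..<2*pi}) \<union> ({0..b'-2*pi} \<inter> {0..<2*pi})"
    using key by fastforce
  have "measure lborel ({0..<2*pi} \<inter> cis -` ?B) = b' - a'"
  proof (cases "b' < 2*pi")
    case True
    hence "{0..<2*pi} \<inter> cis -` ?B = {a'..b'}" unfolding eq using a0 by auto
    thus ?thesis using ab by simp
  next
    case False
    hence *: "{0..<2*pi} \<inter> cis -` ?B = {a'..<2*pi} \<union> {0..b'-2*pi} \<and> b'-2*pi \<le> a'"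
      unfolding eq using a0 ab by auto
    show ?thesis
    proof (cases "b' - 2*pi = a'")
      case True
      hence "{0..<2*pi} \<inter> cis -` ?B = {0..<2*pi}" using * a0 by auto
      thus ?thesis using True by (simp del: vimage_eq)
    next
      case F: False
      have "measure lborel ({a'..<2*pi} \<union> {0..b'-2*pi}) = measure lborel {a'..<2*pi} + measure lborel {0..b'-2*pi}"
        by (intro measure_Union) (use * F a0 False in \<open>auto simp: emeasure_lborel_Ico emeasure_lborel_Icc\<close>)
      thus ?thesis using * a0 False by simp
    qed
  qed
  moreover have "arc_length ?B = measure (uniform_measure lborel {0..<2*pi}) (cis -` ?B)"
    unfolding arc_length_def circle_measure_def using B cis_borel_measurable
    by (subst measure_distr) auto
  moreover have "\<dots> = measure lborel ({0..<2*pi} \<inter> cis -` ?B) / (2*pi)"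
    using measurable_sets[OF cis_borel_measurable B]
    by (subst measure_uniform_measure) auto
  ultimately show ?thesis using ab by simp
qed

definition arc_mean :: "(complex \<Rightarrow> complex) \<Rightarrow> complex set \<Rightarrow> complex" where
  "arc_mean u I = (LINT \<zeta>:I|circle_measure. u \<zeta>) / of_real (arc_length I)"

definition carleson_box :: "complex set \<Rightarrow> complex set" where
  "carleson_box I =
    (if I = sphere 0 1 then unit_disc
     else {z \<in> unit_disc. 1 - arc_length I \<le> cmod z \<and> z / of_real (cmod z) \<in> I})"

definition hardy2 :: "(complex \<Rightarrow> complex) set" where
  "hardy2 = {f. f holomorphic_on unit_disc \<and>
     (\<exists>M. \<forall>r\<in>{0..<1}. (1 / (2 * pi)) *
        integral {0..2 * pi} (\<lambda>t. (cmod (f (of_real r * cis t)))\<^sup>2) \<le> M)}"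

text \<open>
  \<open>u\<close> is a boundary function of \<open>f\<close>: a Borel function that is almost everywhere the radial
  limit of \<open>f\<close>. By Fatou's theorem every \<open>f \<in> hardy2\<close> has one, and it is unique almost everywhere.
\<close>

definition boundary_function :: "(complex \<Rightarrow> complex) \<Rightarrow> (complex \<Rightarrow> complex) \<Rightarrow> bool" where
  "boundary_function f u \<longleftrightarrow> u \<in> borel_measurable borel \<and>
     (AE \<zeta> in circle_measure. ((\<lambda>r. f (of_real r * \<zeta>)) \<longlongrightarrow> u \<zeta>) (at_left (1::real)))"

definition morrey_space :: "real \<Rightarrow> (complex \<Rightarrow> complex) set" where
  "morrey_space lam = {f \<in> hardy2. \<exists>u. boundary_function f u \<and>
     (SUP I\<in>circle_arcs.
        (\<integral>\<^sup>+\<zeta>\<in>I. ennreal ((cmod (u \<zeta> - arc_mean u I))\<^sup>2) \<partial>circle_measure)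
          / ennreal (arc_length I powr lam)) < \<infinity>}"

definition box_energy :: "real \<Rightarrow> (complex \<Rightarrow> complex) \<Rightarrow> complex set \<Rightarrow> ennreal" where
  "box_energy p f I =
     (\<integral>\<^sup>+z\<in>carleson_box I. ennreal ((cmod (deriv f z))\<^sup>2 * (1 - (cmod z)\<^sup>2) powr p) \<partial>area_measure)"

text \<open>
  The norm on \<open>morrey_space lam\<close> for \<open>0 < lam < 1\<close>. On that space the extended values below are finite
  and bounded in \<open>I\<close>, so neither \<open>enn2real\<close> nor the real supremum takes a default value.
\<close>

definition morrey_norm :: "real \<Rightarrow> (complex \<Rightarrow> complex) \<Rightarrow> real" where
  "morrey_norm lam f = cmod (f 0) +
     (SUP I\<in>circle_arcs. sqrt (enn2real (box_energy 1 f I / ennreal (arc_length I powr lam))))"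

definition bloch_space :: "(complex \<Rightarrow> complex) set" where
  "bloch_space = {f. f holomorphic_on unit_disc \<and>
     bdd_above ((\<lambda>z. (1 - (cmod z)\<^sup>2) * cmod (deriv f z)) ` unit_disc)}"

definition bloch_norm :: "(complex \<Rightarrow> complex) \<Rightarrow> real" where
  "bloch_norm f = cmod (f 0) + (SUP z\<in>unit_disc. (1 - (cmod z)\<^sup>2) * cmod (deriv f z))"

definition bloch_morrey :: "real \<Rightarrow> real \<Rightarrow> (complex \<Rightarrow> complex) set" where
  "bloch_morrey p lam = {g. g holomorphic_on unit_disc \<and>
     (SUP I\<in>circle_arcs. box_energy p g I / ennreal (arc_length I powr (p - lam + 1))) < \<infinity>}"

definition little_bloch_morrey :: "real \<Rightarrow> real \<Rightarrow> (complex \<Rightarrow> complex) set" where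
  "little_bloch_morrey p lam = {g \<in> bloch_morrey p lam.
     \<forall>\<epsilon>>0. \<exists>\<delta>>0. \<forall>I\<in>circle_arcs. arc_length I < \<delta> \<longrightarrow>
       box_energy p g I / ennreal (arc_length I powr (p - lam + 1)) < ennreal \<epsilon>}"

definition I_op :: "(complex \<Rightarrow> complex) \<Rightarrow> (complex \<Rightarrow> complex) \<Rightarrow> complex \<Rightarrow> complex" where
  "I_op g f z = contour_integral (linepath 0 z) (\<lambda>w. deriv f w * g w)"

definition T_op :: "(complex \<Rightarrow> complex) \<Rightarrow> (complex \<Rightarrow> complex) \<Rightarrow> complex \<Rightarrow> complex" where
  "T_op g f z = contour_integral (linepath 0 z) (\<lambda>w. f w * deriv g w)"

text \<open>
  Operators between normed spaces of analytic functions on the disc, each given by a carrier set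
  and a norm. Functions are compared on the disc only, so linearity is required there.
\<close>

definition bounded_linear_operator ::
    "(complex \<Rightarrow> complex) set \<Rightarrow> ((complex \<Rightarrow> complex) \<Rightarrow> real) \<Rightarrow>
     (complex \<Rightarrow> complex) set \<Rightarrow> ((complex \<Rightarrow> complex) \<Rightarrow> real) \<Rightarrow>
     ((complex \<Rightarrow> complex) \<Rightarrow> complex \<Rightarrow> complex) \<Rightarrow> bool" where
  "bounded_linear_operator X normX Y normY T \<longleftrightarrow>
     (\<forall>f\<in>X. T f \<in> Y) \<and>
     (\<forall>f\<in>X. \<forall>h\<in>X. \<forall>a b. \<forall>z\<in>unit_disc. T (\<lambda>w. a * f w + b * h w) z = a * T f z + b * T h z) \<and>
     (\<exists>C. \<forall>f\<in>X. normY (T f) \<le> C * normX f)"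

definition compact_operator ::
    "(complex \<Rightarrow> complex) set \<Rightarrow> ((complex \<Rightarrow> complex) \<Rightarrow> real) \<Rightarrow>
     (complex \<Rightarrow> complex) set \<Rightarrow> ((complex \<Rightarrow> complex) \<Rightarrow> real) \<Rightarrow>
     ((complex \<Rightarrow> complex) \<Rightarrow> complex \<Rightarrow> complex) \<Rightarrow> bool" where
  "compact_operator X normX Y normY T \<longleftrightarrow>
     bounded_linear_operator X normX Y normY T \<and>
     (\<forall>F :: nat \<Rightarrow> complex \<Rightarrow> complex.
        (\<forall>n. F n \<in> X) \<and> (\<exists>M. \<forall>n. normX (F n) \<le> M) \<longrightarrow>
        (\<exists>h\<in>Y. \<exists>r :: nat \<Rightarrow> nat. strict_mono r \<and>
           (\<lambda>n. normY (\<lambda>z. T (F (r n)) z - h z)) \<longlonglongrightarrow> 0))"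

end

theory Submission
  imports Defs
begin

text \<open>
  Membership in the Morrey space is defined through the oscillation of boundary values, but its norm
  through energies of Carleson boxes. The link is made with the kernel
  $K(z) = 1/(1+|I|-\bar e z)$, where $e$ is the midpoint of $I$: the Littlewood-Paley inequality for
  $(f-f_I)K$ bounds the energy of the box over $I$ by $|I|^2 \int |f-f_I|^2|K|^2$, and a dyadic
  decomposition of the circle around $I$ bounds the latter by $|I|^\lambda$.

  The sub-mean value property of $|f'|^2$ then gives
  $|f(z)| \lesssim \|f\| (1-|z|)^{-(1-\lambda)/2}$ together with the derivative analogue, while the
  functions $(1-|w|^2)^{(1+\lambda)/2}/(1-\bar w z)$ show that these bounds are sharp. Hence $I_g$ is
  bounded only for $g = 0$. For $T_g$ everything is governed by the quantity
  $(1-|z|)^{(1+\lambda)/2}|g'(z)|$: its decay at the circle is equivalent to membership of $g$ in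
  the little Bloch-Morrey type space (for every $p > 1$), it is necessary by the test functions,
  and sufficient by Montel's theorem.
\<close>

section \<open>Polar coordinates\<close>

text \<open>The two descriptions of the Morrey space are compared in one direction only: finite
  oscillation bounds all box energies, so the supremum in \<open>morrey_norm\<close> is a genuine
  one and growth estimates follow. For the test functions, membership is read off from Lipschitz
  boundary values and the norm is estimated through box energies, so oscillation never has to be
  recovered from energies. The kernel is chosen because its modulus is about 1/|I| on the box and
  decays like the inverse distance from the midpoint of the arc; its square gains a factor 1/4 per
  dyadic step. The oscillation integral over the k-th dilated arc must therefore grow more slowly
  than 4^k, and the constants of neighbouring arcs are compared with enough care to obtain 3^k. The
  exponent (1+\<lambda>)/2 in the condition on g is forced by homogeneity: the Bloch weight 1-|z|
  times the maximal growth (1-|z|)^(-(1-\<lambda>)/2) of f leaves (1-|z|)^((1+\<lambda>)/2) for g'.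
  Area integrals are reduced to Taylor coefficients by polar coordinates, which are derived from
  rotation invariance instead of a Jacobian.\<close>

lemma nn_integral_complex_lborel:
  assumes [measurable]: "F \<in> borel_measurable borel"
  shows "(\<integral>\<^sup>+z. F z \<partial>lborel) = (\<integral>\<^sup>+x. \<integral>\<^sup>+y. F (Complex x y) \<partial>lborel \<partial>lborel)"
proof -
  have m: "(\<lambda>p. Complex (fst p) (snd p)) \<in> borel_measurable (borel :: (real \<times> real) measure)"
    unfolding borel_measurable_complex_iff by (simp add: borel_prod[symmetric])
  have "lborel = distr (lborel :: (real \<times> real) measure) borel (\<lambda>p. Complex (fst p) (snd p))"
  proof (rule lborel_eqI)
    fix l u :: complex
    assume le: "\<And>b. b \<in> Basis \<Longrightarrow> l \<bullet> b \<le> u \<bullet> b"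
    have "(\<lambda>p. Complex (fst p) (snd p)) -` box l u = box (Re l) (Re u) \<times> box (Im l) (Im u)"
      by (auto simp: in_box_complex_iff)
    moreover have "emeasure lborel (box (Re l) (Re u) \<times> box (Im l) (Im u)) = ennreal ((Re u - Re l) * (Im u - Im l))"
      using le[of 1] le[of \<i>]
      by (subst lborel_prod[symmetric], subst lborel.emeasure_pair_measure_Times)
         (auto simp: Basis_complex_def ennreal_mult)
    ultimately show "emeasure (distr (lborel :: (real \<times> real) measure) borel (\<lambda>p. Complex (fst p) (snd p))) (box l u)
        = ennreal (\<Prod>b\<in>Basis. (u - l) \<bullet> b)"
      using m by (simp add: emeasure_distr Basis_complex_def)
  qed simp
  then have "(\<integral>\<^sup>+z. F z \<partial>lborel) = (\<integral>\<^sup>+p. F (Complex (fst p) (snd p)) \<partial>(lborel :: (real \<times> real) measure))"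
    using m assms by (subst nn_integral_distr[of _ lborel borel F, symmetric]) simp_all
  also have "\<dots> = (\<integral>\<^sup>+x. \<integral>\<^sup>+y. F (Complex x y) \<partial>lborel \<partial>lborel)"
    using measurable_compose[OF m assms]
    by (subst lborel_prod[symmetric], subst lborel.nn_integral_fst[symmetric])
       (auto simp: lborel_prod)
  finally show ?thesis .
qed

lemma borel_measurable_Complex [measurable (raw)]:
  "f \<in> borel_measurable M \<Longrightarrow> g \<in> borel_measurable M \<Longrightarrow> (\<lambda>x. Complex (f x) (g x)) \<in> borel_measurable M"
  unfolding borel_measurable_complex_iff by simp

section \<open>Invariance of plane Lebesgue measure under shears and rotations\<close>

lemma nn_integral_real_shift:
  fixes c :: real assumes [measurable]: "F \<in> borel_measurable borel"
  shows "(\<integral>\<^sup>+x. F (x + c) \<partial>lborel) = (\<integral>\<^sup>+x. F x \<partial>lborel)"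
  using nn_integral_real_affine[of F 1 c] by (simp add: add.commute)

lemma nn_integral_complex_lborel':
  assumes [measurable]: "F \<in> borel_measurable borel"
  shows "(\<integral>\<^sup>+z. F z \<partial>lborel) = (\<integral>\<^sup>+y. \<integral>\<^sup>+x. F (Complex x y) \<partial>lborel \<partial>lborel)"
  unfolding nn_integral_complex_lborel[OF assms]
  by (rule lborel_pair.Fubini'[symmetric]) measurable

lemma nn_integral_complex_shear_Re:
  assumes [measurable]: "F \<in> borel_measurable borel"
  shows "(\<integral>\<^sup>+z. F (Complex (Re z + t * Im z) (Im z)) \<partial>lborel) = (\<integral>\<^sup>+z. F z \<partial>lborel)"
  using nn_integral_real_shift[of "\<lambda>x. F (Complex x _)"]
  by (subst (1 2) nn_integral_complex_lborel') simp_all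

lemma nn_integral_complex_shear_Im:
  assumes [measurable]: "F \<in> borel_measurable borel"
  shows "(\<integral>\<^sup>+z. F (Complex (Re z) (Im z + t * Re z)) \<partial>lborel) = (\<integral>\<^sup>+z. F z \<partial>lborel)"
  using nn_integral_real_shift[of "\<lambda>x. F (Complex _ x)"]
  by (subst (1 2) nn_integral_complex_lborel) simp_all

text \<open>A rotation is a product of three shears: horizontal by \<open>- t\<close>, vertical by
  \<open>b\<close>, horizontal by \<open>- t\<close>, where \<open>t = b / (1 + a)\<close> is the
  tangent of half the angle. Shears preserve the measure by Fubini and translation invariance on
  lines. The half turn \<open>c = -1\<close>, at which the denominator vanishes, is done as two
  quarter turns.\<close>

lemma nn_integral_complex_rotate:
  assumes [measurable]: "F \<in> borel_measurable borel" and "cmod c = 1"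
  shows "(\<integral>\<^sup>+z. F (c * z) \<partial>lborel) = (\<integral>\<^sup>+z. F z \<partial>lborel)"
proof -
  have *: "(\<integral>\<^sup>+z. F (c * z) \<partial>lborel) = (\<integral>\<^sup>+z. F z \<partial>lborel)"
    if [measurable]: "F \<in> borel_measurable borel" and c: "cmod c = 1" "c \<noteq> -1" for F c
  proof -
    define a b t where "a = Re c" "b = Im c" "t = b / (1 + a)"
    have ab: "a\<^sup>2 + b\<^sup>2 = 1" using c by (simp add: a_b_t_def cmod_def)
    have a1: "1 + a \<noteq> 0"
    proof
      assume "1 + a = 0"
      then have "a = -1" by simp
      with ab have "b = 0" by simp
      with \<open>a = -1\<close> c show False by (auto simp: a_b_t_def complex_eq_iff)
    qed
    have t: "t * b = 1 - a" "t * (1 + a) = b"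
      using a1 ab unfolding a_b_t_def(3) by (simp_all add: field_simps power2_eq_square)
    have "c * z = Complex (Re z - t * Im z - t * (Im z + b * (Re z - t * Im z))) (Im z + b * (Re z - t * Im z))" for z
    proof -
      have "Re z - t * Im z - t * (Im z + b * (Re z - t * Im z)) = Re z * (1 - t*b) - Im z * (t * (1 + 1 - t*b))"
        by (simp add: algebra_simps)
      also have "\<dots> = a * Re z - b * Im z" using t by simp
      finally have 1: "Re z - t * Im z - t * (Im z + b * (Re z - t * Im z)) = a * Re z - b * Im z" .
      have "Im z + b * (Re z - t * Im z) = b * Re z + Im z * (1 - t*b)" by (simp add: algebra_simps)
      also have "\<dots> = b * Re z + a * Im z" using t by simp
      finally show ?thesis unfolding 1 by (simp add: complex_eq_iff a_b_t_def(1,2))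
    qed
    then have "(\<integral>\<^sup>+z. F (c * z) \<partial>lborel) = (\<integral>\<^sup>+z. F (Complex (Re z - t * Im z - t * (Im z + b * (Re z - t * Im z))) (Im z + b * (Re z - t * Im z))) \<partial>lborel)"
      by simp
    also have "\<dots> = (\<integral>\<^sup>+z. F (Complex (Re z - t * (Im z + b * Re z)) (Im z + b * Re z)) \<partial>lborel)"
      using nn_integral_complex_shear_Re[of "\<lambda>z. F (Complex (Re z - t * (Im z + b * Re z)) (Im z + b * Re z))" "-t"]
      by simp
    also have "\<dots> = (\<integral>\<^sup>+z. F (Complex (Re z - t * Im z) (Im z)) \<partial>lborel)"
      using nn_integral_complex_shear_Im[of "\<lambda>z. F (Complex (Re z - t * Im z) (Im z))" b]
      by simp
    also have "\<dots> = (\<integral>\<^sup>+z. F z \<partial>lborel)"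
      using nn_integral_complex_shear_Re[of F "-t"] by simp
    finally show ?thesis .
  qed
  show ?thesis
  proof (cases "c = -1")
    case True
    have "(\<integral>\<^sup>+z. F (c * z) \<partial>lborel) = (\<integral>\<^sup>+z. F (\<i> * (\<i> * z)) \<partial>lborel)"
      using True by (simp add: mult.assoc[symmetric])
    also have "\<dots> = (\<integral>\<^sup>+z. F z \<partial>lborel)"
      using *[of "\<lambda>z. F (\<i> * z)" \<i>] *[of F \<i>] by (simp add: complex_eq_iff)
    finally show ?thesis .
  qed (use * assms in blast)
qed

section \<open>Arc length on the circle: support and rotation invariance\<close>

declare cis_borel_measurable [measurable]

lemma sets_circle_measure [measurable_cong, simp]: "sets circle_measure = sets borel"
  by (simp add: circle_measure_def)

lemma space_circle_measure [simp]: "space circle_measure = UNIV"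
  by (simp add: circle_measure_def)

lemma emeasure_circle_measure_UNIV [simp]: "emeasure circle_measure UNIV = 1"
proof -
  show ?thesis unfolding circle_measure_def
    by (subst emeasure_distr) (simp_all add: emeasure_uniform_measure_1)
qed

interpretation circle: finite_measure circle_measure
  by (rule finite_measureI) simp

lemma nn_integral_circle_measure:
  assumes [measurable]: "F \<in> borel_measurable borel"
  shows "(\<integral>\<^sup>+\<zeta>. F \<zeta> \<partial>circle_measure) = (\<integral>\<^sup>+t. F (cis t) * indicator {0..<2*pi} t \<partial>lborel) / ennreal (2*pi)"
proof -
  show ?thesis unfolding circle_measure_def
    by (subst nn_integral_distr) (simp_all add: nn_integral_uniform_measure)
qed

lemma AE_circle_measure_norm: "AE \<zeta> in circle_measure. cmod \<zeta> = 1"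
proof -
  show ?thesis unfolding circle_measure_def by (subst AE_distr_iff) simp_all
qed

lemma nn_integral_circle_cong:
  assumes "\<And>\<zeta>. cmod \<zeta> = 1 \<Longrightarrow> f \<zeta> = g \<zeta>"
  shows "(\<integral>\<^sup>+\<zeta>. f \<zeta> \<partial>circle_measure) = (\<integral>\<^sup>+\<zeta>. g \<zeta> \<partial>circle_measure)"
  by (rule nn_integral_cong_AE, use AE_circle_measure_norm in eventually_elim) (rule assms)

lemma nn_integral_circle_mono:
  assumes "\<And>\<zeta>. cmod \<zeta> = 1 \<Longrightarrow> f \<zeta> \<le> g \<zeta>"
  shows "(\<integral>\<^sup>+\<zeta>. f \<zeta> \<partial>circle_measure) \<le> (\<integral>\<^sup>+\<zeta>. g \<zeta> \<partial>circle_measure)"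
  by (rule nn_integral_mono_AE, use AE_circle_measure_norm in eventually_elim) (rule assms)

text \<open>After reduction of the angle modulo the period, the shifted interval sticks out of
  \<open>{0..<2*pi}\<close> at the right end, and periodicity of \<open>cis\<close> moves that piece
  back to \<open>{0..<q}\<close>.\<close>

lemma nn_integral_circle_measure_rotate:
  assumes [measurable]: "F \<in> borel_measurable borel"
  shows "(\<integral>\<^sup>+\<zeta>. F (\<zeta> * cis s) \<partial>circle_measure) = (\<integral>\<^sup>+\<zeta>. F \<zeta> \<partial>circle_measure)"
proof -
  define n where "n = \<lfloor>s / (2*pi)\<rfloor>"
  define q where "q = s - 2*pi * of_int n"
  have fl: "of_int n \<le> s/(2*pi)" "s/(2*pi) < of_int n + 1" unfolding n_def by linarith+
  have q: "0 \<le> q" "q < 2*pi" using fl by (auto simp: q_def field_simps)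
  have per: "cis (t + 2*pi * of_int m) = cis t" for t m
    by (metis cis_mult cis_multiple_2pi Ints_of_int mult.right_neutral)
  have cisq: "cis s = cis q" using per[of q n] by (simp add: q_def)
  have shift: "(\<integral>\<^sup>+t. F (cis t) * indicator {2*pi..<2*pi+q} t \<partial>lborel) = (\<integral>\<^sup>+t. F (cis t) * indicator {0..<q} t \<partial>lborel)"
  proof -
    have "(\<integral>\<^sup>+t. F (cis t) * indicator {2*pi..<2*pi+q} t \<partial>lborel) = (\<integral>\<^sup>+t. F (cis (t + 2*pi)) * indicator {2*pi..<2*pi+q} (t + 2*pi) \<partial>lborel)"
      by (subst nn_integral_real_shift) simp_all
    also have "\<dots> = (\<integral>\<^sup>+t. F (cis t) * indicator {0..<q} t \<partial>lborel)"
      using per[of _ 1] by (intro nn_integral_cong) (auto split: split_indicator)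
    finally show ?thesis .
  qed
  have "(\<integral>\<^sup>+t. F (cis t * cis s) * indicator {0..<2*pi} t \<partial>lborel) = (\<integral>\<^sup>+t. F (cis (t + q)) * indicator {q..<2*pi+q} (t + q) \<partial>lborel)"
    unfolding cisq by (intro nn_integral_cong) (auto simp: cis_mult split: split_indicator)
  also have "\<dots> = (\<integral>\<^sup>+t. F (cis t) * indicator {q..<2*pi+q} t \<partial>lborel)"
    by (subst nn_integral_real_shift) simp_all
  also have "\<dots> = (\<integral>\<^sup>+t. F (cis t) * indicator {q..<2*pi} t + F (cis t) * indicator {2*pi..<2*pi+q} t \<partial>lborel)"
    using q by (intro nn_integral_cong) (auto split: split_indicator)
  also have "\<dots> = (\<integral>\<^sup>+t. F (cis t) * indicator {q..<2*pi} t \<partial>lborel) + (\<integral>\<^sup>+t. F (cis t) * indicator {0..<q} t \<partial>lborel)"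
    by (subst nn_integral_add) (simp_all add: shift)
  also have "\<dots> = (\<integral>\<^sup>+t. F (cis t) * indicator {q..<2*pi} t + F (cis t) * indicator {0..<q} t \<partial>lborel)"
    by (subst nn_integral_add) simp_all
  also have "\<dots> = (\<integral>\<^sup>+t. F (cis t) * indicator {0..<2*pi} t \<partial>lborel)"
    using q by (intro nn_integral_cong) (auto split: split_indicator)
  finally show ?thesis
    by (simp add: nn_integral_circle_measure)
qed

section \<open>Normalized area, its radial distribution, and integration over the disc\<close>

lemma sets_area_measure [measurable_cong, simp]: "sets area_measure = sets borel"
  by (simp add: area_measure_def)

lemma space_area_measure [simp]: "space area_measure = UNIV"
  by (simp add: area_measure_def space_scale_measure)

lemma nn_integral_area_measure:
  assumes [measurable]: "F \<in> borel_measurable borel"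
  shows "(\<integral>\<^sup>+z. F z \<partial>area_measure) = ennreal (1/pi) * (\<integral>\<^sup>+z. F z \<partial>lborel)"
  unfolding area_measure_def by (simp add: nn_integral_scale_measure)

lemma emeasure_area_measure_cball:
  assumes "0 \<le> r"
  shows "emeasure area_measure (cball z r) = ennreal (r\<^sup>2)"
  using assms unfolding area_measure_def
  by (simp add: emeasure_cball unit_ball_vol_2 ennreal_mult[symmetric])

text \<open>This is the radial half of polar coordinates. Both measures are finite, so it is enough
  to compare them on half-lines; the clamp \<open>max 0 (min 1 x)\<close> treats all positions of
  \<open>x\<close> at once.\<close>

lemma distr_norm_area_measure:
  "distr (density area_measure (indicator (ball 0 1))) borel cmod
     = density lborel (\<lambda>r. ennreal (2 * r) * indicator {0..<1} r)"
proof -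
  have m[measurable]: "ball (0::complex) 1 \<in> sets borel" by simp
  have em: "emeasure area_measure (ball (0::complex) 1 - cball 0 x) = ennreal (1 - x\<^sup>2)" if "0 \<le> x" "x \<le> 1" for x
  proof -
    have b1: "emeasure area_measure (ball (0::complex) 1) = 1"
      unfolding area_measure_def by (simp add: emeasure_ball unit_ball_vol_2 ennreal_mult[symmetric])
    have "emeasure area_measure (ball (0::complex) 1 - cball 0 x \<inter> ball 0 1) = 1 - emeasure area_measure (cball (0::complex) x \<inter> ball 0 1)"
    proof (subst emeasure_Diff)
      have "emeasure area_measure (cball (0::complex) x \<inter> ball 0 1) \<le> emeasure area_measure (ball (0::complex) 1)"
        by (intro emeasure_mono) auto
      then show "emeasure area_measure (cball (0::complex) x \<inter> ball 0 1) \<noteq> \<infinity>"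
        using b1 by (auto simp: top_unique)
    qed (use b1 in auto)
    moreover have "emeasure area_measure (cball (0::complex) x \<inter> ball 0 1) = ennreal (x\<^sup>2)"
    proof (cases "x < 1")
      case True
      then have "cball (0::complex) x \<inter> ball 0 1 = cball 0 x" by auto
      then show ?thesis using that by (simp add: emeasure_area_measure_cball)
    next
      case False
      with that have "cball (0::complex) x \<inter> ball 0 1 = ball 0 1" by auto
      then show ?thesis using b1 False that by simp
    qed
    moreover have "ball (0::complex) 1 - cball 0 x \<inter> ball 0 1 = ball 0 1 - cball 0 x" by auto
    ultimately show ?thesis using that by (simp add: ennreal_minus flip: ennreal_1)
  qed
  have L: "emeasure (distr (density area_measure (indicator (ball 0 1))) borel cmod) {x<..} = ennreal (1 - (max 0 (min 1 x))\<^sup>2)" for x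
  proof -
    have "emeasure (distr (density area_measure (indicator (ball 0 1))) borel cmod) {x<..} = emeasure area_measure (ball 0 1 \<inter> cmod -` {x<..})"
      by (subst emeasure_distr) (simp_all add: emeasure_density measurable_sets_borel[OF borel_measurable_norm] flip: indicator_inter_arith)
    also have "\<dots> = ennreal (1 - (max 0 (min 1 x))\<^sup>2)"
    proof (cases "x < 0")
      case True
      then have "ball 0 1 \<inter> cmod -` {x<..} = ball 0 1" by (auto intro: less_le_trans[OF _ norm_ge_zero])
      then show ?thesis using True
        unfolding area_measure_def by (simp add: emeasure_ball unit_ball_vol_2 ennreal_mult[symmetric])
    next
      case False
      then have "ball 0 1 \<inter> cmod -` {x<..} = ball 0 1 - cball 0 (min 1 x)" by auto
      then show ?thesis using False em[of "min 1 x"] by simp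
    qed
    finally show ?thesis .
  qed
  have R: "emeasure (density lborel (\<lambda>r. ennreal (2 * r) * indicator {0..<1} r)) {x<..} = ennreal (1 - (max 0 (min 1 x))\<^sup>2)" for x :: real
  proof -
    define y where "y = max 0 (min 1 x)"
    have y: "0 \<le> y" "y \<le> 1" by (auto simp: y_def)
    have "emeasure (density lborel (\<lambda>r. ennreal (2 * r) * indicator {0..<1} r)) {x<..} = (\<integral>\<^sup>+r. ennreal (2 * r) * indicator {0..<1} r * indicator {x<..} r \<partial>lborel)"
      by (subst emeasure_density) auto
    also have "\<dots> = (\<integral>\<^sup>+r. ennreal (2 * r) * indicator {y..1} r \<partial>lborel)"
    proof (rule nn_integral_cong_AE)
      have "AE r in lborel. r \<noteq> 1 \<and> r \<noteq> y"
        using AE_lborel_singleton[of 1] AE_lborel_singleton[of y] by auto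
      then show "AE r in lborel. ennreal (2 * r) * indicator {0..<1} r * indicator {x<..} r = ennreal (2 * r) * indicator {y..1} r"
        by eventually_elim (auto simp: y_def split: split_indicator)
    qed
    also have "\<dots> = ennreal (1\<^sup>2 - y\<^sup>2)"
      using y by (intro nn_integral_FTC_Icc) (auto intro!: derivative_eq_intros)
    finally show ?thesis by (simp add: y_def)
  qed
  show ?thesis
  proof (rule measure_eqI_lessThan)
    fix x show "emeasure (distr (density area_measure (indicator (ball 0 1))) borel cmod) {x<..} < \<infinity>"
      unfolding L by (simp add: ennreal_less_top)
  qed (use L R in simp_all)
qed

text \<open>Averaging replaces the change of variables. Area is invariant under rotations, so the
  integral equals the mean of all rotated integrals; after the two integrations are interchanged,
  the inner circle integral depends on \<open>cmod z\<close> only, and the distribution of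
  \<open>cmod z\<close> is known from \<open>distr_norm_area_measure\<close>.\<close>

lemma nn_integral_disc_polar:
  assumes [measurable]: "F \<in> borel_measurable borel"
  shows "(\<integral>\<^sup>+z\<in>ball 0 1. F z \<partial>area_measure) =
         (\<integral>\<^sup>+r\<in>{0..<1}. ennreal (2 * r) * (\<integral>\<^sup>+\<zeta>. F (of_real r * \<zeta>) \<partial>circle_measure) \<partial>lborel)"
proof -
  have [measurable]: "ball (0::complex) 1 \<in> sets borel" by simp
  define \<Phi> where "\<Phi> r = (\<integral>\<^sup>+\<zeta>. F (of_real r * \<zeta>) \<partial>circle_measure)" for r :: real
  have [measurable]: "(\<lambda>x. F (complex_of_real (fst x) * snd x)) \<in> borel_measurable (borel \<Otimes>\<^sub>M circle_measure)"
    by measurable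
  have \<Phi>m[measurable]: "\<Phi> \<in> borel_measurable borel"
    unfolding \<Phi>_def by measurable
  interpret A: sigma_finite_measure area_measure
  proof
    show "\<exists>A::complex set set. countable A \<and> A \<subseteq> sets area_measure \<and> \<Union> A = space area_measure \<and> (\<forall>a\<in>A. emeasure area_measure a \<noteq> \<infinity>)"
      by (rule exI[of _ "range (\<lambda>n::nat. cball 0 (real n))"])
         (auto simp: emeasure_area_measure_cball real_arch_simple)
  qed
  interpret P: pair_sigma_finite area_measure circle_measure ..
  have rot: "(\<integral>\<^sup>+z. F (\<zeta> * z) * indicator (ball 0 1) z \<partial>area_measure) = (\<integral>\<^sup>+z. F z * indicator (ball 0 1) z \<partial>area_measure)"
    if "cmod \<zeta> = 1" for \<zeta>
  proof -
    have "(\<integral>\<^sup>+z. F (\<zeta> * z) * indicator (ball 0 1) z \<partial>lborel) = (\<integral>\<^sup>+z. F (\<zeta> * z) * indicator (ball 0 1) (\<zeta> * z) \<partial>lborel)"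
      using that by (intro nn_integral_cong) (auto simp: norm_mult split: split_indicator)
    also have "\<dots> = (\<integral>\<^sup>+z. F z * indicator (ball 0 1) z \<partial>lborel)"
      using that by (subst nn_integral_complex_rotate) simp_all
    finally show ?thesis by (simp add: nn_integral_area_measure)
  qed
  have "(\<integral>\<^sup>+z\<in>ball 0 1. F z \<partial>area_measure) = (\<integral>\<^sup>+\<zeta>. (\<integral>\<^sup>+z. F z * indicator (ball 0 1) z \<partial>area_measure) \<partial>circle_measure)"
    by simp
  also have "\<dots> = (\<integral>\<^sup>+\<zeta>. (\<integral>\<^sup>+z. F (\<zeta> * z) * indicator (ball 0 1) z \<partial>area_measure) \<partial>circle_measure)"
    using AE_circle_measure_norm by (intro nn_integral_cong_AE) (auto simp: rot)
  also have "\<dots> = (\<integral>\<^sup>+z. (\<integral>\<^sup>+\<zeta>. F (\<zeta> * z) * indicator (ball 0 1) z \<partial>circle_measure) \<partial>area_measure)"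
    by (rule P.Fubini') measurable
  also have "\<dots> = (\<integral>\<^sup>+z. \<Phi> (cmod z) * indicator (ball 0 1) z \<partial>area_measure)"
  proof (rule nn_integral_cong)
    \<comment> \<open>The argument of \<open>z\<close> is absorbed by the rotation invariance of the
      circle.\<close>
    fix z
    have "(\<integral>\<^sup>+\<zeta>. F (\<zeta> * z) \<partial>circle_measure) = (\<integral>\<^sup>+\<zeta>. F (of_real (cmod z) * (\<zeta> * cis (Arg z))) \<partial>circle_measure)"
      by (subst (1) rcis_cmod_Arg[symmetric]) (simp add: rcis_def mult_ac)
    also have "\<dots> = \<Phi> (cmod z)"
      unfolding \<Phi>_def by (rule nn_integral_circle_measure_rotate) measurable
    finally show "(\<integral>\<^sup>+\<zeta>. F (\<zeta> * z) * indicator (ball 0 1) z \<partial>circle_measure) = \<Phi> (cmod z) * indicator (ball 0 1) z"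
      by (simp add: nn_integral_multc)
  qed
  also have "\<dots> = (\<integral>\<^sup>+r. \<Phi> r \<partial>distr (density area_measure (indicator (ball 0 1))) borel cmod)"
    by (subst nn_integral_distr) (simp_all add: nn_integral_density mult.commute)
  also have "\<dots> = (\<integral>\<^sup>+r\<in>{0..<1}. ennreal (2 * r) * \<Phi> r \<partial>lborel)"
    unfolding distr_norm_area_measure by (subst nn_integral_density) (simp_all add: mult_ac)
  finally show ?thesis by (simp add: \<Phi>_def)
qed

section \<open>Parseval's identity and the Littlewood-Paley inequality\<close>

lemma distr_circle_measure_rotate: "distr circle_measure borel (\<lambda>\<zeta>. \<zeta> * cis s) = circle_measure"
proof (rule measure_eqI)
  fix A assume "A \<in> sets (distr circle_measure borel (\<lambda>\<zeta>. \<zeta> * cis s))"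
  then have [measurable]: "A \<in> sets borel" by simp
  have "emeasure (distr circle_measure borel (\<lambda>\<zeta>. \<zeta> * cis s)) A = (\<integral>\<^sup>+\<zeta>. indicator A (\<zeta> * cis s) \<partial>circle_measure)"
    by (subst nn_integral_distr[symmetric, of _ _ borel]) (simp_all add: nn_integral_indicator)
  also have "\<dots> = emeasure circle_measure A"
    by (subst nn_integral_circle_measure_rotate) simp_all
  finally show "emeasure (distr circle_measure borel (\<lambda>\<zeta>. \<zeta> * cis s)) A = emeasure circle_measure A" .
qed simp

lemma borel_measurable_cnj [measurable (raw)]:
  assumes "f \<in> borel_measurable M" shows "(\<lambda>x. cnj (f x)) \<in> borel_measurable M"
  using measurable_compose[OF assms borel_measurable_continuous_onI[OF continuous_on_cnj[OF continuous_on_id]]] by simp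

lemma measure_circle_measure_UNIV [simp]: "measure circle_measure UNIV = 1"
  by (simp add: measure_def)

lemma integrable_circle_measure_bound:
  fixes f :: "complex \<Rightarrow> complex"
  assumes "f \<in> borel_measurable borel" "\<And>\<zeta>. cmod \<zeta> = 1 \<Longrightarrow> cmod (f \<zeta>) \<le> B"
  shows "integrable circle_measure f"
  by (rule circle.integrable_const_bound[of _ B])
     (use assms AE_circle_measure_norm in \<open>auto simp: measurable_cong_sets[OF sets_circle_measure refl]\<close>)

text \<open>For \<open>n \<noteq> m\<close>, rotation by the angle \<open>1 / (n - m)\<close> leaves
  the integral unchanged but multiplies it by \<open>cis 1\<close>, which is not 1 because sin 1 >
  0. Hence the integral vanishes.\<close>

lemma circle_orthogonality:
  "(LINT \<zeta>|circle_measure. \<zeta> ^ n * cnj \<zeta> ^ m) = (if n = m then 1 else 0)"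
proof (cases "n = m")
  case True
  have "(LINT \<zeta>|circle_measure. \<zeta> ^ n * cnj \<zeta> ^ m) = (LINT \<zeta>|circle_measure. (1::complex))"
  proof (rule integral_cong_AE)
    show "AE \<zeta> in circle_measure. \<zeta> ^ n * cnj \<zeta> ^ m = 1"
      using AE_circle_measure_norm
      by eventually_elim (simp add: True complex_norm_square[symmetric] flip: power_mult_distrib)
  qed (auto intro!: borel_measurable_continuous_onI continuous_intros simp: measurable_cong_sets[OF sets_circle_measure refl])
  then show ?thesis using True by simp
next
  case False
  define s where "s = 1 / (real n - real m)"
  have s: "real n * s - real m * s = 1" using False by (simp only: left_diff_distrib[symmetric] s_def) simp
  let ?I = "LINT \<zeta>|circle_measure. \<zeta> ^ n * cnj \<zeta> ^ m"
  have m: "(\<lambda>\<zeta>::complex. \<zeta> ^ n * cnj \<zeta> ^ m) \<in> borel_measurable borel"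
    by (intro borel_measurable_continuous_onI continuous_intros)
  have "?I = (LINT \<zeta>|distr circle_measure borel (\<lambda>\<zeta>. \<zeta> * cis s). \<zeta> ^ n * cnj \<zeta> ^ m)"
    by (simp add: distr_circle_measure_rotate)
  also have "\<dots> = (LINT \<zeta>|circle_measure. (\<zeta> * cis s) ^ n * cnj (\<zeta> * cis s) ^ m)"
    using m by (intro integral_distr) simp_all
  also have "\<dots> = (LINT \<zeta>|circle_measure. cis 1 * (\<zeta> ^ n * cnj \<zeta> ^ m))"
  proof (rule Bochner_Integration.integral_cong[OF refl])
    fix \<zeta>
    have "cis s ^ n * cnj (cis s) ^ m = cis 1"
      using s by (simp add: Complex.DeMoivre cis_cnj cis_mult)
    then show "(\<zeta> * cis s) ^ n * cnj (\<zeta> * cis s) ^ m = cis 1 * (\<zeta> ^ n * cnj \<zeta> ^ m)"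
      by (simp add: power_mult_distrib mult_ac)
  qed
  also have "\<dots> = cis 1 * ?I" by simp
  finally have "?I = 0 \<or> cis 1 = 1" by (metis mult_cancel_right1)
  moreover have "cis 1 \<noteq> 1"
  proof
    assume "cis 1 = 1"
    then have "sin (1::real) = 0" by (simp add: complex_eq_iff)
    moreover have "sin (1::real) > 0" using pi_gt3 by (intro sin_gt_zero) auto
    ultimately show False by simp
  qed
  ultimately show ?thesis using False by simp
qed

text \<open>Absolute summability of the coefficients justifies integration term by term. It holds
  for every dilation of a holomorphic function by a radius below 1, which is how the lemma is
  applied.\<close>

lemma nn_integral_circle_parseval:
  fixes c :: "nat \<Rightarrow> complex"
  assumes sc: "summable (\<lambda>n. norm (c n))"
    and F: "\<And>\<zeta>. cmod \<zeta> = 1 \<Longrightarrow> (\<lambda>n. c n * \<zeta> ^ n) sums F \<zeta>"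
  shows "(\<integral>\<^sup>+\<zeta>. ennreal ((cmod (F \<zeta>))\<^sup>2) \<partial>circle_measure) = (\<Sum>n. ennreal ((cmod (c n))\<^sup>2))"
proof -
  \<comment> \<open>\<open>F\<close> is controlled on the circle only. Cutting off outside makes the
    partial sums converge everywhere, so that the limit \<open>G\<close> is Borel and bounded by
    \<open>C\<close>.\<close>
  define S :: "complex set" where "S = sphere 0 1"
  have [measurable]: "S \<in> sets borel" by (simp add: S_def)
  define e where "e n \<zeta> = c n * \<zeta> ^ n * indicator S \<zeta>" for n \<zeta>
  define G where "G \<zeta> = F \<zeta> * indicator S \<zeta>" for \<zeta>
  define C where "C = (\<Sum>n. norm (c n))"
  have e_sums: "(\<lambda>n. e n \<zeta>) sums G \<zeta>" for \<zeta>
    using F[of \<zeta>] by (auto simp: e_def G_def S_def split: split_indicator)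
  have [measurable]: "e n \<in> borel_measurable borel" for n
    unfolding e_def by measurable
  have [measurable]: "G \<in> borel_measurable borel"
    by (rule borel_measurable_LIMSEQ_metric[of "\<lambda>n \<zeta>. \<Sum>i<n. e i \<zeta>"]) (use e_sums in \<open>auto simp: sums_def\<close>)
  have e_le: "cmod (e n \<zeta>) \<le> norm (c n)" for n \<zeta>
    by (auto simp: e_def S_def norm_mult norm_power split: split_indicator)
  have G_le: "cmod (G \<zeta>) \<le> C" for \<zeta>
  proof -
    have "G \<zeta> = (\<Sum>n. e n \<zeta>)" using e_sums by (simp add: sums_iff)
    also have "cmod \<dots> \<le> C" unfolding C_def
      by (rule norm_suminf_le[OF e_le sc])
    finally show ?thesis .
  qed
  have C0: "0 \<le> C" unfolding C_def by (rule suminf_nonneg[OF sc]) simp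
  have int: "integrable circle_measure (\<lambda>\<zeta>. e n \<zeta> * H \<zeta>)"
    if [measurable]: "H \<in> borel_measurable borel" and H: "\<And>\<zeta>. cmod (H \<zeta>) \<le> B" for n H B
    by (rule integrable_circle_measure_bound[of _ "norm (c n) * B"])
       (auto simp: norm_mult intro!: mult_mono e_le H intro: order_trans[OF norm_ge_zero])
  have termwise: "(\<lambda>n. LINT \<zeta>|circle_measure. e n \<zeta> * H \<zeta>) sums (LINT \<zeta>|circle_measure. G \<zeta> * H \<zeta>)"
    if [measurable]: "H \<in> borel_measurable borel" and H: "\<And>\<zeta>. cmod (H \<zeta>) \<le> B" for H B
  proof -
    have B0: "0 \<le> B" using H[of 0] by (meson norm_ge_zero order_trans)
    have le: "norm (e n \<zeta> * H \<zeta>) \<le> norm (c n) * B" for n \<zeta>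
      unfolding norm_mult by (intro mult_mono e_le H) auto
    have "(\<lambda>n. LINT \<zeta>|circle_measure. e n \<zeta> * H \<zeta>) sums (LINT \<zeta>|circle_measure. (\<Sum>n. e n \<zeta> * H \<zeta>))"
    proof (rule sums_integral)
      show "integrable circle_measure (\<lambda>\<zeta>. e n \<zeta> * H \<zeta>)" for n by (rule int[OF that])
      show "AE \<zeta> in circle_measure. summable (\<lambda>n. norm (e n \<zeta> * H \<zeta>))"
        by (intro AE_I2 summable_comparison_test'[OF summable_mult2[OF sc, of B]]) (simp add: le)
      show "summable (\<lambda>n. LINT \<zeta>|circle_measure. norm (e n \<zeta> * H \<zeta>))"
      proof (rule summable_comparison_test'[OF summable_mult2[OF sc, of B]])
        fix n
        have "norm (LINT \<zeta>|circle_measure. norm (e n \<zeta> * H \<zeta>)) = (LINT \<zeta>|circle_measure. norm (e n \<zeta> * H \<zeta>))"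
          by simp
        also have "\<dots> \<le> (LINT \<zeta>|circle_measure. norm (c n) * B)"
          by (rule integral_mono) (use le int[OF that] in auto)
        finally show "norm (LINT \<zeta>|circle_measure. norm (e n \<zeta> * H \<zeta>)) \<le> norm (c n) * B" by simp
      qed
    qed
    also have "(\<lambda>\<zeta>. \<Sum>n. e n \<zeta> * H \<zeta>) = (\<lambda>\<zeta>. G \<zeta> * H \<zeta>)"
      using sums_mult2[OF e_sums] by (auto simp: sums_iff)
    finally show ?thesis .
  qed
  have ee: "(LINT \<zeta>|circle_measure. e m \<zeta> * cnj (e n \<zeta>)) = (if m = n then of_real ((cmod (c n))\<^sup>2) else 0)" for m n
  proof -
    have "(LINT \<zeta>|circle_measure. e m \<zeta> * cnj (e n \<zeta>)) = (LINT \<zeta>|circle_measure. (c m * cnj (c n)) * (\<zeta> ^ m * cnj \<zeta> ^ n))"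
    proof (rule integral_cong_AE)
      show "AE \<zeta> in circle_measure. e m \<zeta> * cnj (e n \<zeta>) = (c m * cnj (c n)) * (\<zeta> ^ m * cnj \<zeta> ^ n)"
        using AE_circle_measure_norm by eventually_elim (simp add: e_def S_def)
      have "(\<lambda>\<zeta>. (c m * cnj (c n)) * (\<zeta> ^ m * cnj \<zeta> ^ n)) \<in> borel_measurable borel"
        by (intro borel_measurable_continuous_onI continuous_intros)
      then show "(\<lambda>\<zeta>. (c m * cnj (c n)) * (\<zeta> ^ m * cnj \<zeta> ^ n)) \<in> borel_measurable circle_measure"
        by (simp add: measurable_cong_sets[OF sets_circle_measure refl])
    qed measurable
    also have "\<dots> = (c m * cnj (c n)) * (if m = n then 1 else 0)"
      by (simp add: circle_orthogonality)
    finally show ?thesis by (simp add: complex_norm_square del: of_real_power)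
  qed
  \<comment> \<open>Testing the expansion of \<open>G\<close> against one term isolates a
    coefficient; \<open>termwise\<close> with \<open>H = cnj G\<close> afterwards sums these
    integrals.\<close>
  have Ge: "(LINT \<zeta>|circle_measure. e n \<zeta> * cnj (G \<zeta>)) = of_real ((cmod (c n))\<^sup>2)" for n
  proof -
    have "(\<lambda>m. LINT \<zeta>|circle_measure. e m \<zeta> * cnj (e n \<zeta>)) sums (LINT \<zeta>|circle_measure. G \<zeta> * cnj (e n \<zeta>))"
      by (rule termwise[of _ "norm (c n)"]) (simp_all add: e_le)
    then have "(LINT \<zeta>|circle_measure. G \<zeta> * cnj (e n \<zeta>)) = of_real ((cmod (c n))\<^sup>2)"
      unfolding ee by (rule sums_unique2[OF _ sums_single[of n "\<lambda>_. complex_of_real ((cmod (c n))\<^sup>2)"]])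
    moreover have "(LINT \<zeta>|circle_measure. e n \<zeta> * cnj (G \<zeta>)) = cnj (LINT \<zeta>|circle_measure. G \<zeta> * cnj (e n \<zeta>))"
      using Bochner_Integration.integral_cnj[of circle_measure "\<lambda>\<zeta>. G \<zeta> * cnj (e n \<zeta>)"] by (simp add: mult.commute)
    ultimately show ?thesis by simp
  qed
  have "(\<lambda>n. complex_of_real ((cmod (c n))\<^sup>2)) sums (LINT \<zeta>|circle_measure. G \<zeta> * cnj (G \<zeta>))"
    using termwise[of "\<lambda>\<zeta>. cnj (G \<zeta>)" C] by (simp add: G_le Ge)
  also have "(LINT \<zeta>|circle_measure. G \<zeta> * cnj (G \<zeta>)) = (LINT \<zeta>|circle_measure. complex_of_real ((cmod (G \<zeta>))\<^sup>2))"
    by (simp only: complex_norm_square)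
  also have "\<dots> = of_real (LINT \<zeta>|circle_measure. (cmod (G \<zeta>))\<^sup>2)"
    by (rule integral_complex_of_real)
  finally have s: "(\<lambda>n. (cmod (c n))\<^sup>2) sums (LINT \<zeta>|circle_measure. (cmod (G \<zeta>))\<^sup>2)"
    by (simp only: sums_of_real_iff)
  have "(\<integral>\<^sup>+\<zeta>. ennreal ((cmod (F \<zeta>))\<^sup>2) \<partial>circle_measure) = (\<integral>\<^sup>+\<zeta>. ennreal ((cmod (G \<zeta>))\<^sup>2) \<partial>circle_measure)"
    by (rule nn_integral_circle_cong) (simp add: G_def S_def)
  also have "\<dots> = ennreal (LINT \<zeta>|circle_measure. (cmod (G \<zeta>))\<^sup>2)"
  proof (rule nn_integral_eq_integral)
    show "integrable circle_measure (\<lambda>\<zeta>. (cmod (G \<zeta>))\<^sup>2)"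
      by (rule circle.integrable_const_bound[of _ "C\<^sup>2"]) (auto intro!: power_mono G_le)
  qed simp
  also have "\<dots> = (\<Sum>n. ennreal ((cmod (c n))\<^sup>2))"
    using s by (intro suminf_ennreal_eq[symmetric]) auto
  finally show ?thesis .
qed

section \<open>Taylor coefficients and circle means\<close>

definition taylor_coeff :: "(complex \<Rightarrow> complex) \<Rightarrow> nat \<Rightarrow> complex" where
  "taylor_coeff f n = (deriv ^^ n) f 0 / fact n"

text \<open>The square of the integral mean M_2(r, f), with values in \<open>ennreal\<close> so that
  suprema and infinite sums can be taken freely.\<close>

definition circle_mean :: "(complex \<Rightarrow> complex) \<Rightarrow> real \<Rightarrow> ennreal" where
  "circle_mean f r = (\<integral>\<^sup>+\<zeta>. ennreal ((cmod (f (of_real r * \<zeta>)))\<^sup>2) \<partial>circle_measure)"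

lemma taylor_sums:
  assumes "f holomorphic_on unit_disc" "z \<in> unit_disc"
  shows "(\<lambda>n. taylor_coeff f n * z ^ n) sums f z"
  using holomorphic_power_series[OF assms] by (simp add: taylor_coeff_def)

lemma taylor_summable_norm:
  assumes f: "f holomorphic_on unit_disc" and r: "0 \<le> r" "r < 1"
  shows "summable (\<lambda>n. norm (taylor_coeff f n * of_real r ^ n))"
proof -
  \<comment> \<open>Convergence at the larger radius \<open>(1 + r) / 2\<close> implies absolute
    convergence at \<open>r\<close>.\<close>
  have "summable (\<lambda>n. taylor_coeff f n * (of_real ((1 + r) / 2)) ^ n)"
    by (rule sums_summable[OF taylor_sums[OF f]]) (use r in \<open>simp del: of_real_add of_real_divide\<close>)
  then show ?thesis
    by (rule powser_insidea) (use r in \<open>simp del: of_real_add of_real_divide\<close>)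
qed

lemma circle_mean_eq:
  assumes f: "f holomorphic_on unit_disc" and r: "0 \<le> r" "r < 1"
  shows "circle_mean f r = (\<Sum>n. ennreal ((cmod (taylor_coeff f n))\<^sup>2 * r ^ (2 * n)))"
proof -
  have "circle_mean f r = (\<Sum>n. ennreal ((cmod (taylor_coeff f n * of_real r ^ n))\<^sup>2))"
    unfolding circle_mean_def
  proof (rule nn_integral_circle_parseval)
    show "summable (\<lambda>n. norm (taylor_coeff f n * of_real r ^ n))" by (rule taylor_summable_norm[OF assms])
    fix \<zeta> :: complex assume "cmod \<zeta> = 1"
    then have "of_real r * \<zeta> \<in> unit_disc" using r by (simp add: norm_mult)
    from taylor_sums[OF f this] show "(\<lambda>n. taylor_coeff f n * of_real r ^ n * \<zeta> ^ n) sums f (of_real r * \<zeta>)"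
      by (simp add: power_mult_distrib mult.assoc)
  qed
  then show ?thesis using r by (simp add: norm_mult norm_power power_mult_distrib power_mult mult.commute)
qed

lemma taylor_coeff_deriv:
  "taylor_coeff (deriv f) n = of_nat (Suc n) * taylor_coeff f (Suc n)"
proof -
  have "(deriv ^^ n) (deriv f) 0 = (deriv ^^ Suc n) f 0"
    by (simp add: funpow_swap1)
  then show ?thesis by (simp add: taylor_coeff_def field_simps del: of_nat_Suc)
qed

lemma nn_integral_disc_radial:
  assumes f: "continuous_on unit_disc f" and [measurable]: "w \<in> borel_measurable borel"
  shows "(\<integral>\<^sup>+z\<in>unit_disc. ennreal ((cmod (f z))\<^sup>2) * w (cmod z) \<partial>area_measure)
       = (\<integral>\<^sup>+r\<in>{0..<1}. ennreal (2 * r) * (circle_mean f r * w r) \<partial>lborel)"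
proof -
  define F where "F z = indicator unit_disc z *\<^sub>R f z" for z
  have [measurable]: "F \<in> borel_measurable borel"
    unfolding F_def by (intro borel_measurable_continuous_on_indicator f) simp
  let ?G = "\<lambda>r::real. \<integral>\<^sup>+\<zeta>. ennreal ((cmod (F (of_real r * \<zeta>)))\<^sup>2) * w (cmod (of_real r * \<zeta>)) \<partial>circle_measure"
  have "(\<integral>\<^sup>+z\<in>unit_disc. ennreal ((cmod (f z))\<^sup>2) * w (cmod z) \<partial>area_measure)
      = (\<integral>\<^sup>+z\<in>unit_disc. ennreal ((cmod (F z))\<^sup>2) * w (cmod z) \<partial>area_measure)"
    by (intro nn_integral_cong) (simp add: F_def split: split_indicator)
  also have "\<dots> = (\<integral>\<^sup>+r\<in>{0..<1}. ennreal (2 * r) * (?G r) \<partial>lborel)"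
    by (rule nn_integral_disc_polar) measurable
  also have "\<dots> = (\<integral>\<^sup>+r\<in>{0..<1}. ennreal (2 * r) * (circle_mean f r * w r) \<partial>lborel)"
  proof (intro nn_integral_cong)
    fix r :: real
    have "(?G r) = circle_mean f r * w r"
      if r: "0 \<le> r" "r < 1"
    proof -
      have "(?G r)
          = (\<integral>\<^sup>+\<zeta>. ennreal ((cmod (F (of_real r * \<zeta>)))\<^sup>2) * w r \<partial>circle_measure)"
        by (rule nn_integral_circle_cong) (use r in \<open>simp add: norm_mult\<close>)
      also have "\<dots> = circle_mean F r * w r"
        unfolding circle_mean_def by (rule nn_integral_multc) measurable
      also have "circle_mean F r = circle_mean f r"
        unfolding circle_mean_def
        by (rule nn_integral_circle_cong) (use r in \<open>simp add: F_def norm_mult\<close>)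
      finally show ?thesis .
    qed
    then show "ennreal (2 * r) * (?G r) * indicator {0..<1} r = ennreal (2 * r) * (circle_mean f r * w r) * indicator {0..<1} r"
      by (auto split: split_indicator)
  qed
  finally show ?thesis .
qed

lemma nn_integral_FTC_Ico:
  fixes f F :: "real \<Rightarrow> real"
  assumes "f \<in> borel_measurable borel" "\<And>x. a \<le> x \<Longrightarrow> x \<le> b \<Longrightarrow> (F has_real_derivative f x) (at x)"
    "\<And>x. a \<le> x \<Longrightarrow> x \<le> b \<Longrightarrow> 0 \<le> f x" "a \<le> b"
  shows "(\<integral>\<^sup>+x\<in>{a..<b}. ennreal (f x) \<partial>lborel) = ennreal (F b - F a)"
proof -
  have "(\<integral>\<^sup>+x\<in>{a..<b}. ennreal (f x) \<partial>lborel) = (\<integral>\<^sup>+x\<in>{a..b}. ennreal (f x) \<partial>lborel)"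
    by (rule nn_integral_cong_AE, use AE_lborel_singleton[of b] in eventually_elim)
       (auto split: split_indicator)
  also have "\<dots> = ennreal (F b - F a)"
    by (rule nn_integral_FTC_Icc) (use assms in \<open>auto intro: has_field_derivative_at_within\<close>)
  finally show ?thesis .
qed

text \<open>Sub-mean value property: the constant Taylor coefficient alone bounds every circle mean
  from below, and 2r dr has total mass 1 on the unit interval.\<close>

lemma sq_norm_at_0_le_nn_integral_disc:
  assumes f: "f holomorphic_on unit_disc"
  shows "ennreal ((cmod (f 0))\<^sup>2) \<le> (\<integral>\<^sup>+z\<in>unit_disc. ennreal ((cmod (f z))\<^sup>2) \<partial>area_measure)"
proof -
  have le: "ennreal ((cmod (f 0))\<^sup>2) \<le> circle_mean f r" if "0 \<le> r" "r < 1" for r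
  proof -
    have "ennreal ((cmod (f 0))\<^sup>2) = (\<Sum>n<1. ennreal ((cmod (taylor_coeff f n))\<^sup>2 * r ^ (2 * n)))"
      by (simp add: taylor_coeff_def)
    also have "\<dots> \<le> circle_mean f r"
      unfolding circle_mean_eq[OF f that] by (rule sum_le_suminf) (auto intro: summableI)
    finally show ?thesis .
  qed
  have "ennreal ((cmod (f 0))\<^sup>2) = ennreal (1\<^sup>2 - 0\<^sup>2) * ennreal ((cmod (f 0))\<^sup>2)" by simp
  also have "ennreal (1\<^sup>2 - 0\<^sup>2) = (\<integral>\<^sup>+r\<in>{0..<1}. ennreal (2 * r) \<partial>lborel)"
    by (rule nn_integral_FTC_Ico[symmetric]) (auto intro!: derivative_eq_intros)
  also have "\<dots> * ennreal ((cmod (f 0))\<^sup>2) = (\<integral>\<^sup>+r\<in>{0..<1}. ennreal (2 * r) * ennreal ((cmod (f 0))\<^sup>2) \<partial>lborel)"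
    by (subst nn_integral_multc[symmetric]) (auto intro!: nn_integral_cong simp: mult_ac)
  also have "\<dots> \<le> (\<integral>\<^sup>+r\<in>{0..<1}. ennreal (2 * r) * (circle_mean f r * 1) \<partial>lborel)"
    by (intro nn_integral_mono) (auto intro!: mult_left_mono le split: split_indicator)
  also have "\<dots> = (\<integral>\<^sup>+z\<in>unit_disc. ennreal ((cmod (f z))\<^sup>2) * 1 \<partial>area_measure)"
    using nn_integral_disc_radial[OF holomorphic_on_imp_continuous_on[OF f], of "\<lambda>_. 1"] by simp
  finally show ?thesis by simp
qed

text \<open>The limit r -> 1 is taken inside a finite partial sum, where it is only the continuity
  of a polynomial; the infinite series is formed afterwards.\<close>

lemma suminf_taylor_coeff_le:
  assumes f: "f holomorphic_on unit_disc"
    and K: "\<And>r. 0 \<le> r \<Longrightarrow> r < 1 \<Longrightarrow> circle_mean f r \<le> K"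
  shows "(\<Sum>n. ennreal ((cmod (taylor_coeff f n))\<^sup>2)) \<le> K"
proof (rule suminf_le_const[OF summableI])
  fix N
  let ?s = "\<lambda>r. (\<Sum>n<N. ennreal ((cmod (taylor_coeff f n))\<^sup>2 * r ^ (2 * n)))"
  have "(?s \<longlongrightarrow> ?s 1) (at_left 1)"
    by (intro tendsto_intros)
  then have "?s 1 \<le> K"
  proof (rule tendsto_upperbound)
    have "eventually (\<lambda>r::real. r \<in> {0<..<1}) (at_left 1)"
      by (rule eventually_at_leftI[of 0]) auto
    then show "eventually (\<lambda>r. ?s r \<le> K) (at_left 1)"
    proof eventually_elim
      case (elim r)
      have "?s r \<le> circle_mean f r"
        using elim by (subst circle_mean_eq[OF f]) (simp, simp, intro sum_le_suminf summableI, simp_all)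
      also have "\<dots> \<le> K" using elim K by simp
      finally show ?case .
    qed
  qed simp
  then show "(\<Sum>n<N. ennreal ((cmod (taylor_coeff f n))\<^sup>2)) \<le> K" by simp
qed

text \<open>The comparison is made coefficient by coefficient: the squared n-th coefficient of f'
  carries the factor (n+1)^2, the weight integral of r^(2n) equals 1/((n+1)(n+2)), and their product
  is at most 1.\<close>

theorem littlewood_paley_le:
  assumes f: "f holomorphic_on unit_disc"
    and K: "\<And>r. 0 \<le> r \<Longrightarrow> r < 1 \<Longrightarrow> circle_mean f r \<le> K"
  shows "(\<integral>\<^sup>+z\<in>unit_disc. ennreal ((cmod (deriv f z))\<^sup>2 * (1 - (cmod z)\<^sup>2)) \<partial>area_measure) \<le> K"
proof -
  let ?D = "\<lambda>n. ennreal ((cmod (taylor_coeff (deriv f) n))\<^sup>2)"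
  let ?W = "\<lambda>n. \<integral>\<^sup>+r\<in>{0..<1}. ennreal (2 * r * (1 - r\<^sup>2) * r ^ (2 * n)) \<partial>lborel"
  have df: "deriv f holomorphic_on unit_disc" using f by (intro holomorphic_deriv) auto
  have "(\<integral>\<^sup>+z\<in>unit_disc. ennreal ((cmod (deriv f z))\<^sup>2 * (1 - (cmod z)\<^sup>2)) \<partial>area_measure)
      = (\<integral>\<^sup>+z\<in>unit_disc. ennreal ((cmod (deriv f z))\<^sup>2) * ennreal (1 - (cmod z)\<^sup>2) \<partial>area_measure)"
    by (simp add: ennreal_mult')
  also have "\<dots> = (\<integral>\<^sup>+r\<in>{0..<1}. ennreal (2 * r) * (circle_mean (deriv f) r * ennreal (1 - r\<^sup>2)) \<partial>lborel)"
    by (rule nn_integral_disc_radial[OF holomorphic_on_imp_continuous_on[OF df]]) measurable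
  also have "\<dots> = (\<integral>\<^sup>+r. (\<Sum>n. ?D n * (ennreal (2 * r * (1 - r\<^sup>2) * r ^ (2 * n)) * indicator {0..<1} r)) \<partial>lborel)"
  proof (intro nn_integral_cong)
    fix r :: real
    show "ennreal (2 * r) * (circle_mean (deriv f) r * ennreal (1 - r\<^sup>2)) * indicator {0..<1} r
        = (\<Sum>n. ?D n * (ennreal (2 * r * (1 - r\<^sup>2) * r ^ (2 * n)) * indicator {0..<1} r))"
    proof (cases "0 \<le> r \<and> r < 1")
      case True
      then have r2: "0 \<le> 1 - r\<^sup>2" by (simp add: power_le_one)
      have "ennreal (2 * r) * (circle_mean (deriv f) r * ennreal (1 - r\<^sup>2)) = ennreal (2 * r * (1 - r\<^sup>2)) * circle_mean (deriv f) r"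
        using True r2 ennreal_mult[of "2 * r" "1 - r\<^sup>2"] by (simp only: mult_ac) simp
      also have "\<dots> = (\<Sum>n. ennreal (2 * r * (1 - r\<^sup>2)) * ennreal ((cmod (taylor_coeff (deriv f) n))\<^sup>2 * r ^ (2 * n)))"
        using True by (simp add: circle_mean_eq[OF df])
      also have "\<dots> = (\<Sum>n. ?D n * (ennreal (2 * r * (1 - r\<^sup>2) * r ^ (2 * n))))"
        using True r2 by (intro suminf_cong) (simp add: mult_ac flip: ennreal_mult)
      finally show ?thesis using True by simp
    qed simp
  qed
  also have "\<dots> = (\<Sum>n. ?D n * (?W n))"
    by (subst nn_integral_suminf) (simp_all add: nn_integral_cmult)
  also have "\<dots> \<le> (\<Sum>n. ennreal ((cmod (taylor_coeff f (Suc n)))\<^sup>2))"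
  proof (rule suminf_le[OF _ summableI summableI])
    \<comment> \<open>The radial weight integrates to 1/(n+1) - 1/(n+2).\<close>
    fix n
    have "(?W n)
        = ennreal ((1 ^ (2*n+2) / real (n+1) - 1 ^ (2*n+4) / real (n+2)) - (0 ^ (2*n+2) / real (n+1) - 0 ^ (2*n+4) / real (n+2)))"
    proof (rule nn_integral_FTC_Ico)
      fix x :: real assume "0 \<le> x" "x \<le> 1"
      then show "0 \<le> 2 * x * (1 - x\<^sup>2) * x ^ (2 * n)" by (simp add: power_le_one)
      show "((\<lambda>x. x ^ (2*n+2) / real (n+1) - x ^ (2*n+4) / real (n+2)) has_real_derivative 2 * x * (1 - x\<^sup>2) * x ^ (2 * n)) (at x)"
      proof -
        have "((\<lambda>x. x ^ (2*n+2) / real (n+1)) has_real_derivative real (2*n+2) * x ^ (2*n+1) / real (n+1)) (at x)"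
          using DERIV_cdivide[OF DERIV_pow[of "2*n+2" x UNIV], of "real (n+1)"] by simp
        moreover have "((\<lambda>x. x ^ (2*n+4) / real (n+2)) has_real_derivative real (2*n+4) * x ^ (2*n+3) / real (n+2)) (at x)"
          using DERIV_cdivide[OF DERIV_pow[of "2*n+4" x UNIV], of "real (n+2)"] by (simp add: eval_nat_numeral)
        ultimately have D: "((\<lambda>x. x ^ (2*n+2) / real (n+1) - x ^ (2*n+4) / real (n+2)) has_real_derivative
            real (2*n+2) * x ^ (2*n+1) / real (n+1) - real (2*n+4) * x ^ (2*n+3) / real (n+2)) (at x)"
          by (rule DERIV_diff)
        have c: "real (2*n+2) * y / real (n+1) = 2 * y" "real (2*n+4) * y / real (n+2) = 2 * y" for y
          by (simp_all add: field_simps)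
        have "2 * x ^ (2*n+1) - 2 * x ^ (2*n+3) = 2 * x * (1 - x\<^sup>2) * x ^ (2 * n)"
          by (simp add: power_add algebra_simps power2_eq_square power3_eq_cube)
        with D show ?thesis unfolding c by (simp only:)
      qed
    qed auto
    also have "\<dots> = ennreal (1 / (real (n+1) * real (n+2)))"
      by (simp add: field_simps)
    finally have I: "(?W n) = ennreal (1 / (real (n+1) * real (n+2)))" .
    have "real (n+1) ^ 2 * (1 / (real (n+1) * real (n+2))) \<le> 1"
      by (simp add: divide_simps power2_eq_square)
    then have "(cmod (taylor_coeff f (Suc n)))\<^sup>2 * (real (n+1) ^ 2 * (1 / (real (n+1) * real (n+2)))) \<le> (cmod (taylor_coeff f (Suc n)))\<^sup>2 * 1"
      by (intro mult_left_mono) auto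
    moreover have "cmod (taylor_coeff (deriv f) n) = real (n+1) * cmod (taylor_coeff f (Suc n))"
      by (simp only: taylor_coeff_deriv norm_mult norm_of_nat) simp
    ultimately show "?D n * (?W n)
        \<le> ennreal ((cmod (taylor_coeff f (Suc n)))\<^sup>2)"
      unfolding I by (subst ennreal_mult[symmetric]) (auto simp: power_mult_distrib mult_ac intro!: ennreal_leI)
  qed
  \<comment> \<open>Differentiation has dropped the coefficient of index 0; putting it back only
    increases the sum.\<close>
  also have "\<dots> \<le> (\<Sum>n. ennreal ((cmod (taylor_coeff f n))\<^sup>2))" (is "_ \<le> suminf ?a")
  proof (rule suminf_le_const[OF summableI])
    fix N
    have "(\<Sum>n<N. ?a (Suc n)) \<le> (\<Sum>n<Suc N. ?a n)"
      unfolding sum.lessThan_Suc_shift by (rule add_increasing) simp_all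
    also have "\<dots> \<le> suminf ?a"
      by (intro sum_le_suminf summableI) simp_all
    finally show "(\<Sum>n<N. ?a (Suc n)) \<le> suminf ?a" .
  qed
  also have "\<dots> \<le> K" by (rule suminf_taylor_coeff_le[OF assms])
  finally show ?thesis .
qed

section \<open>Boundary values in the Hardy space\<close>

lemma borel_measurable_disc_restrict:
  fixes f :: "complex \<Rightarrow> complex"
  assumes "continuous_on unit_disc f"
  shows "(\<lambda>z. indicator unit_disc z *\<^sub>R f z) \<in> borel_measurable borel"
  by (intro borel_measurable_continuous_on_indicator assms) simp

lemma circle_mean_eq_integral:
  assumes f: "continuous_on unit_disc f" and r: "0 \<le> r" "r < 1"
  shows "circle_mean f r = ennreal (1 / (2 * pi) * integral {0..2 * pi} (\<lambda>t. (cmod (f (of_real r * cis t)))\<^sup>2))"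
proof -
  define F where "F z = indicator unit_disc z *\<^sub>R f z" for z
  have [measurable]: "F \<in> borel_measurable borel"
    unfolding F_def by (rule borel_measurable_disc_restrict[OF f])
  let ?g = "\<lambda>t. (cmod (f (of_real r * cis t)))\<^sup>2"
  have Fg: "F (of_real r * cis t) = f (of_real r * cis t)" for t
    using r by (simp add: F_def norm_mult)
  have cont: "continuous_on {0..2*pi} ?g"
    using r by (intro continuous_intros continuous_on_compose2[OF f]) (auto simp: norm_mult)
  have si: "set_integrable lborel {0..2*pi} ?g"
    unfolding set_integrable_def by (rule borel_integrable_compact) (use cont in auto)
  have "circle_mean f r = (\<integral>\<^sup>+\<zeta>. ennreal ((cmod (F (of_real r * \<zeta>)))\<^sup>2) \<partial>circle_measure)"
    unfolding circle_mean_def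
    by (rule nn_integral_circle_cong) (use r in \<open>simp add: F_def norm_mult\<close>)
  also have "\<dots> = (\<integral>\<^sup>+t\<in>{0..<2*pi}. ennreal (?g t) \<partial>lborel) / ennreal (2*pi)"
    by (subst nn_integral_circle_measure) (simp_all add: Fg)
  also have "(\<integral>\<^sup>+t\<in>{0..<2*pi}. ennreal (?g t) \<partial>lborel) = (\<integral>\<^sup>+t. ennreal (indicator {0..2*pi} t *\<^sub>R ?g t) \<partial>lborel)"
    by (rule nn_integral_cong_AE, use AE_lborel_singleton[of "2*pi"] in eventually_elim) (auto split: split_indicator)
  also have "\<dots> = ennreal (LINT t:{0..2*pi}|lborel. ?g t)"
    using si unfolding set_integrable_def set_lebesgue_integral_def by (intro nn_integral_eq_integral) auto
  also have "(LINT t:{0..2*pi}|lborel. ?g t) = integral {0..2*pi} ?g"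
    by (rule set_borel_integral_eq_integral(2)[OF si])
  also have "ennreal (integral {0..2*pi} ?g) / ennreal (2*pi) = ennreal (1 / (2 * pi) * integral {0..2 * pi} ?g)"
    by (subst divide_ennreal) (auto intro!: integral_nonneg integrable_continuous_real cont)
  finally show ?thesis .
qed

lemma hardy2_iff:
  "f \<in> hardy2 \<longleftrightarrow> f holomorphic_on unit_disc \<and> (\<exists>M. \<forall>r\<in>{0..<1}. circle_mean f r \<le> ennreal M)"
proof (cases "f holomorphic_on unit_disc")
  case True
  then have c: "continuous_on unit_disc f" by (rule holomorphic_on_imp_continuous_on)
  let ?m = "\<lambda>r. 1 / (2 * pi) * integral {0..2 * pi} (\<lambda>t. (cmod (f (of_real r * cis t)))\<^sup>2)"
  have nn: "0 \<le> ?m r" if "r \<in> {0..<1}" for r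
    using that c by (intro mult_nonneg_nonneg integral_nonneg integrable_continuous_real)
      (auto intro!: continuous_intros continuous_on_compose2[OF c] simp: norm_mult)
  have "(\<exists>M. \<forall>r\<in>{0..<1}. ?m r \<le> M) \<longleftrightarrow> (\<exists>M. \<forall>r\<in>{0..<1}. circle_mean f r \<le> ennreal M)"
  proof
    assume "\<exists>M. \<forall>r\<in>{0..<1}. ?m r \<le> M"
    then show "\<exists>M. \<forall>r\<in>{0..<1}. circle_mean f r \<le> ennreal M"
      using circle_mean_eq_integral[OF c] by (auto intro: ennreal_leI)
  next
    assume "\<exists>M. \<forall>r\<in>{0..<1}. circle_mean f r \<le> ennreal M"
    then obtain M where M: "\<And>r. r \<in> {0..<1} \<Longrightarrow> circle_mean f r \<le> ennreal M" by blast
    \<comment> \<open>\<open>ennreal\<close> sends a negative \<open>M\<close> to 0, so the real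
      bound has to be \<open>max 0 M\<close>.\<close>
    have "?m r \<le> max 0 M" if "r \<in> {0..<1}" for r
    proof -
      have "ennreal (?m r) \<le> ennreal (max 0 M)"
        using M[OF that] circle_mean_eq_integral[OF c, of r] that by (simp add: ennreal_max_0)
      then show ?thesis by (subst (asm) ennreal_le_iff) auto
    qed
    then show "\<exists>M. \<forall>r\<in>{0..<1}. ?m r \<le> M" by blast
  qed
  then show ?thesis using True by (simp add: hardy2_def)
qed (simp add: hardy2_def)

text \<open>Coefficientwise this is (s^n - r^n)^2 + r^(2n) \<le> s^(2n), true because 2 r^n (s^n -
  r^n) \<ge> 0. The L^2 distance of two dilations is thus controlled by the increase of the circle
  means, so bounded means give a Cauchy family as the radius tends to 1.\<close>

lemma circle_mean_diff:
  assumes f: "f holomorphic_on unit_disc" and r: "0 \<le> r" "r \<le> s" "s < 1"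
  shows "(\<integral>\<^sup>+\<zeta>. ennreal ((cmod (f (of_real r * \<zeta>) - f (of_real s * \<zeta>)))\<^sup>2) \<partial>circle_measure) + circle_mean f r \<le> circle_mean f s"
proof -
  let ?c = "\<lambda>n. taylor_coeff f n * of_real r ^ n - taylor_coeff f n * of_real s ^ n"
  have "(\<integral>\<^sup>+\<zeta>. ennreal ((cmod (f (of_real r * \<zeta>) - f (of_real s * \<zeta>)))\<^sup>2) \<partial>circle_measure)
      = (\<Sum>n. ennreal ((cmod (?c n))\<^sup>2))"
  proof (rule nn_integral_circle_parseval)
    have "summable (\<lambda>n. norm (taylor_coeff f n * of_real r ^ n) + norm (taylor_coeff f n * of_real s ^ n))"
      using r by (intro summable_add taylor_summable_norm[OF f]) auto
    then show "summable (\<lambda>n. norm (?c n))"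
      by (rule summable_comparison_test') (simp add: norm_triangle_ineq4)
    fix \<zeta> :: complex assume "cmod \<zeta> = 1"
    then have "of_real r * \<zeta> \<in> unit_disc" "of_real s * \<zeta> \<in> unit_disc" using r by (simp_all add: norm_mult)
    from sums_diff[OF taylor_sums[OF f this(1)] taylor_sums[OF f this(2)]]
    show "(\<lambda>n. (?c n) * \<zeta> ^ n) sums (f (of_real r * \<zeta>) - f (of_real s * \<zeta>))"
      by (simp add: power_mult_distrib algebra_simps)
  qed
  also have "\<dots> + circle_mean f r = (\<Sum>n. ennreal ((cmod (?c n))\<^sup>2) + ennreal ((cmod (taylor_coeff f n))\<^sup>2 * r ^ (2 * n)))"
    using r by (simp add: circle_mean_eq[OF f] suminf_add summableI)
  also have "\<dots> \<le> circle_mean f s"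
    using r unfolding circle_mean_eq[OF f order_trans[OF r(1,2)] r(3)]
  proof (intro suminf_le summableI)
    fix n
    have rs: "0 \<le> r ^ n" "r ^ n \<le> s ^ n" using r by (auto intro: power_mono)
    have "cmod (?c n) = cmod (taylor_coeff f n) * \<bar>r ^ n - s ^ n\<bar>"
      by (simp flip: right_diff_distrib of_real_power of_real_diff add: norm_mult del: of_real_diff of_real_power)
    then have "(cmod (?c n))\<^sup>2 + (cmod (taylor_coeff f n))\<^sup>2 * r ^ (2 * n)
       = (cmod (taylor_coeff f n))\<^sup>2 * ((r ^ n - s ^ n)\<^sup>2 + (r ^ n)\<^sup>2)"
      by (simp add: power_mult_distrib algebra_simps power_mult[symmetric])
    also have "\<dots> \<le> (cmod (taylor_coeff f n))\<^sup>2 * (s ^ n)\<^sup>2"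
    proof (rule mult_left_mono)
      have "2 * r ^ n * (s ^ n - r ^ n) \<ge> 0" using rs by simp
      then show "(r ^ n - s ^ n)\<^sup>2 + (r ^ n)\<^sup>2 \<le> (s ^ n)\<^sup>2" by (simp add: power2_eq_square algebra_simps)
    qed simp
    finally show "ennreal ((cmod (?c n))\<^sup>2) + ennreal ((cmod (taylor_coeff f n))\<^sup>2 * r ^ (2 * n)) \<le> ennreal ((cmod (taylor_coeff f n))\<^sup>2 * s ^ (2 * n))"
      using r by (subst ennreal_plus[symmetric]) (auto intro!: ennreal_leI simp: power_even_eq simp del: ennreal_plus)
  qed
  finally show ?thesis .
qed

lemma sq_norm_add_le: "(norm (a + b))\<^sup>2 \<le> 2 * (norm a)\<^sup>2 + 2 * (norm b)\<^sup>2"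
proof -
  have "(norm (a + b))\<^sup>2 \<le> (norm a + norm b)\<^sup>2" by (intro power_mono norm_triangle_ineq) simp
  also have "\<dots> \<le> 2 * (norm a)\<^sup>2 + 2 * (norm b)\<^sup>2"
    using sum_squares_bound[of "norm a" "norm b"] by (simp add: power2_sum)
  finally show ?thesis .
qed

text \<open>Take a radius r whose mean is within e/3 of the supremum. By
  \<open>circle_mean_diff\<close> all later dilations stay within e/3 of the r-dilation in squared
  L^2 distance, and Fatou's lemma passes this on to the boundary function. The factor 2 comes from
  \<open>sq_norm_add_le\<close> and affects constants only.\<close>

lemma circle_mean_le_boundary:
  assumes h: "f \<in> hardy2" and b: "boundary_function f v" and s: "0 \<le> s" "s < 1"
  shows "circle_mean f s \<le> 2 * (\<integral>\<^sup>+\<zeta>. ennreal ((cmod (v \<zeta>))\<^sup>2) \<partial>circle_measure)" (is "_ \<le> 2 * ?V")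
proof -
  have f: "f holomorphic_on unit_disc" using h by (simp add: hardy2_def)
  obtain M where M: "\<And>r. r \<in> {0..<1} \<Longrightarrow> circle_mean f r \<le> ennreal M"
    using h unfolding hardy2_iff by blast
  have [measurable]: "v \<in> borel_measurable borel" using b by (simp add: boundary_function_def)
  \<comment> \<open>Off the disc \<open>f\<close> is arbitrary; its cut-off \<open>F\<close> is
    Borel, as Fatou's lemma requires of the integrands.\<close>
  define F where "F z = indicator unit_disc z *\<^sub>R f z" for z
  have [measurable]: "F \<in> borel_measurable borel"
    unfolding F_def by (rule borel_measurable_disc_restrict[OF holomorphic_on_imp_continuous_on[OF f]])
  have Ff: "F (of_real r * \<zeta>) = f (of_real r * \<zeta>)" if "0 \<le> r" "r < 1" "cmod \<zeta> = 1" for r \<zeta>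
    using that by (simp add: F_def norm_mult)
  have cmF: "circle_mean f r = circle_mean F r" if "0 \<le> r" "r < 1" for r
    unfolding circle_mean_def
    by (rule nn_integral_circle_cong) (use that in \<open>simp add: Ff\<close>)
  define S where "S = (SUP r\<in>{0..<1}. circle_mean f r)"
  have S: "circle_mean f r \<le> S" if "0 \<le> r" "r < 1" for r
    unfolding S_def by (rule SUP_upper) (use that in auto)
  have "S \<le> ennreal M" unfolding S_def by (rule SUP_least) (rule M)
  then have Sfin: "S < top" by (rule le_less_trans) simp
  have eps: "S \<le> 2 * ?V + ennreal e" if e: "e > 0" for e
  proof -
    obtain r where r: "0 \<le> r" "r < 1" and Sr: "S \<le> circle_mean f r + ennreal (e / 3)"
    proof (cases "S = 0")
      case True then show ?thesis using that[of 0] by simp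
    next
      case False
      then have "S - ennreal (e / 3) < S"
        using Sfin e by (intro ennreal_between) (auto simp: less_top zero_less_iff_neq_zero)
      then obtain r where "r \<in> {0..<1}" "S - ennreal (e / 3) < circle_mean f r"
        unfolding S_def less_SUP_iff by auto
      then show ?thesis using that[of r] by (auto simp: ennreal_minus_le_iff add.commute dest: less_imp_le)
    qed
    let ?E = "\<lambda>\<zeta>. ennreal ((cmod (F (of_real r * \<zeta>) - v \<zeta>))\<^sup>2)"
    have D: "(\<integral>\<^sup>+\<zeta>. ennreal ((cmod (F (of_real r * \<zeta>) - F (of_real s * \<zeta>)))\<^sup>2) \<partial>circle_measure) \<le> ennreal (e / 3)"
      (is "?D s \<le> _") if s: "r \<le> s" "s < 1" for s
    proof -
      have "?D s = (\<integral>\<^sup>+\<zeta>. ennreal ((cmod (f (of_real r * \<zeta>) - f (of_real s * \<zeta>)))\<^sup>2) \<partial>circle_measure)"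
        by (rule nn_integral_circle_cong) (use r s in \<open>simp add: Ff\<close>)
      then have "?D s + circle_mean f r \<le> circle_mean f s" using circle_mean_diff[OF f r(1) s] by simp
      also have "\<dots> \<le> ennreal (e / 3) + circle_mean f r" using S[of s] Sr r s by (simp add: add.commute)
      \<comment> \<open>Cancellation in \<open>ennreal\<close> requires the cancelled mean to be
        finite, which \<open>Sfin\<close> provides.\<close>
      finally show ?thesis
        using S[OF r] Sfin by (subst (asm) ennreal_add_left_cancel_le[of "circle_mean f r", simplified add.commute]) (auto simp: add.commute)
    qed
    \<comment> \<open>Fatou's lemma is about sequences, so the radial limit is sampled along radii
      in [r, 1) that tend to 1; at \<open>k = 0\<close> the radius is \<open>r\<close>
      itself.\<close>
    define t where "t k = 1 - (1 - r) / real (Suc k)" for k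
    let ?U = "\<lambda>\<zeta> k. ennreal ((cmod (F (of_real r * \<zeta>) - F (of_real (t k) * \<zeta>)))\<^sup>2)"
    have t: "r \<le> t k" "t k < 1" for k
    proof -
      have "(1 - r) / real (Suc k) \<le> (1 - r) / 1" using r by (intro divide_left_mono) auto
      then show "r \<le> t k" by (simp add: t_def)
      show "t k < 1" using r by (simp add: t_def)
    qed
    have "t \<longlonglongrightarrow> 1 - 0" unfolding t_def by (intro tendsto_diff tendsto_const LIMSEQ_Suc lim_const_over_n)
    then have tl: "filterlim t (at_left 1) sequentially"
      by (intro tendsto_imp_filterlim_at_left) (auto simp: t)
    have "(\<integral>\<^sup>+\<zeta>. ?E \<zeta> \<partial>circle_measure)
        = (\<integral>\<^sup>+\<zeta>. liminf (?U \<zeta>) \<partial>circle_measure)"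
    proof (rule nn_integral_cong_AE)
      have "AE \<zeta> in circle_measure. ((\<lambda>r. f (of_real r * \<zeta>)) \<longlongrightarrow> v \<zeta>) (at_left (1::real))"
        using b by (simp add: boundary_function_def)
      then show "AE \<zeta> in circle_measure. ?E \<zeta> =
          liminf (?U \<zeta>)"
        using AE_circle_measure_norm
      proof eventually_elim
        case (elim \<zeta>)
        have "(\<lambda>k. f (of_real (t k) * \<zeta>)) \<longlonglongrightarrow> v \<zeta>"
          by (rule filterlim_compose[OF elim(1) tl])
        moreover have "F (of_real (t k) * \<zeta>) = f (of_real (t k) * \<zeta>)" for k
          using t[of k] r elim by (intro Ff) auto
        ultimately have "(\<lambda>k. F (of_real (t k) * \<zeta>)) \<longlonglongrightarrow> v \<zeta>" by simp
        then have "(?U \<zeta>) \<longlonglongrightarrow> ?E \<zeta>"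
          by (intro tendsto_intros)
        then show ?case by (rule lim_imp_Liminf[OF trivial_limit_sequentially, symmetric])
      qed
    qed
    also have "\<dots> \<le> liminf (\<lambda>k. ?D (t k))"
      by (rule nn_integral_liminf) measurable
    also have "\<dots> \<le> liminf (\<lambda>k. ennreal (e / 3))"
      by (intro Liminf_mono always_eventually allI D t)
    finally have Dv: "(\<integral>\<^sup>+\<zeta>. ?E \<zeta> \<partial>circle_measure) \<le> ennreal (e / 3)" (is "?W \<le> _")
      by (simp add: Liminf_const)
    have pt: "ennreal ((cmod (F (of_real r * \<zeta>)))\<^sup>2) \<le> 2 * ennreal ((cmod (v \<zeta>))\<^sup>2) + 2 * ?E \<zeta>" for \<zeta>
      using ennreal_leI[OF sq_norm_add_le[of "v \<zeta>" "F (of_real r * \<zeta>) - v \<zeta>"]]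
      by (simp add: ennreal_mult)
    have "circle_mean f r \<le> (\<integral>\<^sup>+\<zeta>. 2 * ennreal ((cmod (v \<zeta>))\<^sup>2) + 2 * ?E \<zeta> \<partial>circle_measure)"
      unfolding cmF[OF r] unfolding circle_mean_def using pt by (intro nn_integral_mono)
    also have "\<dots> = 2 * ?V + 2 * ?W"
      by (subst nn_integral_add) (simp_all add: nn_integral_cmult)
    also have "\<dots> \<le> 2 * ?V + 2 * ennreal (e / 3)"
      by (intro add_left_mono mult_left_mono Dv) simp
    finally have "S \<le> 2 * ?V + 2 * ennreal (e / 3) + ennreal (e / 3)"
      using Sr by (meson add_right_mono order_trans)
    also have "\<dots> = 2 * ?V + (ennreal 2 * ennreal (e / 3) + ennreal (e / 3))" by (simp add: add.assoc)
    also have "ennreal 2 * ennreal (e / 3) + ennreal (e / 3) = ennreal e"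
      using e by (simp flip: ennreal_mult ennreal_plus del: ennreal_numeral)
    finally show ?thesis .
  qed
  have "S \<le> 2 * ?V" by (rule ennreal_le_epsilon[OF eps])
  with S[OF s] show ?thesis by (rule order_trans)
qed

section \<open>Arcs and Carleson boxes\<close>

lemma weight_sq_le: "0 \<le> 1 - cmod z \<Longrightarrow> 1 - (cmod z)\<^sup>2 \<le> 2 * (1 - cmod z)"
proof -
  assume z: "0 \<le> 1 - cmod z"
  have "1 - (cmod z)\<^sup>2 = (1 - cmod z) * (1 + cmod z)" by (simp add: power2_eq_square algebra_simps)
  also have "\<dots> \<le> (1 - cmod z) * 2" using z by (intro mult_left_mono) auto
  finally show ?thesis by simp
qed

lemma norm_cis_diff: "cmod (cis s - cis t) = 2 * \<bar>sin ((s - t) / 2)\<bar>"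
proof -
  have "cis s - cis t = cis t * (cis (s - t) - 1)" by (simp add: algebra_simps cis_mult)
  then show ?thesis using dist_exp_i_1[of "s - t"] by (simp add: norm_mult cis_conv_exp)
qed

text \<open>Concavity of the sine on [0, pi], applied to the chord from 0 to pi/2.\<close>

lemma Jordan_sin_ge:
  fixes x :: real assumes "0 \<le> x" "x \<le> pi / 2"
  shows "2 * x / pi \<le> sin x"
proof -
  have "convex_on {0..pi} (\<lambda>x::real. - sin x)"
  proof (rule f''_ge0_imp_convex)
    fix x :: real assume "x \<in> {0..pi}"
    then show "0 \<le> sin x" by (auto intro: sin_ge_zero)
  qed (auto intro!: derivative_eq_intros)
  from convex_onD[OF this, of "2 * x / pi" 0 "pi / 2"] assms
  show ?thesis by (simp add: field_simps)
qed

text \<open>Arcs are parametrized by midpoint angle and normalized length, because the kernel and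
  the dyadic dilations both refer to the midpoint. Normalized length \<open>l\<close> means the
  half-angle \<open>pi * l\<close>.\<close>

definition circ_arc :: "real \<Rightarrow> real \<Rightarrow> complex set" where
  "circ_arc t l = cis ` {t - pi * l .. t + pi * l}"

lemma arc_in_circle_arcs: "0 < l \<Longrightarrow> l \<le> 1 \<Longrightarrow> circ_arc t l \<in> circle_arcs"
  unfolding circle_arcs_def circ_arc_def
  by (rule CollectI, rule exI[of _ "t - pi * l"], rule exI[of _ "t + pi * l"]) auto

lemma circle_arcs_cases:
  assumes "I \<in> circle_arcs"
  obtains t l where "0 < l" "l \<le> 1" "I = circ_arc t l"
proof -
  obtain a b where ab: "I = cis ` {a..b}" "a < b" "b \<le> a + 2 * pi"
    using assms by (auto simp: circle_arcs_def)
  have "pi * ((b - a) / (2 * pi)) = (b - a) / 2" by simp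
  then have "I = circ_arc ((a + b) / 2) ((b - a) / (2 * pi))"
    unfolding circ_arc_def ab by (simp add: field_simps)
  then show ?thesis using ab by (intro that[of "(b - a) / (2 * pi)"]) auto
qed

lemma arc_length_arc: "0 < l \<Longrightarrow> l \<le> 1 \<Longrightarrow> arc_length (circ_arc t l) = l"
  unfolding circ_arc_def by (subst arc_length_cis_image) auto

lemma measurable_arc [measurable]: "circ_arc t l \<in> sets borel"
  unfolding circ_arc_def
  by (intro borel_compact compact_continuous_image continuous_intros) auto

lemma emeasure_arc: "0 < l \<Longrightarrow> l \<le> 1 \<Longrightarrow> emeasure circle_measure (circ_arc t l) = ennreal l"
  using arc_length_arc[of l t] by (simp add: circle.emeasure_eq_measure arc_length_def)

text \<open>Jordan's inequality turns a chord into an angle: a point at angle a from the midpoint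
  has chord 2|sin(a/2)| \<ge> 2|a|/pi, so a chord of at most 2l forces |a| \<le> pi l.\<close>

lemma norm_eq_1_imp_arc:
  assumes z: "cmod z = 1" and d: "cmod (z - cis t) \<le> 2 * l"
  shows "z \<in> circ_arc t l"
proof -
  define a where "a = Arg (z / cis t)"
  have z_eq: "z = cis (t + a)"
    using z rcis_cmod_Arg[of "z / cis t"] by (simp add: a_def rcis_def norm_divide cis_mult[symmetric] mult.commute)
  have a: "\<bar>a\<bar> \<le> pi"
    using Arg_bounded[of "z / cis t"] by (auto simp: a_def)
  have "2 * \<bar>a\<bar> / pi = 2 * (2 * (\<bar>a\<bar> / 2) / pi)" by simp
  also have "\<dots> \<le> 2 * sin (\<bar>a\<bar> / 2)" using a by (intro mult_left_mono Jordan_sin_ge) auto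
  also have "\<dots> \<le> 2 * \<bar>sin (a / 2)\<bar>" by (auto simp: abs_if)
  also have "\<dots> \<le> 2 * l" using d norm_cis_diff[of "t + a" t] by (simp add: z_eq)
  finally have "\<bar>a\<bar> \<le> pi * l" by (simp add: field_simps)
  then show ?thesis unfolding circ_arc_def z_eq by (intro imageI) auto
qed

lemma arc_norm_diff_le:
  assumes "z \<in> circ_arc t l"
  shows "cmod (z - cis t) \<le> pi * l"
proof -
  obtain s where s: "z = cis s" "\<bar>s - t\<bar> \<le> pi * l" using assms by (auto simp: circ_arc_def)
  have "\<bar>sin ((s - t) / 2)\<bar> \<le> \<bar>(s - t) / 2\<bar>" by (rule abs_sin_x_le_abs_x)
  then show ?thesis using s by (simp add: norm_cis_diff)
qed

lemma arc_1: "circ_arc t 1 = sphere 0 1"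
proof
  show "sphere 0 1 \<subseteq> circ_arc t 1"
  proof
    fix z :: complex assume z: "z \<in> sphere 0 1"
    then have "cmod (z - cis t) \<le> 2 * 1" using norm_triangle_ineq4[of z "cis t"] by simp
    then show "z \<in> circ_arc t 1" using z by (intro norm_eq_1_imp_arc) auto
  qed
qed (auto simp: circ_arc_def)

section \<open>Carleson boxes compared with discs about the midpoint of the arc\<close>

lemma carleson_box_arc_1: "carleson_box (circ_arc t 1) = unit_disc"
  by (simp add: carleson_box_def arc_1)

lemma carleson_box_subset_disc: "carleson_box I \<subseteq> unit_disc"
  by (auto simp: carleson_box_def split: if_splits)

lemma carleson_boxI:
  assumes l: "0 < l" "l \<le> 1" and z: "z \<in> unit_disc" "cmod (z - cis t) \<le> l"
  shows "z \<in> carleson_box (circ_arc t l)"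
proof (cases "circ_arc t l = sphere 0 1")
  case True then show ?thesis using z by (simp add: carleson_box_def)
next
  case False
  then have "l \<noteq> 1" using arc_1 by auto
  with l have l1: "l < 1" by simp
  have z0: "z \<noteq> 0" using z l1 by auto
  have nz: "1 - cmod z \<le> l" using z norm_triangle_ineq2[of "cis t" z] by (simp add: norm_minus_commute)
  have "cmod (z / of_real (cmod z) - z) = \<bar>1 - cmod z\<bar>"
  proof -
    have "z / of_real (cmod z) - z = (z / of_real (cmod z)) * of_real (1 - cmod z)" using z0 by (simp add: field_simps)
    then have "cmod (z / of_real (cmod z) - z) = cmod (z / of_real (cmod z)) * \<bar>1 - cmod z\<bar>"
      by (simp only: norm_mult norm_of_real)
    then show ?thesis using z0 by (simp add: norm_divide)
  qed
  also have "\<dots> \<le> l" using nz z by simp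
  finally have "cmod (z / of_real (cmod z) - z) \<le> l" .
  then have "cmod ((z / of_real (cmod z) - z) + (z - cis t)) \<le> l + l"
    using z by (intro norm_triangle_le add_mono) auto
  then have "z / of_real (cmod z) \<in> circ_arc t l"
    using z0 by (intro norm_eq_1_imp_arc) (auto simp: norm_divide)
  then show ?thesis using False z nz by (simp add: carleson_box_def arc_length_arc l)
qed

text \<open>For the third bound, a point of the box is within l of its projection, and the
  projection is within pi l < 4l of the midpoint; hence the 5.\<close>

lemma carleson_boxD:
  assumes l: "0 < l" "l \<le> 1" and z: "z \<in> carleson_box (circ_arc t l)"
  shows "cmod z < 1" "1 - l \<le> cmod z" "cmod (z - cis t) \<le> 5 * l"
    "z \<noteq> 0 \<Longrightarrow> z / of_real (cmod z) \<in> circ_arc t l"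
proof -
  show z1: "cmod z < 1" using z carleson_box_subset_disc[of "circ_arc t l"] by auto
  \<comment> \<open>The box over the whole circle is the full disc and contains 0, while
    \<open>0 / 0 = 0\<close> is not on the circle; hence the proviso
    \<open>z \<noteq> 0\<close>.\<close>
  have *: "1 - l \<le> cmod z \<and> (z \<noteq> 0 \<longrightarrow> z / of_real (cmod z) \<in> circ_arc t l)"
  proof (cases "circ_arc t l = sphere 0 1")
    case True
    have "l = 1" using arc_length_arc[OF l, of t] arc_length_arc[of 1 t] True arc_1[of t] by simp
    then show ?thesis using True by (auto simp: norm_divide)
  qed (use z arc_length_arc[OF l] in \<open>auto simp: carleson_box_def\<close>)
  then show b: "1 - l \<le> cmod z" by simp
  show "z / of_real (cmod z) \<in> circ_arc t l" if "z \<noteq> 0" using * that by simp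
  show "cmod (z - cis t) \<le> 5 * l"
  proof (cases "z = 0")
    case True then show ?thesis using b l by simp
  next
    case False
    have "cmod (z - z / of_real (cmod z)) = \<bar>1 - cmod z\<bar>"
    proof -
      have "z - z / of_real (cmod z) = (z / of_real (cmod z)) * of_real (cmod z - 1)" using False by (simp add: field_simps)
      then have "cmod (z - z / of_real (cmod z)) = cmod (z / of_real (cmod z)) * \<bar>cmod z - 1\<bar>"
        by (simp only: norm_mult norm_of_real)
      then show ?thesis using False by (simp add: norm_divide)
    qed
    also have "\<dots> \<le> l" using b z1 by simp
    finally have "cmod ((z - z / of_real (cmod z)) + (z / of_real (cmod z) - cis t)) \<le> l + pi * l"
      using * False by (intro norm_triangle_le add_mono arc_norm_diff_le) auto
    also have "pi * l \<le> 4 * l" using pi_less_4 l by (intro mult_right_mono) auto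
    finally show ?thesis by simp
  qed
qed

lemma measurable_carleson_box [measurable]: 
  assumes "0 < l" "l \<le> 1" shows "carleson_box (circ_arc t l) \<in> sets borel"
proof -
  have "{z::complex. 1 - l \<le> cmod z \<and> z / of_real (cmod z) \<in> circ_arc t l} \<in> sets borel" by measurable
  then have "unit_disc \<inter> {z::complex. 1 - l \<le> cmod z \<and> z / of_real (cmod z) \<in> circ_arc t l} \<in> sets borel" by simp
  moreover have "{z \<in> unit_disc. 1 - l \<le> cmod z \<and> z / of_real (cmod z) \<in> circ_arc t l} = unit_disc \<inter> {z::complex. 1 - l \<le> cmod z \<and> z / of_real (cmod z) \<in> circ_arc t l}" by auto
  ultimately show ?thesis
    by (simp add: carleson_box_def arc_length_arc assms)
qed

section \<open>Morrey functions and Carleson measures\<close>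

lemma ennreal_divide_le_iff:
  assumes "0 < q" shows "x / ennreal q \<le> y \<longleftrightarrow> x \<le> y * ennreal q"
proof
  assume "x / ennreal q \<le> y"
  then have "x / ennreal q * ennreal q \<le> y * ennreal q" by (rule mult_right_mono) simp
  then show "x \<le> y * ennreal q" using assms by (simp add: ennreal_divide_times)
next
  assume "x \<le> y * ennreal q"
  then show "x / ennreal q \<le> y" using assms by (intro divide_le_posI_ennreal) (simp_all add: mult.commute)
qed

section \<open>The energy of a single box\<close>

lemma measurable_disc_sq_norm:
  assumes g: "continuous_on unit_disc g" and [measurable]: "w \<in> borel_measurable borel"
  shows "(\<lambda>z. ennreal ((cmod (g z))\<^sup>2 * w z) * indicator unit_disc z) \<in> borel_measurable borel"
proof -
  have [measurable]: "(\<lambda>z. indicator unit_disc z *\<^sub>R g z) \<in> borel_measurable borel"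
    by (rule borel_measurable_disc_restrict[OF g])
  have "(\<lambda>z. ennreal ((cmod (indicator unit_disc z *\<^sub>R g z))\<^sup>2 * w z)) \<in> borel_measurable borel"
    by measurable
  also have "(\<lambda>z. ennreal ((cmod (indicator unit_disc z *\<^sub>R g z))\<^sup>2 * w z)) = (\<lambda>z. ennreal ((cmod (g z))\<^sup>2 * w z) * indicator unit_disc z)"
    by (auto split: split_indicator)
  finally show ?thesis .
qed

text \<open>This puts the product of f - c with the kernel back into the Hardy space, where its
  circle means are controlled by its boundary values.\<close>

lemma hardy2_diff_mult_bounded:
  assumes f: "f \<in> hardy2" and k: "k holomorphic_on unit_disc" "\<And>z. z \<in> unit_disc \<Longrightarrow> cmod (k z) \<le> B"
  shows "(\<lambda>z. (f z - c) * k z) \<in> hardy2"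
proof -
  have hf: "f holomorphic_on unit_disc" using f by (simp add: hardy2_def)
  obtain M where M: "\<And>r. r \<in> {0..<1} \<Longrightarrow> circle_mean f r \<le> ennreal M"
    using f unfolding hardy2_iff by blast
  define F where "F z = indicator unit_disc z *\<^sub>R f z" for z
  have [measurable]: "F \<in> borel_measurable borel"
    unfolding F_def by (rule borel_measurable_disc_restrict[OF holomorphic_on_imp_continuous_on[OF hf]])
  have "circle_mean (\<lambda>z. (f z - c) * k z) r \<le> ennreal (B\<^sup>2 * (2 * max 0 M + 2 * (cmod c)\<^sup>2))" if r: "r \<in> {0..<1}" for r
  proof -
    have "circle_mean (\<lambda>z. (f z - c) * k z) r \<le>
      (\<integral>\<^sup>+\<zeta>. ennreal (B\<^sup>2) * (2 * ennreal ((cmod (F (of_real r * \<zeta>)))\<^sup>2) + ennreal (2 * (cmod c)\<^sup>2)) \<partial>circle_measure)"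
      unfolding circle_mean_def
    proof (rule nn_integral_mono_AE, use AE_circle_measure_norm in eventually_elim)
      case (elim \<zeta>)
      define z where "z = of_real r * \<zeta>"
      have z: "z \<in> unit_disc" using elim r by (simp add: z_def norm_mult)
      have "(cmod ((f z - c) * k z))\<^sup>2 = (cmod (k z))\<^sup>2 * (cmod (f z + - c))\<^sup>2"
        by (simp add: norm_mult power_mult_distrib)
      also have "\<dots> \<le> B\<^sup>2 * (2 * (cmod (f z))\<^sup>2 + 2 * (cmod (- c))\<^sup>2)"
        by (intro mult_mono power_mono k z sq_norm_add_le) auto
      finally have "ennreal ((cmod ((f z - c) * k z))\<^sup>2) \<le> ennreal (B\<^sup>2 * (2 * (cmod (f z))\<^sup>2 + 2 * (cmod c)\<^sup>2))"
        by (intro ennreal_leI) simp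
      then show ?case using z unfolding z_def[symmetric] by (simp add: F_def ennreal_mult)
    qed
    also have "\<dots> = ennreal (B\<^sup>2) * (2 * circle_mean F r + ennreal (2 * (cmod c)\<^sup>2))"
      unfolding circle_mean_def by (subst nn_integral_cmult, measurable, subst nn_integral_add) (simp_all add: nn_integral_cmult)
    also have "circle_mean F r = circle_mean f r"
      unfolding circle_mean_def
      by (rule nn_integral_circle_cong) (use r in \<open>simp add: F_def norm_mult\<close>)
    also have "ennreal (B\<^sup>2) * (2 * circle_mean f r + ennreal (2 * (cmod c)\<^sup>2)) \<le> ennreal (B\<^sup>2) * (2 * ennreal (max 0 M) + ennreal (2 * (cmod c)\<^sup>2))"
      using M[OF r] by (intro mult_left_mono add_right_mono) (auto simp: ennreal_max_0)
    also have "\<dots> = ennreal (B\<^sup>2 * (2 * max 0 M + 2 * (cmod c)\<^sup>2))"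
      by (simp add: ennreal_mult)
    finally show ?thesis .
  qed
  moreover have "(\<lambda>z. (f z - c) * k z) holomorphic_on unit_disc"
    by (intro holomorphic_intros hf k)
  ultimately show ?thesis unfolding hardy2_iff by blast
qed

text \<open>Up to a unimodular factor the denominator is (1+l)e - z, so its modulus is the distance
  from \<open>z\<close> to the pole (1+l)e of the kernel, a point at distance l from the closed
  disc. The three bounds are triangle inequalities for this distance.\<close>

lemma box_kernel_bounds:
  assumes "0 < l" "cmod z \<le> 1" "cmod e = 1"
  shows "l \<le> cmod (1 + of_real l - cnj e * z)" "cmod (z - e) \<le> 2 * cmod (1 + of_real l - cnj e * z)"
    "cmod (1 + of_real l - cnj e * z) \<le> l + cmod (z - e)"
proof -
  have ze: "cmod (1 - cnj e * z) = cmod (z - e)"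
  proof -
    have "1 - cnj e * z = cnj e * (e - z)"
      using assms complex_norm_square[of e] by (simp add: algebra_simps)
    then show ?thesis using assms by (simp add: norm_mult norm_minus_commute)
  qed
  have "cmod (1 + of_real l) = 1 + l"
    using assms(1) norm_of_real[of "1 + l", where 'a = complex] by simp
  then have "(1 + l) - cmod (cnj e * z) \<le> cmod (1 + of_real l - cnj e * z)"
    using norm_triangle_ineq2[of "1 + complex_of_real l" "cnj e * z"] by simp
  then show l: "l \<le> cmod (1 + of_real l - cnj e * z)" using assms by (simp add: norm_mult)
  have "cmod (1 - cnj e * z) \<le> cmod (1 + of_real l - cnj e * z) + l"
    using norm_triangle_ineq4[of "1 + of_real l - cnj e * z" "of_real l"] assms by (simp add: algebra_simps)
  then show "cmod (z - e) \<le> 2 * cmod (1 + of_real l - cnj e * z)" using l ze by simp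
  show "cmod (1 + of_real l - cnj e * z) \<le> l + cmod (z - e)"
    using norm_triangle_ineq[of "of_real l" "1 - cnj e * z"] assms ze by (simp add: algebra_simps)
qed

text \<open>Put e = \<open>cis t\<close> and h = (f - c) K. Since K' = cnj e K^2, one has f' K = h'
  - cnj e h K. On the box |K| lies between 1/(6l) and 1/l, whence |f'|^2 \<le> 72 l^2 |h'|^2 + 72
  |h|^2. The first term leads to a Littlewood-Paley integral; for the second, the weight and the
  width of the box each contribute a factor of order l.\<close>

lemma box_energy_1_le_boundary:
  assumes f: "f \<in> hardy2" and b: "boundary_function f u" and l: "0 < l" "l \<le> 1"
  shows "box_energy 1 f (circ_arc t l) \<le> ennreal (720 * l\<^sup>2) *
    (\<integral>\<^sup>+\<zeta>. ennreal ((cmod (u \<zeta> - c))\<^sup>2 / (cmod (1 + of_real l - cnj (cis t) * \<zeta>))\<^sup>2) \<partial>circle_measure)" (is "_ \<le> _ * ?V")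
proof -
  define K where "K z = 1 / (1 + of_real l - cnj (cis t) * z)" for z
  define h where "h z = (f z - c) * K z" for z
  note kb = box_kernel_bounds[OF l(1), of _ "cis t", simplified norm_cis]
  have hf: "f holomorphic_on unit_disc" using f by (simp add: hardy2_def)
  have nz: "1 + of_real l - cnj (cis t) * z \<noteq> 0" if "cmod z \<le> 1" for z
    using kb(1)[OF that refl] l by auto
  have hK: "K holomorphic_on unit_disc"
    unfolding K_def using nz by (intro holomorphic_intros) auto
  have Kle: "cmod (K z) \<le> 1 / l" if "cmod z \<le> 1" for z
    using kb(1)[OF that refl] l unfolding K_def norm_divide norm_one by (intro divide_left_mono) (auto intro!: mult_pos_pos)
  have h2: "h \<in> hardy2" unfolding h_def
    by (rule hardy2_diff_mult_bounded[OF f hK, of "1 / l"]) (auto intro: Kle)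
  then have hh: "h holomorphic_on unit_disc" by (simp add: hardy2_def)
  then have dh: "deriv h holomorphic_on unit_disc" by (intro holomorphic_deriv) auto
  define v where "v \<zeta> = (u \<zeta> - c) * K \<zeta>" for \<zeta>
  have bh: "boundary_function h v"
    unfolding boundary_function_def
  proof
    have [measurable]: "u \<in> borel_measurable borel" using b by (simp add: boundary_function_def)
    show "v \<in> borel_measurable borel" unfolding v_def K_def by measurable
    have "AE \<zeta> in circle_measure. ((\<lambda>r. f (of_real r * \<zeta>)) \<longlongrightarrow> u \<zeta>) (at_left (1::real))"
      using b by (simp add: boundary_function_def)
    then show "AE \<zeta> in circle_measure. ((\<lambda>r. h (of_real r * \<zeta>)) \<longlongrightarrow> v \<zeta>) (at_left (1::real))"
      using AE_circle_measure_norm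
    proof eventually_elim
      case (elim \<zeta>)
      have "((\<lambda>r. K (of_real r * \<zeta>)) \<longlongrightarrow> K (of_real 1 * \<zeta>)) (at_left (1::real))"
        unfolding K_def using nz[of \<zeta>] elim by (intro tendsto_intros) auto
      then show ?case unfolding h_def v_def using elim by (intro tendsto_intros) auto
    qed
  qed
  define V where "V = ?V"
  have cm: "circle_mean h r \<le> 2 * V" if "0 \<le> r" "r < 1" for r
    using circle_mean_le_boundary[OF h2 bh that]
    by (simp add: v_def K_def V_def norm_mult norm_divide power_mult_distrib power_divide)
  have pt: "(cmod (deriv f z))\<^sup>2 * (1 - (cmod z)\<^sup>2) \<le> 72 * l\<^sup>2 * ((cmod (deriv h z))\<^sup>2 * (1 - (cmod z)\<^sup>2)) + 144 * l * (cmod (h z))\<^sup>2"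
    if z: "z \<in> carleson_box (circ_arc t l)" for z
  proof -
    note zb = carleson_boxD[OF l z]
    have zd: "z \<in> unit_disc" using zb by simp
    have dK: "(K has_field_derivative cnj (cis t) * (K z)\<^sup>2) (at z)"
      unfolding K_def using nz[of z] zb
      by (auto intro!: derivative_eq_intros simp: power2_eq_square divide_simps)
    have df: "(f has_field_derivative deriv f z) (at z)"
      using hf zd by (intro holomorphic_derivI[of _ unit_disc]) auto
    have "(h has_field_derivative deriv f z * K z + (f z - c) * (cnj (cis t) * (K z)\<^sup>2)) (at z)"
      unfolding h_def using df dK by (auto intro!: derivative_eq_intros)
    then have "deriv h z = deriv f z * K z + (f z - c) * (cnj (cis t) * (K z)\<^sup>2)" by (rule DERIV_imp_deriv)
    then have eq: "deriv f z * K z = deriv h z + - (h z * cnj (cis t) * K z)"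
      by (simp add: h_def power2_eq_square algebra_simps)
    have "cmod (h z * cnj (cis t) * K z) \<le> cmod (h z) * (1 / l)"
      using mult_left_mono[OF Kle[of z], of "cmod (h z)"] zb by (simp add: norm_mult)
    then have hK2: "(cmod (h z * cnj (cis t) * K z))\<^sup>2 \<le> (cmod (h z))\<^sup>2 / l\<^sup>2"
      using power_mono[of "cmod (h z * cnj (cis t) * K z)" "cmod (h z) * (1 / l)" 2] by (simp add: power_divide)
    \<comment> \<open>The 6 is 1 + 5: the pole has distance l from \<open>cis t\<close>, and points
      of the box are within 5l of it.\<close>
    have "cmod (1 + of_real l - cnj (cis t) * z) \<le> 6 * l"
      using kb(3)[of z, OF _ refl] zb by simp
    then have "1 / (6 * l) \<le> cmod (K z)"
      using l nz[of z] zb unfolding K_def norm_divide norm_one by (intro divide_left_mono) auto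
    then have "(1 / (6 * l))\<^sup>2 \<le> (cmod (K z))\<^sup>2" using l by (intro power_mono) auto
    then have K2: "1 \<le> 36 * l\<^sup>2 * (cmod (K z))\<^sup>2" using l by (simp add: field_simps power2_eq_square)
    have "(cmod (deriv f z))\<^sup>2 * 1 \<le> (cmod (deriv f z))\<^sup>2 * (36 * l\<^sup>2 * (cmod (K z))\<^sup>2)"
      by (intro mult_left_mono K2) simp
    also have "\<dots> = 36 * l\<^sup>2 * (cmod (deriv f z * K z))\<^sup>2" by (simp add: norm_mult power_mult_distrib)
    also have "\<dots> \<le> 36 * l\<^sup>2 * (2 * (cmod (deriv h z))\<^sup>2 + 2 * (cmod (- (h z * cnj (cis t) * K z)))\<^sup>2)"
      unfolding eq by (intro mult_left_mono sq_norm_add_le) simp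
    also have "\<dots> \<le> 36 * l\<^sup>2 * (2 * (cmod (deriv h z))\<^sup>2 + 2 * ((cmod (h z))\<^sup>2 / l\<^sup>2))"
      using hK2 by (intro mult_left_mono add_left_mono) auto
    also have "\<dots> = 72 * l\<^sup>2 * (cmod (deriv h z))\<^sup>2 + 72 * (cmod (h z))\<^sup>2"
      using l by (simp add: field_simps)
    finally have 1: "(cmod (deriv f z))\<^sup>2 \<le> 72 * l\<^sup>2 * (cmod (deriv h z))\<^sup>2 + 72 * (cmod (h z))\<^sup>2" by simp
    have 2: "0 \<le> 1 - (cmod z)\<^sup>2" using zb by (simp add: power_le_one)
    have 3: "1 - (cmod z)\<^sup>2 \<le> 2 * l" using weight_sq_le[of z] zb by simp
    have "(cmod (deriv f z))\<^sup>2 * (1 - (cmod z)\<^sup>2) \<le> (72 * l\<^sup>2 * (cmod (deriv h z))\<^sup>2 + 72 * (cmod (h z))\<^sup>2) * (1 - (cmod z)\<^sup>2)"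
      by (intro mult_right_mono 1 2)
    also have "\<dots> = 72 * l\<^sup>2 * ((cmod (deriv h z))\<^sup>2 * (1 - (cmod z)\<^sup>2)) + 72 * (cmod (h z))\<^sup>2 * (1 - (cmod z)\<^sup>2)"
      by (simp add: algebra_simps)
    also have "\<dots> \<le> 72 * l\<^sup>2 * ((cmod (deriv h z))\<^sup>2 * (1 - (cmod z)\<^sup>2)) + 72 * (cmod (h z))\<^sup>2 * (2 * l)"
      by (intro add_left_mono mult_left_mono 3) auto
    finally show ?thesis by (simp add: mult_ac)
  qed
  let ?A = "\<lambda>z. ennreal ((cmod (deriv h z))\<^sup>2 * (1 - (cmod z)\<^sup>2)) * indicator unit_disc z"
  \<comment> \<open>For \<open>h\<close> itself the box is enlarged to the annulus 1 - l \<le> |z| <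
    1, on which polar coordinates reduce everything to circle means.\<close>
  let ?B = "\<lambda>z. ennreal ((cmod (h z))\<^sup>2 * indicator {1-l..} (cmod z)) * indicator unit_disc z"
  have [measurable]: "?A \<in> borel_measurable borel" "?B \<in> borel_measurable borel"
    by (rule measurable_disc_sq_norm holomorphic_on_imp_continuous_on dh hh; measurable)+
  have "box_energy 1 f (circ_arc t l) \<le> (\<integral>\<^sup>+z. ennreal (72 * l\<^sup>2) * ?A z + ennreal (144 * l) * ?B z \<partial>area_measure)" (is "_ \<le> nn_integral _ ?R")
    unfolding box_energy_def
  proof (rule nn_integral_mono)
    fix z
    show "ennreal ((cmod (deriv f z))\<^sup>2 * (1 - (cmod z)\<^sup>2) powr 1) * indicator (carleson_box (circ_arc t l)) z \<le> ?R z"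
    proof (cases "z \<in> carleson_box (circ_arc t l)")
      case True
      note zb = carleson_boxD[OF l True]
      have nn: "0 \<le> 1 - (cmod z)\<^sup>2" using zb by (simp add: power_le_one)
      have "ennreal ((cmod (deriv f z))\<^sup>2 * (1 - (cmod z)\<^sup>2) powr 1) \<le> ennreal (72 * l\<^sup>2 * ((cmod (deriv h z))\<^sup>2 * (1 - (cmod z)\<^sup>2)) + 144 * l * (cmod (h z))\<^sup>2)"
        using pt[OF True] nn by (intro ennreal_leI) simp
      also have "\<dots> = ennreal (72 * l\<^sup>2) * ennreal ((cmod (deriv h z))\<^sup>2 * (1 - (cmod z)\<^sup>2)) + ennreal (144 * l) * ennreal ((cmod (h z))\<^sup>2)"
        using l nn by (simp add: ennreal_mult)
      finally show ?thesis using True zb by simp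
    qed simp
  qed
  also have "\<dots> = ennreal (72 * l\<^sup>2) * (\<integral>\<^sup>+z. ?A z \<partial>area_measure) + ennreal (144 * l) * (\<integral>\<^sup>+z. ?B z \<partial>area_measure)"
    by (subst nn_integral_add) (simp_all add: nn_integral_cmult)
  also have "\<dots> \<le> ennreal (72 * l\<^sup>2) * (2 * V) + ennreal (144 * l) * (ennreal (2 * l) * (2 * V))"
  proof (intro add_mono mult_left_mono)
    show "(\<integral>\<^sup>+z. ?A z \<partial>area_measure) \<le> 2 * V"
      by (rule littlewood_paley_le[OF hh cm])
    have "(\<integral>\<^sup>+z. ?B z \<partial>area_measure) = (\<integral>\<^sup>+z\<in>unit_disc. ennreal ((cmod (h z))\<^sup>2) * indicator {1-l..} (cmod z) \<partial>area_measure)"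
      by (intro nn_integral_cong) (auto split: split_indicator)
    also have "\<dots> = (\<integral>\<^sup>+r\<in>{0..<1}. ennreal (2 * r) * (circle_mean h r * indicator {1-l..} r) \<partial>lborel)"
      by (rule nn_integral_disc_radial[OF holomorphic_on_imp_continuous_on[OF hh]]) measurable
    also have "\<dots> \<le> (\<integral>\<^sup>+r. (ennreal (2 * r) * indicator {1-l..<1} r) * (2 * V) \<partial>lborel)" (is "nn_integral _ ?L \<le> nn_integral _ ?R")
    proof (rule nn_integral_mono)
      fix r :: real
      show "?L r \<le> ?R r"
        using cm[of r] by (auto split: split_indicator intro!: mult_left_mono)
    qed
    also have "\<dots> = (\<integral>\<^sup>+r\<in>{1-l..<1}. ennreal (2 * r) \<partial>lborel) * (2 * V)"
      by (rule nn_integral_multc) measurable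
    also have "(\<integral>\<^sup>+r\<in>{1-l..<1}. ennreal (2 * r) \<partial>lborel) = ennreal (1\<^sup>2 - (1 - l)\<^sup>2)"
      using l by (intro nn_integral_FTC_Ico) (auto intro!: derivative_eq_intros)
    also have "1\<^sup>2 - (1 - l)\<^sup>2 \<le> 2 * l" using l by (simp add: power2_eq_square algebra_simps)
    finally show "(\<integral>\<^sup>+z. ?B z \<partial>area_measure) \<le> ennreal (2 * l) * (2 * V)"
      by (simp add: ennreal_leI mult_right_mono)
  qed auto
  also have "\<dots> = ennreal (72 * l\<^sup>2 * 2) * V + ennreal (144 * l * (2 * l) * 2) * V"
  proof -
    have A: "ennreal a * (ennreal b * W) = ennreal (a * b) * W" if "0 \<le> a" "0 \<le> b" for a b W
      using that by (simp add: ennreal_mult mult.assoc)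
    have "ennreal (72 * l\<^sup>2) * (2 * V) = ennreal (72 * l\<^sup>2 * 2) * V"
      unfolding ennreal_numeral[symmetric] by (rule A) auto
    moreover have "ennreal (144 * l) * (ennreal (2 * l) * (2 * V)) = ennreal (144 * l * (2 * l)) * (2 * V)"
      using l by (intro A) auto
    moreover have "ennreal (144 * l * (2 * l)) * (2 * V) = ennreal (144 * l * (2 * l) * 2) * V"
      unfolding ennreal_numeral[symmetric] using l by (intro A) auto
    ultimately show ?thesis by (simp only:)
  qed
  \<comment> \<open>144 comes from the derivative term and 576 from the annulus.\<close>
  also have "\<dots> = ennreal (720 * l\<^sup>2) * V"
    using l by (subst distrib_right[symmetric], subst ennreal_plus[symmetric]) (auto simp: power2_eq_square)
  finally show ?thesis by (simp add: V_def)
qed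

section \<open>Dyadic decomposition of the circle around an arc\<close>

lemma circ_arc_mono: "0 \<le> l \<Longrightarrow> l \<le> l' \<Longrightarrow> circ_arc t l \<subseteq> circ_arc t l'"
  unfolding circ_arc_def
  by (intro image_mono) (auto intro: order_trans[OF mult_left_mono[of l l' pi]] dest: mult_left_mono[of l l' pi])

text \<open>\<open>m\<close> stands for any choice of constants attached to arcs; it becomes
  \<open>arc_mean u\<close>. Constants of neighbouring dilated arcs differ, in square, by at most 6
  A l^(lam-1): integrate over the smaller arc, and use lam < 1 to replace its length by l.
  Telescoping over k steps costs (3/2)^k, and the length of the arc, at most 2^k l, turns this into
  3^k.\<close>

lemma dyadic_oscillation_bound:
  fixes u :: "complex \<Rightarrow> complex" and m :: "complex set \<Rightarrow> complex"
  assumes [measurable]: "u \<in> borel_measurable borel" and A: "0 \<le> A" and lam: "0 < lam" "lam < 1"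
    and H: "\<And>t l. 0 < l \<Longrightarrow> l \<le> 1 \<Longrightarrow>
      (\<integral>\<^sup>+\<zeta>\<in>circ_arc t l. ennreal ((cmod (u \<zeta> - m (circ_arc t l)))\<^sup>2) \<partial>circle_measure) \<le> ennreal (A * l powr lam)"
    and l: "0 < l" "l \<le> 1"
  shows "(\<integral>\<^sup>+\<zeta>\<in>circ_arc t (min 1 (2 ^ k * l)). ennreal ((cmod (u \<zeta> - m (circ_arc t l)))\<^sup>2) \<partial>circle_measure)
     \<le> ennreal (74 * A * 3 ^ k * l powr lam)"
proof -
  define L where "L k = min 1 (2 ^ k * l)" for k :: nat
  define J where "J k = circ_arc t (L k)" for k
  have [measurable]: "J k \<in> sets borel" for k unfolding J_def by measurable
  have L: "0 < L k" "L k \<le> 1" "l \<le> L k" "L k \<le> 2 ^ k * l" "L k \<le> L (Suc k)" "L (Suc k) \<le> 2 * L k" for k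
    using l by (auto simp: L_def min_def mult_le_cancel_right1)
  have J0: "J 0 = circ_arc t l" using l by (simp add: J_def L_def)
  have JJ: "J k \<subseteq> J (Suc k)" for k
    unfolding J_def using L[of k] by (intro circ_arc_mono) auto
  have split: "(cmod (x - y))\<^sup>2 \<le> 2 * (cmod (w - x))\<^sup>2 + 2 * (cmod (w - y))\<^sup>2" for x y w :: complex
    using sq_norm_add_le[of "x - w" "w - y"] by (simp add: norm_minus_commute)
  let ?O = "\<lambda>i j \<zeta>. ennreal ((cmod (u \<zeta> - m (J i)))\<^sup>2) * indicator (J j) \<zeta>"
  let ?d = "\<lambda>i j. (cmod (m (J i) - m (J j)))\<^sup>2"
  have step: "?d k (Suc k) \<le> 6 * A * l powr (lam - 1)" for k
  proof -
    have "ennreal (?d k (Suc k)) * ennreal (L k)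
        = (\<integral>\<^sup>+\<zeta>\<in>J k. ennreal (?d k (Suc k)) \<partial>circle_measure)"
      using L[of k] by (subst nn_integral_cmult_indicator) (auto simp: J_def emeasure_arc)
    also have "\<dots> \<le> (\<integral>\<^sup>+\<zeta>. 2 * ?O k k \<zeta> + 2 * ?O (Suc k) (Suc k) \<zeta> \<partial>circle_measure)" (is "nn_integral _ ?L \<le> nn_integral _ ?R")
    proof (rule nn_integral_mono)
      fix \<zeta>
      have "ennreal (?d k (Suc k)) \<le> 2 * (ennreal ((cmod (u \<zeta> - m (J k)))\<^sup>2)) + 2 * (ennreal ((cmod (u \<zeta> - m (J (Suc k))))\<^sup>2))"
        using ennreal_leI[OF split[of "m (J k)" "m (J (Suc k))" "u \<zeta>"]] by (simp add: ennreal_mult)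
      then show "?L \<zeta> \<le> ?R \<zeta>"
        using JJ[of k] by (auto split: split_indicator)
    qed
    also have "\<dots> = 2 * (\<integral>\<^sup>+\<zeta>. ?O k k \<zeta> \<partial>circle_measure) + 2 * (\<integral>\<^sup>+\<zeta>. ?O (Suc k) (Suc k) \<zeta> \<partial>circle_measure)"
      by (subst nn_integral_add) (simp_all add: nn_integral_cmult)
    also have "\<dots> \<le> 2 * ennreal (A * L k powr lam) + 2 * ennreal (A * L (Suc k) powr lam)"
      unfolding J_def using L by (intro add_mono mult_left_mono H) auto
    also have "\<dots> = ennreal (2 * (A * L k powr lam) + 2 * (A * L (Suc k) powr lam))"
      using A by (simp add: ennreal_mult)
    finally have "ennreal (?d k (Suc k) * L k) \<le> ennreal (2 * (A * L k powr lam) + 2 * (A * L (Suc k) powr lam))"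
      using L[of k] by (simp add: ennreal_mult)
    then have "?d k (Suc k) * L k \<le> 2 * (A * L k powr lam) + 2 * (A * L (Suc k) powr lam)"
      using A by (subst (asm) ennreal_le_iff) auto
    \<comment> \<open>Doubling the arc costs at most a factor 2 because lam < 1, so the total is 2 +
      2 * 2 = 6.\<close>
    also have "L (Suc k) powr lam \<le> (2 * L k) powr lam"
      using L[of k] L[of "Suc k"] lam by (intro powr_mono2) auto
    also have "(2 * L k) powr lam = 2 powr lam * L k powr lam" using L[of k] by (simp add: powr_mult)
    also have "\<dots> \<le> 2 powr 1 * L k powr lam" using lam by (intro mult_right_mono powr_mono) auto
    finally have "?d k (Suc k) * L k \<le> 6 * A * L k powr lam"
      using A by (simp add: mult_left_mono mult_right_mono algebra_simps)
    also have "L k powr lam = L k powr (lam - 1) * L k" using L(1)[of k] by (simp add: powr_diff)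
    finally have "?d k (Suc k) \<le> 6 * A * L k powr (lam - 1)"
      using L(1)[of k] by (simp flip: mult.assoc)
    also have "\<dots> \<le> 6 * A * l powr (lam - 1)"
      using L[of k] A l lam by (intro mult_left_mono powr_mono2') auto
    finally show ?thesis .
  qed
  \<comment> \<open>Three times the bound in \<open>step\<close>. The numbers a(k) = 2X((3/2)^k - 1)
    solve a(k+1) = 3/2 a(k) + X with a(0) = 0.\<close>
  define X where "X = 18 * A * l powr (lam - 1)"
  have X0: "0 \<le> X" using A by (simp add: X_def)
  have D: "?d k 0 \<le> 2 * X * ((3/2) ^ k - 1)" for k
  proof (induction k)
    case (Suc k)
    let ?a = "cmod (m (J k) - m (J 0))" and ?b = "cmod (m (J (Suc k)) - m (J k))"
    have "cmod (m (J (Suc k)) - m (J 0)) \<le> ?a + ?b"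
      using norm_triangle_ineq[of "m (J k) - m (J 0)" "m (J (Suc k)) - m (J k)"] by simp
    then have "(cmod (m (J (Suc k)) - m (J 0)))\<^sup>2 \<le> (?a + ?b)\<^sup>2" by (intro power_mono) auto
    \<comment> \<open>The uneven weights 3/2 and 3 are essential: with the symmetric weights 2 and 2
      the final growth would be 4^k, which the decay of the squared kernel cannot
      compensate.\<close>
    also have "\<dots> \<le> 3/2 * ?a\<^sup>2 + 3 * ?b\<^sup>2"
      using zero_le_power2[of "?a - 2 * ?b"] by (simp add: power2_eq_square algebra_simps)
    also have "\<dots> \<le> 3/2 * (2 * X * ((3/2) ^ k - 1)) + 3 * (6 * A * l powr (lam - 1))"
      using step[of k] by (intro add_mono mult_left_mono Suc.IH) (auto simp: norm_minus_commute)
    also have "\<dots> = 2 * X * ((3/2) ^ Suc k - 1)" by (simp add: X_def algebra_simps)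
    finally show ?case .
  qed simp
  have "(\<integral>\<^sup>+\<zeta>. ?O 0 k \<zeta> \<partial>circle_measure)
     \<le> (\<integral>\<^sup>+\<zeta>. 2 * ?O k k \<zeta> + ennreal (2 * ?d k 0) * indicator (J k) \<zeta> \<partial>circle_measure)" (is "nn_integral _ ?L \<le> nn_integral _ ?R")
  proof (rule nn_integral_mono)
    fix \<zeta>
    show "?L \<zeta> \<le> ?R \<zeta>"
      using ennreal_leI[OF sq_norm_add_le[of "u \<zeta> - m (J k)" "m (J k) - m (J 0)"]]
      by (auto simp: ennreal_mult split: split_indicator)
  qed
  also have "\<dots> = 2 * (\<integral>\<^sup>+\<zeta>. ?O k k \<zeta> \<partial>circle_measure) + ennreal (2 * ?d k 0) * ennreal (L k)"
    using L[of k] by (subst nn_integral_add) (simp_all add: nn_integral_cmult nn_integral_cmult_indicator J_def emeasure_arc)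
  also have "\<dots> \<le> 2 * ennreal (A * L k powr lam) + ennreal (2 * ?d k 0) * ennreal (L k)"
    unfolding J_def using L by (intro add_right_mono mult_left_mono H) auto
  also have "\<dots> = ennreal (2 * (A * L k powr lam) + 2 * ?d k 0 * L k)"
    using A L(1)[of k] by (simp add: ennreal_mult)
  also have "\<dots> \<le> ennreal (74 * A * 3 ^ k * l powr lam)"
  proof (rule ennreal_leI)
    have "L k powr lam \<le> (2 ^ k * l) powr lam"
      using L[of k] lam by (intro powr_mono2) auto
    also have "\<dots> = (2 ^ k) powr lam * l powr lam" using l by (simp add: powr_mult)
    also have "(2 ^ k) powr lam \<le> ((2::real) ^ k) powr 1" using lam by (intro powr_mono) auto
    also have "\<dots> = 2 ^ k" by simp
    also have "(2::real) ^ k \<le> 3 ^ k" by (intro power_mono) auto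
    finally have 1: "L k powr lam \<le> 3 ^ k * l powr lam" by (simp add: mult_right_mono)
    have "?d k 0 * L k \<le> (2 * X * (3/2) ^ k) * (2 ^ k * l)"
    proof (intro mult_mono L)
      have "?d k 0 \<le> 2 * X * ((3/2) ^ k - 1)" by (rule D)
      also have "\<dots> \<le> 2 * X * (3/2) ^ k" using X0 by (intro mult_left_mono) auto
      finally show "?d k 0 \<le> 2 * X * (3/2) ^ k" .
    qed (use X0 L(1)[of k] in \<open>auto\<close>)
    also have "\<dots> = 2 * (X * l) * ((3/2) ^ k * 2 ^ k)" by simp
    also have "(3/2::real) ^ k * 2 ^ k = 3 ^ k" by (simp flip: power_mult_distrib)
    also have "X * l = 18 * A * l powr lam" using l by (simp add: X_def powr_diff)
    finally have 2: "?d k 0 * L k \<le> 36 * A * 3 ^ k * l powr lam" by (simp add: mult_ac)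
    \<comment> \<open>The 74 consists of 2 from the oscillation on the large arc and 72 = 2 * 36
      from the difference of the constants.\<close>
    have "2 * (A * L k powr lam) \<le> 2 * (A * (3 ^ k * l powr lam))" using A by (intro mult_left_mono 1) auto
    with 2 show "2 * (A * L k powr lam) + 2 * ?d k 0 * L k \<le> 74 * A * 3 ^ k * l powr lam" by simp
  qed
  finally show ?thesis by (simp only: J0) (simp only: J_def L_def)
qed

text \<open>Each point is assigned to the first dyadic arc that contains it. If its index is k = j +
  1, the point lies outside the j-th arc, hence at distance more than 2^j l from the pole, and the
  squared kernel is at most 4 * 4^(-k) / l^2. Against the growth 3^k this leaves the geometric
  series of (3/4)^k, and 4 * 74 * 4 = 1184.\<close>

lemma poisson_type_oscillation_bound:
  fixes u :: "complex \<Rightarrow> complex" and m :: "complex set \<Rightarrow> complex"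
  assumes [measurable]: "u \<in> borel_measurable borel" and A: "0 \<le> A" and lam: "0 < lam" "lam < 1"
    and H: "\<And>t l. 0 < l \<Longrightarrow> l \<le> 1 \<Longrightarrow>
      (\<integral>\<^sup>+\<zeta>\<in>circ_arc t l. ennreal ((cmod (u \<zeta> - m (circ_arc t l)))\<^sup>2) \<partial>circle_measure) \<le> ennreal (A * l powr lam)"
    and l: "0 < l" "l \<le> 1"
  shows "(\<integral>\<^sup>+\<zeta>. ennreal ((cmod (u \<zeta> - m (circ_arc t l)))\<^sup>2 / (cmod (1 + of_real l - cnj (cis t) * \<zeta>))\<^sup>2) \<partial>circle_measure)
     \<le> ennreal (1184 * A * l powr (lam - 2))"
proof -
  define J where "J k = circ_arc t (min 1 (2 ^ k * l))" for k :: nat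
  have [measurable]: "J k \<in> sets borel" for k unfolding J_def by measurable
  define g where "g \<zeta> = (cmod (u \<zeta> - m (circ_arc t l)))\<^sup>2" for \<zeta>
  have [measurable]: "g \<in> borel_measurable borel" unfolding g_def by measurable
  have g0: "0 \<le> g \<zeta>" for \<zeta> by (simp add: g_def)
  let ?w = "\<lambda>k::nat. 4 * (1/4) ^ k / l\<^sup>2"
  have pt: "ennreal (g \<zeta> / (cmod (1 + of_real l - cnj (cis t) * \<zeta>))\<^sup>2) \<le> (\<Sum>k. ennreal (?w k) * (ennreal (g \<zeta>) * indicator (J k) \<zeta>))"
    if \<zeta>: "cmod \<zeta> = 1" for \<zeta>
  proof -
    define q where "q = cmod (1 + of_real l - cnj (cis t) * \<zeta>)"
    have q: "l \<le> q" "cmod (\<zeta> - cis t) \<le> 2 * q"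
      unfolding q_def using box_kernel_bounds[OF l(1), of \<zeta> "cis t"] \<zeta> by auto
    \<comment> \<open>Some dyadic arc is the whole circle, so a first index exists.\<close>
    obtain n where n: "1 / l \<le> 2 ^ n" using real_arch_pow[of 2 "1 / l"] by (auto intro: less_imp_le)
    then have "min 1 (2 ^ n * l) = 1" using l by (simp add: field_simps)
    then have ex: "\<zeta> \<in> J n" using \<zeta> by (simp add: J_def arc_1)
    define k where "k = (LEAST k. \<zeta> \<in> J k)"
    have kJ: "\<zeta> \<in> J k" unfolding k_def using ex by (rule LeastI)
    have "1 / q\<^sup>2 \<le> ?w k"
    proof (cases k)
      case 0
      have "1 / q\<^sup>2 \<le> 1 / l\<^sup>2" using q l by (intro divide_left_mono power_mono) auto
      also have "\<dots> \<le> 4 / l\<^sup>2" by (intro divide_right_mono) auto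
      finally show ?thesis using 0 by simp
    next
      case (Suc j)
      then have nj: "\<zeta> \<notin> J j" using not_less_Least[of j "\<lambda>k. \<zeta> \<in> J k"] by (simp add: k_def)
      then have "\<not> 1 \<le> 2 ^ j * l" using \<zeta> by (auto simp: J_def arc_1 min_def)
      then have "J j = circ_arc t (2 ^ j * l)" by (simp add: J_def min_def)
      with nj norm_eq_1_imp_arc[OF \<zeta>, of t "2 ^ j * l"] have "2 * (2 ^ j * l) < cmod (\<zeta> - cis t)" by force
      with q have qj: "2 ^ j * l < q" by simp
      have "1 / q\<^sup>2 \<le> 1 / (2 ^ j * l)\<^sup>2" using qj l order_less_le_trans[OF l(1) q(1)] by (intro divide_left_mono power_mono) auto
      also have "(2 ^ j * l)\<^sup>2 = 4 ^ j * l\<^sup>2"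
      proof -
        have "((2::real) ^ j)\<^sup>2 = (2\<^sup>2) ^ j" by (simp only: power_mult[symmetric] mult.commute)
        then show ?thesis by (simp add: power_mult_distrib)
      qed
      also have "1 / (4 ^ j * l\<^sup>2) = ?w k" using Suc by (simp add: power_divide)
      finally show ?thesis .
    qed
    then have "g \<zeta> * (1 / q\<^sup>2) \<le> g \<zeta> * ?w k" by (intro mult_left_mono g0)
    then have "ennreal (g \<zeta> / q\<^sup>2) \<le> ennreal (?w k * g \<zeta>)" by (intro ennreal_leI) (simp add: mult.commute)
    also have "\<dots> = ennreal (?w k) * (ennreal (g \<zeta>) * indicator (J k) \<zeta>)"
      using kJ ennreal_mult[of "?w k" "g \<zeta>"] g0 by simp
    \<comment> \<open>The selected term is bounded by the whole series, which can be integrated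
      termwise without discussing how \<open>k\<close> depends on \<zeta>.\<close>
    also have "\<dots> = (\<Sum>i\<in>{k}. ennreal (?w i) * (ennreal (g \<zeta>) * indicator (J i) \<zeta>))" by simp
    also have "\<dots> \<le> (\<Sum>i. ennreal (?w i) * (ennreal (g \<zeta>) * indicator (J i) \<zeta>))"
      by (rule sum_le_suminf[OF summableI]) auto
    finally show ?thesis by (simp add: q_def)
  qed
  have "(\<integral>\<^sup>+\<zeta>. ennreal (g \<zeta> / (cmod (1 + of_real l - cnj (cis t) * \<zeta>))\<^sup>2) \<partial>circle_measure)
     \<le> (\<integral>\<^sup>+\<zeta>. (\<Sum>k. ennreal (?w k) * (ennreal (g \<zeta>) * indicator (J k) \<zeta>)) \<partial>circle_measure)"
    by (rule nn_integral_circle_mono) (rule pt)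
  also have "\<dots> = (\<Sum>k. ennreal (?w k) * (\<integral>\<^sup>+\<zeta>\<in>J k. ennreal (g \<zeta>) \<partial>circle_measure))"
    by (subst nn_integral_suminf) (simp_all add: nn_integral_cmult)
  also have "\<dots> \<le> (\<Sum>k. ennreal (296 * A * l powr (lam - 2) * (3/4) ^ k))"
  proof (intro suminf_le summableI)
    fix k
    have "ennreal (?w k) * (\<integral>\<^sup>+\<zeta>\<in>J k. ennreal (g \<zeta>) \<partial>circle_measure) \<le> ennreal (?w k) * ennreal (74 * A * 3 ^ k * l powr lam)"
      unfolding J_def g_def by (intro mult_left_mono dyadic_oscillation_bound assms) auto
    also have "\<dots> = ennreal (?w k * (74 * A * 3 ^ k * l powr lam))"
      using A by (intro ennreal_mult[symmetric]) auto
    also have "?w k * (74 * A * 3 ^ k * l powr lam) = 296 * A * (l powr lam / l\<^sup>2) * ((1/4) ^ k * 3 ^ k)" by simp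
    also have "l powr lam / l\<^sup>2 = l powr (lam - 2)" using l by (simp add: powr_diff powr_numeral)
    also have "(1/4) ^ k * 3 ^ k = (3/4::real) ^ k" by (simp flip: power_mult_distrib)
    finally show "ennreal (?w k) * (\<integral>\<^sup>+\<zeta>\<in>J k. ennreal (g \<zeta>) \<partial>circle_measure) \<le> ennreal (296 * A * l powr (lam - 2) * (3/4) ^ k)" .
  qed
  also have "\<dots> = ennreal (296 * A * l powr (lam - 2) * (1 / (1 - 3/4)))"
    using A by (intro suminf_ennreal_eq sums_mult geometric_sums) auto
  also have "296 * A * l powr (lam - 2) * (1 / (1 - 3/4)) = 1184 * A * l powr (lam - 2)" by simp
  finally show ?thesis unfolding g_def .
qed

theorem morrey_space_box_energy_le:
  assumes f: "f \<in> morrey_space lam" and lam: "0 < lam" "lam < 1"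
  obtains C where "0 \<le> C"
    "\<And>t l. 0 < l \<Longrightarrow> l \<le> 1 \<Longrightarrow> box_energy 1 f (circ_arc t l) \<le> ennreal (C * l powr lam)"
proof -
  obtain u where f2: "f \<in> hardy2" and b: "boundary_function f u" and
    fin: "(SUP I\<in>circle_arcs. (\<integral>\<^sup>+\<zeta>\<in>I. ennreal ((cmod (u \<zeta> - arc_mean u I))\<^sup>2) \<partial>circle_measure)
          / ennreal (arc_length I powr lam)) < \<infinity>" (is "?S < _")
    using f by (auto simp: morrey_space_def)
  define A where "A = enn2real ?S"
  have A: "0 \<le> A" "?S = ennreal A" using fin by (auto simp: A_def less_top)
  have H: "(\<integral>\<^sup>+\<zeta>\<in>circ_arc t l. ennreal ((cmod (u \<zeta> - arc_mean u (circ_arc t l)))\<^sup>2) \<partial>circle_measure) \<le> ennreal (A * l powr lam)"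
    if l: "0 < l" "l \<le> 1" for t l
  proof -
    have "(\<integral>\<^sup>+\<zeta>\<in>circ_arc t l. ennreal ((cmod (u \<zeta> - arc_mean u (circ_arc t l)))\<^sup>2) \<partial>circle_measure)
          / ennreal (arc_length (circ_arc t l) powr lam) \<le> ennreal A"
      unfolding A(2)[symmetric] by (rule SUP_upper[OF arc_in_circle_arcs[OF l]])
    then show ?thesis using l A by (simp add: arc_length_arc ennreal_divide_le_iff ennreal_mult)
  qed
  have [measurable]: "u \<in> borel_measurable borel" using b by (simp add: boundary_function_def)
  show ?thesis
  proof (rule that[of "720 * 1184 * A"])
    fix t l :: real assume l: "0 < l" "l \<le> 1"
    have "box_energy 1 f (circ_arc t l) \<le> ennreal (720 * l\<^sup>2) *
      (\<integral>\<^sup>+\<zeta>. ennreal ((cmod (u \<zeta> - arc_mean u (circ_arc t l)))\<^sup>2 / (cmod (1 + of_real l - cnj (cis t) * \<zeta>))\<^sup>2) \<partial>circle_measure)"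
      by (rule box_energy_1_le_boundary[OF f2 b l])
    also have "\<dots> \<le> ennreal (720 * l\<^sup>2) * ennreal (1184 * A * l powr (lam - 2))"
      by (intro mult_left_mono poisson_type_oscillation_bound A lam H l) auto
    also have "\<dots> = ennreal (720 * l\<^sup>2 * (1184 * A * l powr (lam - 2)))"
      using A by (intro ennreal_mult[symmetric]) auto
    also have "720 * l\<^sup>2 * (1184 * A * l powr (lam - 2)) = 720 * 1184 * A * l powr lam"
      using l by (simp add: powr_diff powr_numeral)
    finally show "box_energy 1 f (circ_arc t l) \<le> ennreal (720 * 1184 * A * l powr lam)" .
  qed (use A in simp)
qed

section \<open>Growth estimates\<close>

lemma nn_integral_area_affine:
  assumes [measurable]: "F \<in> borel_measurable borel" and r: "0 < r"
  shows "(\<integral>\<^sup>+z. F z \<partial>area_measure) = ennreal (r\<^sup>2) * (\<integral>\<^sup>+z. F (a + of_real r * z) \<partial>area_measure)"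
proof -
  have "(\<integral>\<^sup>+z. F z \<partial>lborel) = (\<integral>\<^sup>+z. F z \<partial>density (distr lborel borel (\<lambda>x. a + r *\<^sub>R x)) (\<lambda>_. ennreal (\<bar>r\<bar> ^ DIM(complex))))"
    using r by (subst lborel_affine[of r a]) (auto simp: ennreal_power)
  also have "\<dots> = ennreal (r\<^sup>2) * (\<integral>\<^sup>+z. F (a + r *\<^sub>R z) \<partial>lborel)"
    by (subst nn_integral_density, simp, simp, subst nn_integral_distr) (simp_all add: nn_integral_cmult)
  finally show ?thesis by (simp add: nn_integral_area_measure scaleR_conv_of_real mult_ac)
qed

lemma sq_norm_le_nn_integral_ball:
  assumes f: "f holomorphic_on ball a r" and r: "0 < r"
  shows "ennreal ((cmod (f a))\<^sup>2 * r\<^sup>2) \<le> (\<integral>\<^sup>+z\<in>ball a r. ennreal ((cmod (f z))\<^sup>2) \<partial>area_measure)"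
proof -
  define g where "g z = f (a + of_real r * z)" for z
  have im: "a + of_real r * z \<in> ball a r \<longleftrightarrow> z \<in> unit_disc" for z
    using r by (simp add: dist_norm norm_mult)
  have g: "g holomorphic_on unit_disc"
    unfolding g_def using im
    by (intro holomorphic_on_compose_gen[OF _ f, unfolded o_def] holomorphic_intros) auto
  define F where "F z = indicator (ball a r) z *\<^sub>R f z" for z
  have [measurable]: "F \<in> borel_measurable borel" unfolding F_def
    by (intro borel_measurable_continuous_on_indicator holomorphic_on_imp_continuous_on[OF f]) simp
  have "ennreal ((cmod (f a))\<^sup>2 * r\<^sup>2) = ennreal (r\<^sup>2) * ennreal ((cmod (g 0))\<^sup>2)"
    by (simp add: g_def ennreal_mult mult.commute)
  also have "\<dots> \<le> ennreal (r\<^sup>2) * (\<integral>\<^sup>+z\<in>unit_disc. ennreal ((cmod (g z))\<^sup>2) \<partial>area_measure)"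
    by (intro mult_left_mono sq_norm_at_0_le_nn_integral_disc g) simp
  also have "(\<integral>\<^sup>+z\<in>unit_disc. ennreal ((cmod (g z))\<^sup>2) \<partial>area_measure) = (\<integral>\<^sup>+z. ennreal ((cmod (F (a + of_real r * z)))\<^sup>2) \<partial>area_measure)"
    using im by (intro nn_integral_cong) (simp add: F_def g_def split: split_indicator)
  also have "ennreal (r\<^sup>2) * \<dots> = (\<integral>\<^sup>+z. ennreal ((cmod (F z))\<^sup>2) \<partial>area_measure)"
    by (rule nn_integral_area_affine[symmetric]) (use r in simp_all)
  also have "\<dots> = (\<integral>\<^sup>+z\<in>ball a r. ennreal ((cmod (f z))\<^sup>2) \<partial>area_measure)"
    by (intro nn_integral_cong) (simp add: F_def split: split_indicator)
  finally show ?thesis .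
qed

text \<open>With d = 1 - |z|, the disc of radius d/2 about z lies in a box over an arc centred in
  the direction of z. There the weight is at least (d/2)^q, and the sub-mean value property of
  |f'|^2 contributes (d/2)^2.\<close>

lemma sq_deriv_le_box_energy:
  assumes f: "f holomorphic_on unit_disc" and z: "z \<in> unit_disc" and q: "0 < q"
  obtains t l where "0 < l" "l \<le> 1" "l \<le> 3/2 * (1 - cmod z)"
    "ennreal ((cmod (deriv f z))\<^sup>2 * ((1 - cmod z) / 2) powr (q + 2)) \<le> box_energy q f (circ_arc t l)"
proof -
  define d where "d = 1 - cmod z"
  have d: "0 < d" using z by (simp add: d_def)
  \<comment> \<open>Points of the disc are within d/2 + d of the boundary point
    \<open>cis t\<close>, hence the 3/2. The minimum takes care of z near the origin, where the box
    is the whole disc.\<close>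
  define l where "l = min 1 (3/2 * d)"
  have l: "0 < l" "l \<le> 1" "l \<le> 3/2 * d" using d by (auto simp: l_def)
  define t where "t = Arg z"
  have zt: "cmod (z - cis t) = d"
  proof -
    have "z - cis t = of_real (cmod z - 1) * cis t"
      using rcis_cmod_Arg[of z] by (simp add: rcis_def t_def algebra_simps)
    then have "cmod (z - cis t) = \<bar>cmod z - 1\<bar>" by (simp only: norm_mult norm_of_real norm_cis mult_1_right)
    then show ?thesis using z by (simp add: d_def)
  qed
  have bd: "cmod w < 1 - d / 2" if "w \<in> ball z (d/2)" for w
    using that norm_triangle_ineq2[of w z] by (simp add: d_def dist_norm norm_minus_commute field_simps)
  have sub: "ball z (d/2) \<subseteq> carleson_box (circ_arc t l)"
  proof
    fix w assume w: "w \<in> ball z (d/2)"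
    have wd: "w \<in> unit_disc" using bd[OF w] d by simp
    show "w \<in> carleson_box (circ_arc t l)"
    proof (cases "l = 1")
      case True then show ?thesis using wd by (simp add: carleson_box_arc_1)
    next
      case False
      then have "l = 3/2 * d" by (simp add: l_def min_def split: if_splits)
      moreover have "cmod (w - cis t) \<le> d / 2 + d"
        using norm_triangle_ineq[of "w - z" "z - cis t"] w zt by (simp add: dist_norm norm_minus_commute)
      ultimately show ?thesis using l wd by (intro carleson_boxI) auto
    qed
  qed
  have df: "deriv f holomorphic_on ball z (d/2)"
    using f by (intro holomorphic_on_subset[OF holomorphic_deriv]) (use bd d in fastforce)+
  have "ennreal ((cmod (deriv f z))\<^sup>2 * (d / 2) powr (q + 2)) = ennreal ((d/2) powr q) * ennreal ((cmod (deriv f z))\<^sup>2 * (d/2)\<^sup>2)"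
    using d by (simp add: powr_add powr_numeral ennreal_mult[symmetric] mult_ac)
  also have "\<dots> \<le> ennreal ((d/2) powr q) * (\<integral>\<^sup>+w\<in>ball z (d/2). ennreal ((cmod (deriv f w))\<^sup>2) \<partial>area_measure)"
    using d by (intro mult_left_mono sq_norm_le_nn_integral_ball df) auto
  also have "\<dots> = (\<integral>\<^sup>+w. ennreal ((d/2) powr q) * (ennreal ((cmod (deriv f w))\<^sup>2) * indicator (ball z (d/2)) w) \<partial>area_measure)"
  proof (rule nn_integral_cmult[symmetric])
    have "(\<lambda>w. indicator (ball z (d/2)) w *\<^sub>R deriv f w) \<in> borel_measurable borel"
      by (intro borel_measurable_continuous_on_indicator holomorphic_on_imp_continuous_on[OF df]) simp
    then have "(\<lambda>w. ennreal ((cmod (indicator (ball z (d/2)) w *\<^sub>R deriv f w))\<^sup>2)) \<in> borel_measurable borel"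
      by measurable
    also have "(\<lambda>w. ennreal ((cmod (indicator (ball z (d/2)) w *\<^sub>R deriv f w))\<^sup>2)) = (\<lambda>w. ennreal ((cmod (deriv f w))\<^sup>2) * indicator (ball z (d/2)) w)"
      by (auto split: split_indicator)
    finally show "(\<lambda>w. ennreal ((cmod (deriv f w))\<^sup>2) * indicator (ball z (d/2)) w) \<in> borel_measurable area_measure"
      by (simp add: measurable_cong_sets[OF sets_area_measure refl])
  qed
  also have "\<dots> \<le> box_energy q f (circ_arc t l)"
    unfolding box_energy_def
  proof (rule nn_integral_mono)
    fix w
    show "ennreal ((d/2) powr q) * (ennreal ((cmod (deriv f w))\<^sup>2) * indicator (ball z (d/2)) w) \<le> ennreal ((cmod (deriv f w))\<^sup>2 * (1 - (cmod w)\<^sup>2) powr q) * indicator (carleson_box (circ_arc t l)) w"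
    proof (cases "w \<in> ball z (d/2)")
      case True
      have "(cmod w)\<^sup>2 \<le> cmod w" using bd[OF True] d by (simp add: power2_eq_square mult_left_le)
      then have "d / 2 \<le> 1 - (cmod w)\<^sup>2" using bd[OF True] by simp
      then have "(d / 2) powr q \<le> (1 - (cmod w)\<^sup>2) powr q" using d q by (intro powr_mono2) auto
      then have "ennreal ((d/2) powr q) * ennreal ((cmod (deriv f w))\<^sup>2) \<le> ennreal ((cmod (deriv f w))\<^sup>2 * (1 - (cmod w)\<^sup>2) powr q)"
        by (subst ennreal_mult[symmetric], simp, simp, subst mult.commute) (intro ennreal_leI mult_left_mono, auto)
      then show ?thesis using True sub by auto
    qed simp
  qed
  finally show ?thesis using l that[of l t] by (simp add: d_def)
qed

text \<open>A real supremum bounds its members only if the family is bounded. The constant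
  \<open>C\<close> obtained from the oscillation supplies this and is then replaced by the norm
  itself, which makes later estimates uniform on norm-bounded sets.\<close>

lemma morrey_norm_facts:
  assumes f: "f \<in> morrey_space lam" and lam: "0 < lam" "lam < 1"
  shows "cmod (f 0) \<le> morrey_norm lam f"
    and "0 < l \<Longrightarrow> l \<le> 1 \<Longrightarrow> box_energy 1 f (circ_arc t l) \<le> ennreal ((morrey_norm lam f)\<^sup>2 * l powr lam)"
proof -
  obtain C where C: "0 \<le> C" "\<And>t l. 0 < l \<Longrightarrow> l \<le> 1 \<Longrightarrow> box_energy 1 f (circ_arc t l) \<le> ennreal (C * l powr lam)"
    using morrey_space_box_energy_le[OF f lam] by blast
  define S where "S I = sqrt (enn2real (box_energy 1 f I / ennreal (arc_length I powr lam)))" for I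
  define N where "N = (SUP I\<in>circle_arcs. S I)"
  have norm: "morrey_norm lam f = cmod (f 0) + N" by (simp add: morrey_norm_def N_def S_def)
  have q: "box_energy 1 f (circ_arc t l) / ennreal (arc_length (circ_arc t l) powr lam) \<le> ennreal C" if "0 < l" "l \<le> 1" for t l
    using C that by (simp add: arc_length_arc ennreal_divide_le_iff ennreal_mult)
  have S0: "0 \<le> S I" for I by (simp add: S_def)
  have "S I \<le> sqrt C" if I: "I \<in> circle_arcs" for I
  proof -
    obtain t l where tl: "0 < l" "l \<le> 1" "I = circ_arc t l" using circle_arcs_cases[OF I] .
    have "enn2real (box_energy 1 f I / ennreal (arc_length I powr lam)) \<le> enn2real (ennreal C)"
      using q[OF tl(1,2), of t] by (intro enn2real_mono) (auto simp: tl)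
    then show ?thesis using C by (simp add: S_def)
  qed
  then have bdd: "bdd_above (S ` circle_arcs)" by (rule bdd_aboveI2)
  have SN: "S I \<le> N" if "I \<in> circle_arcs" for I
    unfolding N_def by (rule cSUP_upper[OF that bdd])
  have "0 \<le> N" using SN[OF arc_in_circle_arcs[of 1 0]] S0[of "circ_arc 0 1"] by simp
  then show n: "cmod (f 0) \<le> morrey_norm lam f" by (simp add: norm)
  have NN: "N \<le> morrey_norm lam f" by (simp add: norm)
  show "box_energy 1 f (circ_arc t l) \<le> ennreal ((morrey_norm lam f)\<^sup>2 * l powr lam)" if l: "0 < l" "l \<le> 1"
  proof -
    let ?x = "box_energy 1 f (circ_arc t l) / ennreal (arc_length (circ_arc t l) powr lam)"
    have fin: "?x < top" using q[OF l] by (rule le_less_trans) simp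
    have "(S (circ_arc t l))\<^sup>2 \<le> (morrey_norm lam f)\<^sup>2"
      using SN[OF arc_in_circle_arcs[OF l, of t]] NN S0[of "circ_arc t l"] by (intro power_mono) auto
    then have "enn2real ?x \<le> (morrey_norm lam f)\<^sup>2" by (simp add: S_def)
    then have "?x \<le> ennreal ((morrey_norm lam f)\<^sup>2)" using fin by (metis ennreal_enn2real ennreal_leI)
    then show ?thesis using l by (simp add: arc_length_arc ennreal_divide_le_iff ennreal_mult)
  qed
qed

lemma morrey_deriv_bound:
  assumes f: "f \<in> morrey_space lam" and lam: "0 < lam" "lam < 1" and z: "z \<in> unit_disc"
  shows "cmod (deriv f z) \<le> 4 * morrey_norm lam f * (1 - cmod z) powr ((lam - 3) / 2)"
proof -
  define d N where "d = 1 - cmod z" and "N = morrey_norm lam f"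
  have d: "0 < d" using z by (simp add: d_def)
  have hf: "f holomorphic_on unit_disc" using f by (simp add: morrey_space_def hardy2_def)
  have N0: "0 \<le> N" using morrey_norm_facts(1)[OF f lam] norm_ge_zero[of "f 0"] unfolding N_def by linarith
  obtain t l where l: "0 < l" "l \<le> 1" "l \<le> 3/2 * d"
    and e: "ennreal ((cmod (deriv f z))\<^sup>2 * (d / 2) powr (1 + 2)) \<le> box_energy 1 f (circ_arc t l)"
    using sq_deriv_le_box_energy[OF hf z zero_less_one] unfolding d_def by blast
  have "ennreal ((cmod (deriv f z))\<^sup>2 * (d / 2) powr (1 + 2)) \<le> ennreal (N\<^sup>2 * l powr lam)"
    using e morrey_norm_facts(2)[OF f lam l(1,2), of t] unfolding N_def by (rule order_trans)
  then have "(cmod (deriv f z))\<^sup>2 * (d / 2) powr (1 + 2) \<le> N\<^sup>2 * l powr lam"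
    by (subst (asm) ennreal_le_iff) auto
  also have "l powr lam \<le> (3/2 * d) powr lam" using l lam by (intro powr_mono2) auto
  also have "\<dots> = (3/2) powr lam * d powr lam" using d by (simp only: powr_mult)
  also have "(3/2::real) powr lam \<le> (3/2) powr 1" using lam by (intro powr_mono) auto
  finally have "(cmod (deriv f z))\<^sup>2 * (d / 2) powr 3 \<le> N\<^sup>2 * (3/2 * d powr lam)"
    by (simp add: mult_left_mono mult_right_mono)
  \<comment> \<open>3/2 is rounded up to 2, so that with the 8 from (d/2)^3 the constant becomes the
    square 16.\<close>
  also have "\<dots> \<le> N\<^sup>2 * (2 * d powr lam)" by (intro mult_left_mono mult_right_mono) auto
  also have "(d / 2) powr 3 = d powr 3 / 8" using d by (simp add: powr_divide)
  finally have "(cmod (deriv f z))\<^sup>2 * d powr 3 \<le> 16 * N\<^sup>2 * d powr lam" by simp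
  then have "(cmod (deriv f z))\<^sup>2 \<le> 16 * N\<^sup>2 * (d powr lam / d powr 3)"
    using d by (simp add: field_simps)
  also have "d powr lam / d powr 3 = (d powr ((lam - 3) / 2))\<^sup>2"
    by (simp only: powr_diff[symmetric] power2_eq_square powr_add[symmetric] field_sum_of_halves)
  finally have "(cmod (deriv f z))\<^sup>2 \<le> (4 * N * d powr ((lam - 3) / 2))\<^sup>2"
    by (simp add: power_mult_distrib)
  then show ?thesis unfolding d_def[symmetric] N_def[symmetric]
    by (rule power2_le_imp_le) (use N0 in simp)
qed

text \<open>The derivative bound is integrated along the radius: raising the exponent (lam-3)/2 by
  one gives -(1-lam)/2. This is negative because lam < 1, so the power is at least 1 and absorbs
  |f(0)|.\<close>

lemma morrey_growth:
  assumes f: "f \<in> morrey_space lam" and lam: "0 < lam" "lam < 1" and z: "z \<in> unit_disc"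
  shows "cmod (f z) \<le> (1 + 8 / (1 - lam)) * morrey_norm lam f * (1 - cmod z) powr (- (1 - lam) / 2)"
proof -
  define N where "N = morrey_norm lam f"
  have hf: "f holomorphic_on unit_disc" using f by (simp add: morrey_space_def hardy2_def)
  have f0: "cmod (f 0) \<le> N" unfolding N_def by (rule morrey_norm_facts(1)[OF f lam])
  then have N0: "0 \<le> N" using norm_ge_zero[of "f 0"] by linarith
  \<comment> \<open>An antiderivative of the bound for the radial derivative; 8/(1-lam) is 4 divided
    by (1-lam)/2.\<close>
  define \<psi> where "\<psi> s = 8 / (1 - lam) * N * (1 - s * cmod z) powr (- (1 - lam) / 2)" for s
  have sz: "0 < 1 - s * cmod z" if "0 \<le> s" "s \<le> 1" for s
  proof -
    have "s * cmod z \<le> 1 * cmod z" using that by (intro mult_right_mono) auto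
    then show ?thesis using z by simp
  qed
  have szd: "of_real s * z \<in> unit_disc" if "0 \<le> s" "s \<le> 1" for s
    using sz[OF that] that by (simp add: norm_mult)
  have df: "((\<lambda>s. f (of_real s * z)) has_vector_derivative (z * deriv f (of_real s * z))) (at s)"
    if "0 \<le> s" "s \<le> 1" for s
  proof -
    have "(f has_field_derivative deriv f (of_real s * z)) (at (of_real s * z))"
      using hf szd[OF that] by (intro holomorphic_derivI[of _ unit_disc]) auto
    moreover have "((\<lambda>s. of_real s * z) has_vector_derivative z) (at s)"
      by (auto intro!: derivative_eq_intros)
    ultimately show ?thesis
      using field_vector_diff_chain_at[of "\<lambda>s. of_real s * z" z s f "deriv f (of_real s * z)"] by (simp add: o_def)
  qed
  have d\<psi>: "(\<psi> has_real_derivative 4 * N * cmod z * (1 - s * cmod z) powr ((lam - 3) / 2)) (at s)"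
    if "0 \<le> s" "s \<le> 1" for s
  proof -
    have "(\<psi> has_real_derivative 8 / (1 - lam) * N * ((- (1 - lam) / 2) * (1 - s * cmod z) powr (- (1 - lam) / 2 - 1) * (- cmod z))) (at s)"
    proof -
      have "((\<lambda>s. 1 - s * cmod z) has_real_derivative - cmod z) (at s)"
        by (auto intro!: derivative_eq_intros)
      from DERIV_cmult[OF DERIV_fun_powr[OF this sz[OF that], of "- (1 - lam) / 2"], of "8 / (1 - lam) * N"]
      show ?thesis unfolding \<psi>_def by (simp add: mult.assoc)
    qed
    moreover have "- (1 - lam) / 2 - 1 = (lam - 3) / 2" by (simp add: field_simps)
    moreover have "8 / (1 - lam) * N * ((- (1 - lam) / 2) * y * (- cmod z)) = 4 * N * cmod z * y" for y
      using lam by (simp add: field_simps)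
    ultimately show ?thesis by (simp only:)
  qed
  have "norm (f (of_real 1 * z) - f (of_real 0 * z)) \<le> \<psi> 1 - \<psi> 0"
  proof (rule differentiable_bound_general[of 0 1 "\<lambda>s. f (of_real s * z)" \<psi> "\<lambda>s. z * deriv f (of_real s * z)" "\<lambda>s. 4 * N * cmod z * (1 - s * cmod z) powr ((lam - 3) / 2)"])
    show "continuous_on {0..1} (\<lambda>s. f (of_real s * z))"
      using df by (intro continuous_at_imp_continuous_on ballI) (auto intro: has_vector_derivative_continuous)
    show "continuous_on {0..1} \<psi>"
      using d\<psi> by (intro continuous_at_imp_continuous_on ballI DERIV_isCont) auto
    fix s :: real assume s: "0 < s" "s < 1"
    show "((\<lambda>s. f (of_real s * z)) has_vector_derivative (z * deriv f (of_real s * z))) (at s)" using df s by simp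
    show "(\<psi> has_vector_derivative 4 * N * cmod z * (1 - s * cmod z) powr ((lam - 3) / 2)) (at s)"
      using d\<psi>[of s] s by (simp add: has_real_derivative_iff_has_vector_derivative)
    have "norm (deriv f (of_real s * z)) \<le> 4 * N * (1 - s * cmod z) powr ((lam - 3) / 2)"
      using morrey_deriv_bound[OF f lam szd[of s]] s by (simp add: N_def norm_mult)
    then have "cmod z * norm (deriv f (of_real s * z)) \<le> cmod z * (4 * N * (1 - s * cmod z) powr ((lam - 3) / 2))"
      by (intro mult_left_mono) auto
    then show "norm (z * deriv f (of_real s * z)) \<le> 4 * N * cmod z * (1 - s * cmod z) powr ((lam - 3) / 2)"
      by (simp add: norm_mult mult_ac)
  qed simp
  moreover have "0 \<le> \<psi> 0" using lam N0 by (simp add: \<psi>_def)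
  ultimately have "cmod (f z - f 0) \<le> \<psi> 1" by simp
  then have "cmod (f z) \<le> N + \<psi> 1" using norm_triangle_ineq[of "f 0" "f z - f 0"] f0 by simp
  also have "N \<le> N * (1 - cmod z) powr (- (1 - lam) / 2)"
  proof -
    have "1 powr (- (1 - lam) / 2) \<le> (1 - cmod z) powr (- (1 - lam) / 2)"
      using z lam by (intro powr_mono2') auto
    then show ?thesis using N0 by (simp add: mult_le_cancel_left1)
  qed
  finally show ?thesis by (simp add: \<psi>_def N_def algebra_simps)
qed

section \<open>Decay of the weighted derivative and the little Bloch-Morrey space\<close>

definition little_weighted :: "real \<Rightarrow> (complex \<Rightarrow> complex) \<Rightarrow> bool" where
  "little_weighted a g \<longleftrightarrow> (\<forall>\<epsilon>>0. \<exists>\<delta>>0. \<forall>z\<in>unit_disc. 1 - cmod z < \<delta> \<longrightarrow> (1 - cmod z) powr a * cmod (deriv g z) \<le> \<epsilon>)"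

text \<open>Apply \<open>sq_deriv_le_box_energy\<close> with the exponent p. The powers of 1 - |z|
  combine to (p + 2) - (p - lam + 1) = 1 + lam, so p cancels; a square root gives the exponent (1 +
  lam)/2.\<close>

lemma little_bloch_morrey_imp_little_weighted:
  assumes g: "g \<in> little_bloch_morrey p lam" and p: "1 < p" and lam: "0 < lam" "lam < 1"
  shows "little_weighted ((1 + lam) / 2) g"
  unfolding little_weighted_def
proof (intro allI impI)
  fix \<epsilon> :: real assume \<epsilon>: "0 < \<epsilon>"
  have hg: "g holomorphic_on unit_disc" using g by (simp add: little_bloch_morrey_def bloch_morrey_def)
  define s where "s = p - lam + 1"
  \<comment> \<open>Chosen to cancel the factors arising from (d/2)^(p+2) and (3/2 d)^s.\<close>
  define c where "c = 2 powr (p + 2) * (3/2) powr s"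
  have c: "0 < c" by (simp add: c_def)
  have s: "0 < s" using p lam by (simp add: s_def)
  from g c \<epsilon> obtain \<delta> where \<delta>: "0 < \<delta>" "\<And>I. I \<in> circle_arcs \<Longrightarrow> arc_length I < \<delta> \<Longrightarrow> box_energy p g I / ennreal (arc_length I powr s) < ennreal (\<epsilon>\<^sup>2 / c)"
    unfolding little_bloch_morrey_def s_def by (auto dest!: spec[of _ "\<epsilon>\<^sup>2 / c"])
  show "\<exists>\<delta>>0. \<forall>z\<in>unit_disc. 1 - cmod z < \<delta> \<longrightarrow> (1 - cmod z) powr ((1 + lam) / 2) * cmod (deriv g z) \<le> \<epsilon>"
  \<comment> \<open>The arc has length at most 3/2 (1-|z|), so the factor 2/3 makes it shorter than
    \<delta>.\<close>
  proof (rule exI[of _ "2/3 * \<delta>"], intro conjI ballI impI)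
    fix z assume z: "z \<in> unit_disc" and zd: "1 - cmod z < 2/3 * \<delta>"
    define d where "d = 1 - cmod z"
    have d: "0 < d" using z by (simp add: d_def)
    obtain t l where l: "0 < l" "l \<le> 1" "l \<le> 3/2 * d"
      and e: "ennreal ((cmod (deriv g z))\<^sup>2 * (d / 2) powr (p + 2)) \<le> box_energy p g (circ_arc t l)"
      using sq_deriv_le_box_energy[OF hg z order.strict_trans[OF zero_less_one p]] unfolding d_def by blast
    have "box_energy p g (circ_arc t l) / ennreal (l powr s) \<le> ennreal (\<epsilon>\<^sup>2 / c)"
      using \<delta>(2)[OF arc_in_circle_arcs[OF l(1,2), of t]] l zd by (simp add: arc_length_arc d_def)
    then have "box_energy p g (circ_arc t l) \<le> ennreal (\<epsilon>\<^sup>2 / c * l powr s)"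
      using l c ennreal_mult[of "\<epsilon>\<^sup>2 / c" "l powr s"] by (simp add: ennreal_divide_le_iff)
    then have "ennreal ((cmod (deriv g z))\<^sup>2 * (d / 2) powr (p + 2)) \<le> ennreal (\<epsilon>\<^sup>2 / c * l powr s)"
      using e by (rule order_trans[rotated])
    then have "(cmod (deriv g z))\<^sup>2 * (d / 2) powr (p + 2) \<le> \<epsilon>\<^sup>2 / c * l powr s"
      using c by (subst (asm) ennreal_le_iff) auto
    also have "\<dots> \<le> \<epsilon>\<^sup>2 / c * (3/2 * d) powr s"
      using l s c by (intro mult_left_mono powr_mono2) auto
    also have "\<dots> = \<epsilon>\<^sup>2 / 2 powr (p + 2) * d powr s"
      using d by (simp only: c_def powr_mult) simp
    finally have "(cmod (deriv g z))\<^sup>2 * d powr (p + 2) \<le> \<epsilon>\<^sup>2 * d powr s"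
      using d by (simp add: powr_divide divide_right_mono field_simps)
    then have "(cmod (deriv g z))\<^sup>2 * (d powr (p + 2) / d powr s) \<le> \<epsilon>\<^sup>2"
      using d by (simp add: field_simps)
    also have "d powr (p + 2) / d powr s = (d powr ((1 + lam) / 2))\<^sup>2"
    proof -
      have "p + 2 - s = 1 + lam" by (simp add: s_def)
      then show ?thesis
        by (simp only: powr_diff[symmetric] power2_eq_square powr_add[symmetric] field_sum_of_halves)
    qed
    finally have "(d powr ((1 + lam) / 2) * cmod (deriv g z))\<^sup>2 \<le> \<epsilon>\<^sup>2" by (simp add: power_mult_distrib mult.commute)
    then show "(1 - cmod z) powr ((1 + lam) / 2) * cmod (deriv g z) \<le> \<epsilon>"
      unfolding d_def[symmetric] by (rule power2_le_imp_le) (use \<epsilon> in simp)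
  qed (use \<delta> in simp)
qed

lemma nn_integral_powr_Ico_1:
  assumes a: "-1 < (a::real)" and l: "0 < l" "l \<le> 1"
  shows "(\<integral>\<^sup>+r\<in>{1-l..<1}. ennreal ((1 - r) powr a) \<partial>lborel) = ennreal (l powr (a + 1) / (a + 1))"
proof -
  have "(\<integral>\<^sup>+r\<in>{1-l..<1}. ennreal ((1 - r) powr a) \<partial>lborel) = (\<integral>\<^sup>+x. ennreal ((1 - (1 + (-1) * x)) powr a) * indicator {1-l..<1} (1 + (-1) * x) \<partial>lborel)"
    using nn_integral_real_affine[of "\<lambda>r. ennreal ((1 - r) powr a) * indicator {1-l..<1} r" "-1" 1] by simp
  also have "\<dots> = (\<integral>\<^sup>+x. ennreal (indicator {0..l} x * x powr a) \<partial>lborel)"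
    by (rule nn_integral_cong_AE, use AE_lborel_singleton[of 0] in eventually_elim) (auto split: split_indicator)
  also have "\<dots> = ennreal (l powr (a + 1) / (a + 1))"
  proof (rule nn_integral_has_integral_lborel)
    have "((\<lambda>x. x powr a) has_integral (l powr (a + 1) / (a + 1))) {0..l}"
      using l by (intro has_integral_powr_from_0 a) simp
    then have "((\<lambda>x. if x \<in> {0..l} then x powr a else 0) has_integral (l powr (a + 1) / (a + 1))) UNIV"
      by (simp only: has_integral_restrict_UNIV)
    moreover have "(\<lambda>x. if x \<in> {0..l} then x powr a else 0) = (\<lambda>x. indicator {0..l} x * x powr a)"
      by (auto split: split_indicator)
    ultimately show "((\<lambda>x. indicator {0..l} x * x powr a) has_integral (l powr (a + 1) / (a + 1))) UNIV" by simp
  qed (auto simp: indicator_def)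
  finally show ?thesis .
qed

text \<open>In polar coordinates a circle of positive radius r meets the box in an arc of measure at
  most l, and only if r \<ge> 1 - l. Since 2r \<le> 2, there remains the integral of (1-r)^a, finite
  for a > -1.\<close>

lemma nn_integral_box_powr_le:
  assumes a: "-1 < a" and l: "0 < l" "l \<le> 1"
  shows "(\<integral>\<^sup>+z\<in>carleson_box (circ_arc t l). ennreal ((1 - cmod z) powr a) \<partial>area_measure) \<le> ennreal (2 * l powr (a + 2) / (a + 1))"
proof -
  note [measurable] = measurable_carleson_box[OF l]
  let ?S = "carleson_box (circ_arc t l)"
  let ?P = "\<lambda>r::real. \<integral>\<^sup>+\<zeta>. ennreal ((1 - cmod (of_real r * \<zeta>)) powr a) * indicator ?S (of_real r * \<zeta>) \<partial>circle_measure"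
  have "(\<integral>\<^sup>+z\<in>?S. ennreal ((1 - cmod z) powr a) \<partial>area_measure)
      = (\<integral>\<^sup>+z\<in>unit_disc. ennreal ((1 - cmod z) powr a) * indicator ?S z \<partial>area_measure)"
    using carleson_box_subset_disc[of "circ_arc t l"] by (intro nn_integral_cong) (auto split: split_indicator)
  also have "\<dots> = (\<integral>\<^sup>+r\<in>{0..<1}. ennreal (2 * r) * (?P r) \<partial>lborel)"
    by (rule nn_integral_disc_polar) measurable
  also have "\<dots> \<le> (\<integral>\<^sup>+r. ennreal (2 * l) * (ennreal ((1 - r) powr a) * indicator {1-l..<1} r) \<partial>lborel)" (is "nn_integral _ ?L \<le> nn_integral _ ?R")
  proof (rule nn_integral_mono)
    fix r :: real
    show "?L r \<le> ?R r"
    \<comment> \<open>At \<open>r = 0\<close> the factor \<open>2 * r\<close> vanishes; for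
      \<open>r > 0\<close> the projection to the circle is defined.\<close>
    proof (cases "0 < r \<and> r < 1")
      case True
      have "(?P r)
         \<le> (\<integral>\<^sup>+\<zeta>. (ennreal ((1 - r) powr a) * indicator {1-l..<1} r) * indicator (circ_arc t l) \<zeta> \<partial>circle_measure)"
      proof (rule nn_integral_mono_AE, use AE_circle_measure_norm in eventually_elim)
        case (elim \<zeta>)
        have "r \<in> {1-l..<1} \<and> \<zeta> \<in> circ_arc t l" if "of_real r * \<zeta> \<in> ?S"
          using carleson_boxD[OF l that] True elim by (cases "\<zeta> = 0") (auto simp: norm_mult)
        then show ?case using True elim by (auto simp: norm_mult split: split_indicator)
      qed
      also have "\<dots> = (ennreal ((1 - r) powr a) * indicator {1-l..<1} r) * ennreal l"
        using l by (subst nn_integral_cmult_indicator) (auto simp: emeasure_arc)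
      finally have "ennreal (2 * r) * (?P r) \<le> ennreal 2 * ((ennreal ((1 - r) powr a) * indicator {1-l..<1} r) * ennreal l)"
        using True by (intro mult_mono ennreal_leI) auto
      also have "\<dots> = ennreal (2 * l) * (ennreal ((1 - r) powr a) * indicator {1-l..<1} r)"
        using l by (simp add: ennreal_mult mult_ac)
      finally show ?thesis using True by simp
    qed (auto split: split_indicator)
  qed
  also have "\<dots> = ennreal (2 * l) * ennreal (l powr (a + 1) / (a + 1))"
    by (subst nn_integral_cmult) (simp_all add: nn_integral_powr_Ico_1[OF a l])
  also have "\<dots> = ennreal (2 * l * (l powr (a + 1) / (a + 1)))"
    using a l by (intro ennreal_mult[symmetric]) auto
  also have "2 * l * (l powr (a + 1) / (a + 1)) = 2 * l powr (a + 2) / (a + 1)"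
    using l by (simp add: powr_add power2_eq_square powr_numeral)
  finally show ?thesis .
qed

text \<open>Squaring the bound leaves the weight (1-|z|)^(p-1-lam), whose exponent exceeds -1
  because p > 1 > lam. The bound \<open>K\<close> is required on one box only, so the same estimate
  serves boundedness over all arcs and decay over short ones.\<close>

lemma box_energy_le_of_weighted_bound:
  assumes p: "1 < p" and lam: "0 < lam" "lam < 1" and l: "0 < l" "l \<le> 1"
    and K: "\<And>z. z \<in> carleson_box (circ_arc t l) \<Longrightarrow> (1 - cmod z) powr ((1 + lam) / 2) * cmod (deriv g z) \<le> K"
  shows "box_energy p g (circ_arc t l) \<le> ennreal (K\<^sup>2 * (2 powr (p + 1) / (p - lam)) * l powr (p - lam + 1))"
proof -
  note [measurable] = measurable_carleson_box[OF l]
  let ?S = "carleson_box (circ_arc t l)"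
  define a where "a = p - 1 - lam"
  have a: "-1 < a" using p lam by (simp add: a_def)
  have "box_energy p g (circ_arc t l) \<le> (\<integral>\<^sup>+z. ennreal (K\<^sup>2 * 2 powr p) * (ennreal ((1 - cmod z) powr a) * indicator ?S z) \<partial>area_measure)" (is "_ \<le> nn_integral _ ?R")
    unfolding box_energy_def
  proof (rule nn_integral_mono)
    fix z
    show "ennreal ((cmod (deriv g z))\<^sup>2 * (1 - (cmod z)\<^sup>2) powr p) * indicator ?S z \<le> ?R z"
    proof (cases "z \<in> ?S")
      case True
      define d where "d = 1 - cmod z"
      have d: "0 < d" "d \<le> 1" using carleson_boxD[OF l True] by (auto simp: d_def)
      have "(d powr ((1 + lam) / 2) * cmod (deriv g z))\<^sup>2 \<le> K\<^sup>2"
        using K[OF True] by (intro power_mono) (auto simp: d_def)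
      then have "d powr (1 + lam) * (cmod (deriv g z))\<^sup>2 \<le> K\<^sup>2"
        by (simp only: power_mult_distrib power2_eq_square[of "d powr _"] powr_add[symmetric] field_sum_of_halves)
      then have 1: "(cmod (deriv g z))\<^sup>2 \<le> K\<^sup>2 / d powr (1 + lam)" using d by (simp add: field_simps)
      have 2: "1 - (cmod z)\<^sup>2 \<le> 2 * d" using weight_sq_le[of z] d by (simp add: d_def)
      have "0 \<le> 1 - (cmod z)\<^sup>2" using d by (simp add: d_def power_le_one)
      then have "(1 - (cmod z)\<^sup>2) powr p \<le> (2 * d) powr p" using 2 p by (intro powr_mono2) auto
      also have "\<dots> = 2 powr p * d powr p" using d by (simp add: powr_mult)
      finally have "(cmod (deriv g z))\<^sup>2 * (1 - (cmod z)\<^sup>2) powr p \<le> (K\<^sup>2 / d powr (1 + lam)) * (2 powr p * d powr p)"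
        by (intro mult_mono 1) auto
      also have "\<dots> = K\<^sup>2 * 2 powr p * (d powr p / d powr (1 + lam))" by simp
      also have "d powr p / d powr (1 + lam) = d powr a" using d by (simp add: powr_diff[symmetric] a_def algebra_simps)
      finally show ?thesis using True by (simp add: d_def ennreal_mult[symmetric] ennreal_leI)
    qed simp
  qed
  also have "\<dots> = ennreal (K\<^sup>2 * 2 powr p) * (\<integral>\<^sup>+z\<in>?S. ennreal ((1 - cmod z) powr a) \<partial>area_measure)"
    by (rule nn_integral_cmult) measurable
  also have "\<dots> \<le> ennreal (K\<^sup>2 * 2 powr p) * ennreal (2 * l powr (a + 2) / (a + 1))"
    by (intro mult_left_mono nn_integral_box_powr_le a l) simp
  also have "\<dots> = ennreal (K\<^sup>2 * 2 powr p * (2 * l powr (a + 2) / (a + 1)))"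
    using a by (intro ennreal_mult[symmetric]) auto
  also have "K\<^sup>2 * 2 powr p * (2 * l powr (a + 2) / (a + 1)) = K\<^sup>2 * (2 powr (p + 1) / (p - lam)) * l powr (p - lam + 1)"
    by (simp add: a_def powr_add algebra_simps)
  finally show ?thesis .
qed

text \<open>The decay condition controls an annulus at the circle; on the remaining compact disc g'
  is bounded by continuity.\<close>

lemma weighted_deriv_bounded:
  assumes g: "g holomorphic_on unit_disc" and lw: "little_weighted a g" and a: "0 < a"
  obtains K where "0 < K" "\<And>z. z \<in> unit_disc \<Longrightarrow> (1 - cmod z) powr a * cmod (deriv g z) \<le> K"
proof -
  obtain \<delta> where \<delta>: "0 < \<delta>" "\<And>z. z \<in> unit_disc \<Longrightarrow> 1 - cmod z < \<delta> \<Longrightarrow> (1 - cmod z) powr a * cmod (deriv g z) \<le> 1"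
    using lw by (auto simp: little_weighted_def dest!: spec[of _ "1::real"])
  have "continuous_on (cball 0 (1 - \<delta>)) (deriv g)"
    using g \<delta>(1) by (intro holomorphic_on_imp_continuous_on holomorphic_on_subset[OF holomorphic_deriv]) auto
  then have "bounded (deriv g ` cball 0 (1 - \<delta>))"
    by (intro compact_imp_bounded compact_continuous_image) auto
  then obtain B where B: "0 < B" "\<And>z. z \<in> cball 0 (1 - \<delta>) \<Longrightarrow> cmod (deriv g z) \<le> B"
    by (auto simp: bounded_pos)
  show ?thesis
  proof (rule that[of "max 1 B"])
    fix z assume z: "z \<in> unit_disc"
    show "(1 - cmod z) powr a * cmod (deriv g z) \<le> max 1 B"
    proof (cases "1 - cmod z < \<delta>")
      case True then show ?thesis using \<delta>(2)[OF z] by simp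
    next
      case False
      have "(1 - cmod z) powr a * cmod (deriv g z) \<le> 1 * B"
        using False z a B by (intro mult_mono powr_le1) auto
      then show ?thesis by simp
    qed
  qed simp
qed

theorem little_bloch_morrey_iff:
  assumes g: "g holomorphic_on unit_disc" and p: "1 < p" and lam: "0 < lam" "lam < 1"
  shows "g \<in> little_bloch_morrey p lam \<longleftrightarrow> little_weighted ((1 + lam) / 2) g"
proof
  assume lw: "little_weighted ((1 + lam) / 2) g"
  define c where "c = 2 powr (p + 1) / (p - lam)"
  have c: "0 < c" using p lam by (simp add: c_def)
  obtain K where K: "0 < K" "\<And>z. z \<in> unit_disc \<Longrightarrow> (1 - cmod z) powr ((1 + lam) / 2) * cmod (deriv g z) \<le> K"
    using weighted_deriv_bounded[OF g lw] lam by auto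
  have quot: "box_energy p g (circ_arc t l) / ennreal (arc_length (circ_arc t l) powr (p - lam + 1)) \<le> ennreal (M\<^sup>2 * c)"
    if l: "0 < l" "l \<le> 1" and M: "\<And>z. z \<in> carleson_box (circ_arc t l) \<Longrightarrow> (1 - cmod z) powr ((1 + lam) / 2) * cmod (deriv g z) \<le> M" for t l M
  proof -
    have "box_energy p g (circ_arc t l) \<le> ennreal (M\<^sup>2 * c * l powr (p - lam + 1))"
      unfolding c_def by (rule box_energy_le_of_weighted_bound[OF p lam l M])
    then show ?thesis using l c by (simp add: arc_length_arc ennreal_divide_le_iff ennreal_mult)
  qed
  have "(SUP I\<in>circle_arcs. box_energy p g I / ennreal (arc_length I powr (p - lam + 1))) \<le> ennreal (K\<^sup>2 * c)"
  proof (rule SUP_least)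
    fix I assume "I \<in> circle_arcs"
    then obtain t l where tl: "0 < l" "l \<le> 1" "I = circ_arc t l" by (rule circle_arcs_cases)
    show "box_energy p g I / ennreal (arc_length I powr (p - lam + 1)) \<le> ennreal (K\<^sup>2 * c)"
      unfolding tl(3) using carleson_box_subset_disc K by (intro quot tl) blast
  qed
  then have bm: "g \<in> bloch_morrey p lam"
    unfolding bloch_morrey_def using g by (auto intro: le_less_trans)
  show "g \<in> little_bloch_morrey p lam"
    unfolding little_bloch_morrey_def
  proof (intro CollectI conjI bm allI impI)
    fix \<epsilon> :: real assume \<epsilon>: "0 < \<epsilon>"
    \<comment> \<open>The bound becomes \<epsilon>/2, because the definition of
      \<open>little_bloch_morrey\<close> asks for a strict inequality.\<close>
    define \<eta> where "\<eta> = sqrt (\<epsilon> / (2 * c))"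
    have \<eta>: "0 < \<eta>" "\<eta>\<^sup>2 * c = \<epsilon> / 2" using \<epsilon> c by (auto simp: \<eta>_def)
    obtain \<delta> where \<delta>: "0 < \<delta>" "\<And>z. z \<in> unit_disc \<Longrightarrow> 1 - cmod z < \<delta> \<Longrightarrow> (1 - cmod z) powr ((1 + lam) / 2) * cmod (deriv g z) \<le> \<eta>"
      using lw \<eta> by (auto simp: little_weighted_def)
    show "\<exists>\<delta>>0. \<forall>I\<in>circle_arcs. arc_length I < \<delta> \<longrightarrow> box_energy p g I / ennreal (arc_length I powr (p - lam + 1)) < ennreal \<epsilon>"
    proof (intro exI conjI ballI impI)
      fix I assume I: "I \<in> circle_arcs" "arc_length I < \<delta>"
      from I(1) obtain t l where tl: "0 < l" "l \<le> 1" "I = circ_arc t l" by (rule circle_arcs_cases)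
      \<comment> \<open>The box over such an arc lies in the annulus 1 - |z| < \<delta>, where the
        weighted derivative is at most \<eta>.\<close>
      have "l < \<delta>" using I(2) tl by (simp add: arc_length_arc)
      then have "box_energy p g I / ennreal (arc_length I powr (p - lam + 1)) \<le> ennreal (\<eta>\<^sup>2 * c)"
        unfolding tl(3) using carleson_boxD[OF tl(1,2)] by (intro quot tl \<delta>(2)) force+
      also have "\<dots> < ennreal \<epsilon>" using \<epsilon> \<eta> by (simp add: ennreal_lessI)
      finally show "box_energy p g I / ennreal (arc_length I powr (p - lam + 1)) < ennreal \<epsilon>" .
    qed (rule \<delta>(1))
  qed
qed (rule little_bloch_morrey_imp_little_weighted[OF _ p lam])

section \<open>Test functions\<close>

text \<open>A Lipschitz function deviates from its mean over an arc of length l by O(l), so the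
  oscillation integral is O(l^3), which is O(l^lam) for l \<le> 1. Membership in
  \<open>morrey_space\<close> refers to boundary values, and this criterion settles it for functions
  smooth up to the circle.\<close>

lemma lipschitz_imp_morrey:
  assumes f: "f \<in> hardy2" and b: "boundary_function f u" and lam: "0 < lam" "lam < 1"
    and B: "\<And>\<zeta> \<xi>. cmod \<zeta> = 1 \<Longrightarrow> cmod \<xi> = 1 \<Longrightarrow> cmod (u \<zeta> - u \<xi>) \<le> B * cmod (\<zeta> - \<xi>)"
  shows "f \<in> morrey_space lam"
proof -
  let ?Q = "\<lambda>I. \<integral>\<^sup>+\<zeta>\<in>I. ennreal ((cmod (u \<zeta> - arc_mean u I))\<^sup>2) \<partial>circle_measure"
  have [measurable]: "u \<in> borel_measurable borel" using b by (simp add: boundary_function_def)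
  have B0: "0 \<le> B" using order_trans[OF norm_ge_zero B[of 1 "-1"]] by simp
  have int_u: "integrable circle_measure u"
  proof (rule integrable_circle_measure_bound[of _ "cmod (u 1) + B * 2"])
    fix \<zeta> :: complex assume z: "cmod \<zeta> = 1"
    have "cmod (u \<zeta> - u 1) \<le> B * cmod (\<zeta> - 1)" using B[OF z, of 1] by simp
    also have "\<dots> \<le> B * 2" using norm_triangle_ineq4[of \<zeta> 1] z B0 by (intro mult_left_mono) auto
    finally show "cmod (u \<zeta>) \<le> cmod (u 1) + B * 2" using norm_triangle_ineq[of "u \<zeta> - u 1" "u 1"] by simp
  qed simp
  have osc: "cmod (u \<zeta> - arc_mean u (circ_arc t l)) \<le> B * (2 * pi * l)"
    if l: "0 < l" "l \<le> 1" and \<zeta>: "\<zeta> \<in> circ_arc t l" for t l \<zeta>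
  proof -
    let ?I = "circ_arc t l"
    have I1: "cmod \<xi> = 1" if "\<xi> \<in> ?I" for \<xi> using that by (auto simp: circ_arc_def)
    have lI: "measure circle_measure ?I = l" using arc_length_arc[OF l, of t] by (simp add: arc_length_def)
    have int1: "integrable circle_measure (\<lambda>\<xi>. indicator ?I \<xi> *\<^sub>R u \<xi>)"
      using int_u by (intro integrable_mult_indicator) auto
    have int2: "integrable circle_measure (\<lambda>\<xi>. indicator ?I \<xi> *\<^sub>R u \<zeta>)"
      by (intro integrable_mult_indicator) auto
    \<comment> \<open>Multiplied by l, value and mean become integrals over the same arc and can be
      subtracted under the integral sign.\<close>
    have "of_real l * u \<zeta> = (LINT \<xi>|circle_measure. indicator ?I \<xi> *\<^sub>R u \<zeta>)"
      by (subst integral_scaleR_left) (auto simp: lI scaleR_conv_of_real circle.emeasure_eq_measure)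
    moreover have "of_real l * arc_mean u ?I = (LINT \<xi>|circle_measure. indicator ?I \<xi> *\<^sub>R u \<xi>)"
      using l by (simp add: arc_mean_def arc_length_arc set_lebesgue_integral_def)
    ultimately have "of_real l * (u \<zeta> - arc_mean u ?I) = (LINT \<xi>|circle_measure. indicator ?I \<xi> *\<^sub>R u \<zeta> - indicator ?I \<xi> *\<^sub>R u \<xi>)"
      by (simp add: Bochner_Integration.integral_diff[OF int2 int1] right_diff_distrib)
    also have "cmod \<dots> \<le> (LINT \<xi>|circle_measure. (B * (2 * pi * l)) * indicator ?I \<xi>)"
    proof (rule Bochner_Integration.integral_norm_bound_integral)
      show "integrable circle_measure (\<lambda>\<xi>. indicator ?I \<xi> *\<^sub>R u \<zeta> - indicator ?I \<xi> *\<^sub>R u \<xi>)"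
        by (rule Bochner_Integration.integrable_diff[OF int2 int1])
      show "integrable circle_measure (\<lambda>\<xi>. B * (2 * pi * l) * indicat_real ?I \<xi>)"
        by (intro integrable_mult_right) (auto simp: circle.emeasure_eq_measure)
      fix \<xi>
      have "cmod (u \<zeta> - u \<xi>) \<le> B * (2 * pi * l)" if xi: "\<xi> \<in> ?I"
      proof -
        have "cmod (\<zeta> - \<xi>) \<le> pi * l + pi * l"
          using norm_triangle_ineq4[of "\<zeta> - cis t" "\<xi> - cis t"] arc_norm_diff_le[OF \<zeta>] arc_norm_diff_le[OF xi] by simp
        then have "B * cmod (\<zeta> - \<xi>) \<le> B * (2 * pi * l)" using B0 by (intro mult_left_mono) auto
        then show ?thesis using B[OF I1[OF \<zeta>] I1[OF xi]] by simp
      qed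
      then show "norm (indicator ?I \<xi> *\<^sub>R u \<zeta> - indicator ?I \<xi> *\<^sub>R u \<xi>) \<le> B * (2 * pi * l) * indicat_real ?I \<xi>"
        by (auto split: split_indicator)
    qed
    also have "\<dots> = B * (2 * pi * l) * l" by (simp add: lI)
    finally show ?thesis using l by (simp add: norm_mult)
  qed
  have "(SUP I\<in>circle_arcs. (?Q I)
          / ennreal (arc_length I powr lam)) \<le> ennreal ((B * (2 * pi))\<^sup>2)"
  proof (rule SUP_least)
    fix I assume "I \<in> circle_arcs"
    then obtain t l where l: "0 < l" "l \<le> 1" and I: "I = circ_arc t l" by (rule circle_arcs_cases)
    have "(?Q I)
        \<le> (\<integral>\<^sup>+\<zeta>. ennreal ((B * (2 * pi * l))\<^sup>2) * indicator I \<zeta> \<partial>circle_measure)"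
      using osc[OF l] unfolding I
      by (intro nn_integral_mono) (auto intro!: ennreal_leI power_mono split: split_indicator)
    also have "\<dots> = ennreal ((B * (2 * pi * l))\<^sup>2) * ennreal l"
      unfolding I using l by (subst nn_integral_cmult_indicator) (auto simp: emeasure_arc)
    also have "\<dots> = ennreal ((B * (2 * pi))\<^sup>2 * l ^ 3)"
      using l by (subst ennreal_mult[symmetric], simp, simp) (simp add: power2_eq_square power3_eq_cube mult_ac)
    also have "\<dots> \<le> ennreal ((B * (2 * pi))\<^sup>2 * l powr lam)"
    proof (intro ennreal_leI mult_left_mono)
      have "l powr 3 \<le> l powr lam" using l lam by (intro powr_mono') auto
      then show "l ^ 3 \<le> l powr lam" using l by (simp add: powr_numeral)
    qed simp
    finally show "(?Q I)
          / ennreal (arc_length I powr lam) \<le> ennreal ((B * (2 * pi))\<^sup>2)"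
      using l by (simp add: I arc_length_arc ennreal_divide_le_iff ennreal_mult)
  qed
  from le_less_trans[OF this ennreal_less_top] show ?thesis
    unfolding morrey_space_def infinity_ennreal_def using f b by blast
qed

text \<open>The normalized Cauchy kernel. At \<open>z = w\<close> its modulus is (1-|w|^2)^(s-1);
  for s = (1+lam)/2 this is the growth rate in \<open>morrey_growth\<close>.\<close>

definition cauchy_test :: "real \<Rightarrow> complex \<Rightarrow> complex \<Rightarrow> complex" where
  "cauchy_test s w z = of_real ((1 - (cmod w)\<^sup>2) powr s) / (1 - cnj w * z)"

lemma cauchy_denom_ge:
  assumes "cmod z \<le> 1"
  shows "1 - cmod w \<le> cmod (1 - cnj w * z)"
proof -
  have "cmod (cnj w * z) \<le> cmod w * 1" unfolding norm_mult complex_mod_cnj using assms by (intro mult_left_mono) auto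
  then show ?thesis using norm_triangle_ineq2[of 1 "cnj w * z"] by simp
qed

lemma cauchy_denom_ge':
  assumes "cmod w \<le> 1"
  shows "1 - cmod z \<le> cmod (1 - cnj w * z)"
  using cauchy_denom_ge[of "cnj w" "cnj z"] assms by (simp add: mult.commute)

lemma cauchy_denom_nz: "cmod w < 1 \<Longrightarrow> cmod z \<le> 1 \<Longrightarrow> 1 - cnj w * z \<noteq> 0"
  using cauchy_denom_ge[of z w] by auto

lemma cauchy_test_holomorphic: "cmod w < 1 \<Longrightarrow> cauchy_test s w holomorphic_on unit_disc"
  unfolding cauchy_test_def using cauchy_denom_nz[of w] by (intro holomorphic_intros) auto

lemma deriv_cauchy_test:
  assumes "cmod w < 1" "cmod z < 1"
  shows "deriv (cauchy_test s w) z = cnj w * of_real ((1 - (cmod w)\<^sup>2) powr s) / (1 - cnj w * z)\<^sup>2"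
  unfolding cauchy_test_def using cauchy_denom_nz[of w z] assms
  by (intro DERIV_imp_deriv) (auto intro!: derivative_eq_intros simp: power2_eq_square)

text \<open>For fixed w the denominator stays away from 0 on the closed disc, so the formula itself
  gives the boundary values, and they are Lipschitz. The Lipschitz bound obtained deteriorates as
  |w| -> 1; uniformity in w is obtained separately, through box energies.\<close>

lemma cauchy_test_in_morrey:
  assumes w: "cmod w < 1" and lam: "0 < lam" "lam < 1"
  shows "cauchy_test s w \<in> morrey_space lam"
proof (rule lipschitz_imp_morrey[OF _ _ lam])
  let ?c = "(1 - (cmod w)\<^sup>2) powr s"
  have le: "cmod (cauchy_test s w z) \<le> ?c / (1 - cmod w)" if "cmod z \<le> 1" for z
    unfolding cauchy_test_def norm_divide norm_of_real
    using cauchy_denom_ge[OF that, of w] w by (intro frac_le) auto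
  show "cauchy_test s w \<in> hardy2"
    unfolding hardy2_iff
  proof (intro conjI cauchy_test_holomorphic[OF w] exI ballI)
    fix r :: real assume r: "r \<in> {0..<1}"
    have "circle_mean (cauchy_test s w) r \<le> (\<integral>\<^sup>+\<zeta>. ennreal ((?c / (1 - cmod w))\<^sup>2) \<partial>circle_measure)"
      unfolding circle_mean_def
      by (rule nn_integral_circle_mono)
         (use r in \<open>auto intro!: ennreal_leI power_mono le simp: norm_mult\<close>)
    then show "circle_mean (cauchy_test s w) r \<le> ennreal ((?c / (1 - cmod w))\<^sup>2)" by simp
  qed
  show "boundary_function (cauchy_test s w) (cauchy_test s w)"
    unfolding boundary_function_def
  proof
    show "cauchy_test s w \<in> borel_measurable borel"
      unfolding cauchy_test_def[abs_def] by measurable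
    show "AE \<zeta> in circle_measure. ((\<lambda>r. cauchy_test s w (of_real r * \<zeta>)) \<longlongrightarrow> cauchy_test s w \<zeta>) (at_left (1::real))"
    proof (use AE_circle_measure_norm in eventually_elim)
      case (elim \<zeta>)
      have "((\<lambda>r. cauchy_test s w (of_real r * \<zeta>)) \<longlongrightarrow> cauchy_test s w (of_real 1 * \<zeta>)) (at_left (1::real))"
        unfolding cauchy_test_def using cauchy_denom_nz[OF w, of \<zeta>] elim by (intro tendsto_intros) auto
      then show ?case by simp
    qed
  qed
  fix \<zeta> \<xi> :: complex assume z: "cmod \<zeta> = 1" "cmod \<xi> = 1"
  have nz: "1 - cnj w * \<zeta> \<noteq> 0" "1 - cnj w * \<xi> \<noteq> 0" using cauchy_denom_nz[OF w] z by auto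
  have "cauchy_test s w \<zeta> - cauchy_test s w \<xi> = of_real ?c * (cnj w * (\<zeta> - \<xi>)) / ((1 - cnj w * \<zeta>) * (1 - cnj w * \<xi>))"
    using nz by (simp add: cauchy_test_def divide_simps) (simp add: algebra_simps)
  then have "cmod (cauchy_test s w \<zeta> - cauchy_test s w \<xi>) = ?c * (cmod w * cmod (\<zeta> - \<xi>)) / (cmod (1 - cnj w * \<zeta>) * cmod (1 - cnj w * \<xi>))"
    by (simp add: norm_mult norm_divide)
  also have "\<dots> \<le> ?c * (1 * cmod (\<zeta> - \<xi>)) / ((1 - cmod w) * (1 - cmod w))"
    using w z cauchy_denom_ge[of \<zeta> w] cauchy_denom_ge[of \<xi> w] by (intro frac_le mult_mono mult_left_mono mult_right_mono) auto
  finally show "cmod (cauchy_test s w \<zeta> - cauchy_test s w \<xi>) \<le> (?c / ((1 - cmod w) * (1 - cmod w))) * cmod (\<zeta> - \<xi>)"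
    by simp
qed

text \<open>Parseval for the geometric series, whose squared coefficients are dominated by the
  powers of |w|^2.\<close>

lemma circle_mean_cauchy_kernel_le:
  assumes w: "cmod w < 1" and r: "0 \<le> r" "r < 1"
  shows "circle_mean (\<lambda>z. 1 / (1 - cnj w * z)) r \<le> ennreal (1 / (1 - (cmod w)\<^sup>2))"
proof -
  have wr: "cmod (cnj w * of_real r) < 1"
  proof -
    have "cmod w * r \<le> cmod w * 1" using r by (intro mult_left_mono) auto
    then show ?thesis using w r by (simp add: norm_mult)
  qed
  have w2: "(cmod w)\<^sup>2 < 1" using w by (simp add: power_less_one_iff)
  have "circle_mean (\<lambda>z. 1 / (1 - cnj w * z)) r = (\<Sum>n. ennreal ((cmod ((cnj w * of_real r) ^ n))\<^sup>2))"
    unfolding circle_mean_def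
  proof (rule nn_integral_circle_parseval)
    show "summable (\<lambda>n. norm ((cnj w * of_real r) ^ n))"
      unfolding norm_power using wr by (intro summable_geometric) simp
    fix \<zeta> :: complex assume "cmod \<zeta> = 1"
    then have "cmod (cnj w * of_real r * \<zeta>) < 1" using wr by (simp add: norm_mult)
    from geometric_sums[OF this] show "(\<lambda>n. (cnj w * of_real r) ^ n * \<zeta> ^ n) sums (1 / (1 - cnj w * (of_real r * \<zeta>)))"
      by (simp add: power_mult_distrib mult.assoc)
  qed
  also have "\<dots> \<le> (\<Sum>n. ennreal (((cmod w)\<^sup>2) ^ n))"
  proof (intro suminf_le summableI ennreal_leI)
    fix n
    have "cmod ((cnj w * of_real r) ^ n) \<le> cmod w ^ n"
      unfolding norm_power using r by (intro power_mono) (auto simp: norm_mult mult_left_le)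
    then have "(cmod ((cnj w * of_real r) ^ n))\<^sup>2 \<le> (cmod w ^ n)\<^sup>2" by (intro power_mono) auto
    then show "(cmod ((cnj w * of_real r) ^ n))\<^sup>2 \<le> ((cmod w)\<^sup>2) ^ n" by (simp only: power_mult[symmetric] mult.commute)
  qed
  also have "\<dots> = ennreal (1 / (1 - (cmod w)\<^sup>2))"
    using w2 by (intro suminf_ennreal_eq geometric_sums) auto
  finally show ?thesis .
qed

text \<open>With \<delta> = 1 - |w|^2 there are two regimes. For l \<le> \<delta> there is a
  pointwise bound |f'|^2 \<le> 16 \<delta>^(lam-3), the weight is at most 2l, and the box lies in a
  disc of normalized area 25 l^2; hence 800. For l > \<delta> the energy of the whole disc, at most
  \<delta>^(1+lam) / \<delta> by Littlewood-Paley, is already below l^lam.\<close>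

lemma cauchy_test_box_energy_le:
  assumes w: "cmod w < 1" and lam: "0 < lam" "lam < 1" and l: "0 < l" "l \<le> 1"
  shows "box_energy 1 (cauchy_test ((1 + lam) / 2) w) (circ_arc t l) \<le> ennreal (800 * l powr lam)"
proof -
  note [measurable] = measurable_carleson_box[OF l]
  define \<delta> where "\<delta> = 1 - (cmod w)\<^sup>2"
  have w2: "(cmod w)\<^sup>2 < 1" using w by (simp add: power_less_one_iff)
  have \<delta>: "0 < \<delta>" "\<delta> \<le> 1" using w2 by (auto simp: \<delta>_def)
  have sq: "(\<delta> powr ((1 + lam) / 2))\<^sup>2 = \<delta> powr (1 + lam)"
    by (simp only: power2_eq_square powr_add[symmetric] field_sum_of_halves)
  let ?f = "cauchy_test ((1 + lam) / 2) w"
  let ?S = "carleson_box (circ_arc t l)"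
  have dsq: "(cmod (deriv ?f z))\<^sup>2 = (cmod w)\<^sup>2 * \<delta> powr (1 + lam) / cmod (1 - cnj w * z) ^ 4"
    if "cmod z < 1" for z
    using deriv_cauchy_test[OF w that, of "(1 + lam) / 2"]
    by (simp add: norm_mult norm_divide norm_power power_mult_distrib power_divide sq flip: \<delta>_def power_mult)
  show ?thesis
  proof (cases "l \<le> \<delta>")
    case True
    have "box_energy 1 ?f (circ_arc t l) \<le> (\<integral>\<^sup>+z. ennreal (32 * \<delta> powr (lam - 3) * l) * indicator (cball (cis t) (5 * l)) z \<partial>area_measure)" (is "_ \<le> nn_integral _ ?R")
      unfolding box_energy_def
    proof (rule nn_integral_mono)
      fix z
      show "ennreal ((cmod (deriv ?f z))\<^sup>2 * (1 - (cmod z)\<^sup>2) powr 1) * indicator ?S z \<le> ?R z"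
      proof (cases "z \<in> ?S")
        case zS: True
        note zb = carleson_boxD[OF l zS]
        \<comment> \<open>1 - |w| \<ge> \<delta>/2, uniformly in z; the fourth power of this bound
          produces the 16.\<close>
        have "\<delta> / 2 \<le> cmod (1 - cnj w * z)"
          using weight_sq_le[of w] w cauchy_denom_ge[of z w] zb by (simp add: \<delta>_def)
        then have "(\<delta> / 2) ^ 4 \<le> cmod (1 - cnj w * z) ^ 4" using \<delta> by (intro power_mono) auto
        then have "(cmod w)\<^sup>2 * \<delta> powr (1 + lam) / cmod (1 - cnj w * z) ^ 4 \<le> 1 * \<delta> powr (1 + lam) / (\<delta> / 2) ^ 4"
          using \<delta> w2 by (intro frac_le mult_right_mono) auto
        also have "\<dots> = 16 * (\<delta> powr (1 + lam) / \<delta> powr 4)" using \<delta> by (simp add: power_divide powr_numeral)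
        also have "\<delta> powr (1 + lam) / \<delta> powr 4 = \<delta> powr (lam - 3)" by (simp only: powr_diff[symmetric]) simp
        finally have 1: "(cmod (deriv ?f z))\<^sup>2 \<le> 16 * \<delta> powr (lam - 3)"
          using dsq[of z] zb by simp
        have 2: "1 - (cmod z)\<^sup>2 \<le> 2 * l" using weight_sq_le[of z] zb by simp
        have 3: "0 \<le> 1 - (cmod z)\<^sup>2" using zb by (simp add: power_le_one)
        have "(cmod (deriv ?f z))\<^sup>2 * (1 - (cmod z)\<^sup>2) \<le> (16 * \<delta> powr (lam - 3)) * (2 * l)"
          by (intro mult_mono 1 2 3) auto
        then show ?thesis using zS zb 3 by (simp add: dist_norm norm_minus_commute ennreal_leI mult_ac)
      qed simp
    qed
    also have "\<dots> = ennreal (32 * \<delta> powr (lam - 3) * l) * ennreal ((5 * l)\<^sup>2)"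
      using l by (subst nn_integral_cmult_indicator) (auto simp: emeasure_area_measure_cball)
    also have "\<dots> = ennreal (800 * (\<delta> powr (lam - 3) * l ^ 3))"
      using l by (subst ennreal_mult[symmetric], simp, simp) (simp add: power2_eq_square power3_eq_cube mult_ac)
    also have "\<dots> \<le> ennreal (800 * l powr lam)"
    proof (intro ennreal_leI mult_left_mono)
      \<comment> \<open>The exponent lam - 3 is negative, so replacing \<delta> by the smaller l
        increases the power.\<close>
      have "\<delta> powr (lam - 3) * l ^ 3 \<le> l powr (lam - 3) * l ^ 3"
        using True l lam by (intro mult_right_mono powr_mono2') auto
      also have "\<dots> = l powr lam" using l by (simp add: powr_diff powr_numeral)
      finally show "\<delta> powr (lam - 3) * l ^ 3 \<le> l powr lam" .
    qed simp
    finally show ?thesis .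
  next
    case False
    define F where "F z = 1 / (1 - cnj w * z)" for z
    have hF: "F holomorphic_on unit_disc"
      unfolding F_def using cauchy_denom_nz[OF w] by (intro holomorphic_intros) auto
    have dF: "deriv F z = cnj w / (1 - cnj w * z)\<^sup>2" if "cmod z < 1" for z
      unfolding F_def using cauchy_denom_nz[OF w, of z] that
      by (intro DERIV_imp_deriv) (auto intro!: derivative_eq_intros simp: power2_eq_square)
    let ?G = "\<lambda>z. ennreal ((cmod (deriv F z))\<^sup>2 * (1 - (cmod z)\<^sup>2)) * indicator unit_disc z"
    have "deriv F holomorphic_on unit_disc" using hF by (intro holomorphic_deriv) auto
    then have [measurable]: "?G \<in> borel_measurable borel"
      by (intro measurable_disc_sq_norm holomorphic_on_imp_continuous_on) measurable
    have "box_energy 1 ?f (circ_arc t l) \<le> (\<integral>\<^sup>+z. ennreal (\<delta> powr (1 + lam)) * ?G z \<partial>area_measure)" (is "_ \<le> nn_integral _ ?R")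
      unfolding box_energy_def
    proof (rule nn_integral_mono)
      fix z
      show "ennreal ((cmod (deriv ?f z))\<^sup>2 * (1 - (cmod z)\<^sup>2) powr 1) * indicator ?S z \<le> ?R z"
      proof (cases "z \<in> ?S")
        case True
        note zb = carleson_boxD[OF l True]
        have 3: "0 \<le> 1 - (cmod z)\<^sup>2" using zb by (simp add: power_le_one)
        have "(cmod (deriv ?f z))\<^sup>2 = \<delta> powr (1 + lam) * (cmod (deriv F z))\<^sup>2"
          using dsq[of z] dF[of z] zb by (simp add: norm_divide norm_power power_divide flip: power_mult)
        then show ?thesis using True zb 3 by (simp add: ennreal_mult mult.assoc)
      qed simp
    qed
    also have "\<dots> = ennreal (\<delta> powr (1 + lam)) * (\<integral>\<^sup>+z. ?G z \<partial>area_measure)"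
      by (rule nn_integral_cmult) measurable
    also have "\<dots> \<le> ennreal (\<delta> powr (1 + lam)) * ennreal (1 / \<delta>)"
    proof (intro mult_left_mono)
      show "(\<integral>\<^sup>+z. ?G z \<partial>area_measure) \<le> ennreal (1 / \<delta>)"
        by (rule littlewood_paley_le[OF hF]) (unfold F_def \<delta>_def, rule circle_mean_cauchy_kernel_le[OF w])
    qed simp
    also have "\<dots> = ennreal (\<delta> powr (1 + lam) * (1 / \<delta>))"
      using \<delta> by (intro ennreal_mult[symmetric]) auto
    also have "\<delta> powr (1 + lam) * (1 / \<delta>) = \<delta> powr lam" using \<delta> by (simp add: powr_add)
    also have "ennreal (\<delta> powr lam) \<le> ennreal (800 * l powr lam)"
    proof (rule ennreal_leI)
      have "\<delta> powr lam \<le> l powr lam" using False \<delta> lam by (intro powr_mono2) auto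
      then show "\<delta> powr lam \<le> 800 * l powr lam" using powr_ge_zero[of l lam] by linarith
    qed
    finally show ?thesis .
  qed
qed

lemma cauchy_test_morrey_norm_le:
  assumes w: "cmod w < 1" and lam: "0 < lam" "lam < 1"
  shows "morrey_norm lam (cauchy_test ((1 + lam) / 2) w) \<le> 1 + sqrt 800"
proof -
  let ?f = "cauchy_test ((1 + lam) / 2) w"
  have "(1 - (cmod w)\<^sup>2) powr ((1 + lam) / 2) \<le> 1"
    using w lam by (intro powr_le1) (auto simp: power_le_one)
  then have "cmod (?f 0) \<le> 1" by (simp add: cauchy_test_def)
  moreover have "(SUP I\<in>circle_arcs. sqrt (enn2real (box_energy 1 ?f I / ennreal (arc_length I powr lam)))) \<le> sqrt 800"
  proof (rule cSUP_least)
    show "circle_arcs \<noteq> {}" using arc_in_circle_arcs[of 1 0] by auto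
    fix I assume "I \<in> circle_arcs"
    then obtain t l where l: "0 < l" "l \<le> 1" and I: "I = circ_arc t l" by (rule circle_arcs_cases)
    have "box_energy 1 ?f I / ennreal (arc_length I powr lam) \<le> ennreal 800"
      unfolding I using cauchy_test_box_energy_le[OF w lam l, of t] ennreal_mult[of 800 "l powr lam"] l
      by (simp only: arc_length_arc ennreal_divide_le_iff powr_gt_zero) simp
    then have "enn2real (box_energy 1 ?f I / ennreal (arc_length I powr lam)) \<le> enn2real (ennreal 800)"
      by (intro enn2real_mono) auto
    then show "sqrt (enn2real (box_energy 1 ?f I / ennreal (arc_length I powr lam))) \<le> sqrt 800" by simp
  qed
  ultimately show ?thesis by (simp add: morrey_norm_def)
qed

section \<open>The operators\<close>

text \<open>On the convex disc h has a primitive, and integration along the segment from 0 gives a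
  difference of its values.\<close>

lemma contour_integral_linepath_primitive:
  assumes h: "h holomorphic_on unit_disc" and z: "z \<in> unit_disc"
  shows "((\<lambda>z. contour_integral (linepath 0 z) h) has_field_derivative h z) (at z)"
proof -
  obtain P where P: "\<And>x. x \<in> unit_disc \<Longrightarrow> (P has_field_derivative h x) (at x within unit_disc)"
    using holomorphic_convex_primitive'[OF convex_ball open_ball h] by blast
  have eq: "contour_integral (linepath 0 x) h = P x - P 0" if "x \<in> unit_disc" for x
  proof (rule contour_integral_unique)
    have "closed_segment 0 x \<subseteq> unit_disc" using that by (intro closed_segment_subset) auto
    then show "(h has_contour_integral P x - P 0) (linepath 0 x)"
      using contour_integral_primitive[OF P, of "linepath 0 x"] by simp
  qed
  have "((\<lambda>x. P x - P 0) has_field_derivative h z) (at z)"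
    using P[OF z] z by (auto intro!: derivative_eq_intros simp: at_within_open[OF z open_ball])
  then show ?thesis
    by (rule has_field_derivative_transform_within_open[OF _ open_ball z]) (simp add: eq)
qed

lemma contour_integrable_on_linepath_0:
  assumes h: "h holomorphic_on unit_disc" and z: "z \<in> unit_disc"
  shows "h contour_integrable_on linepath 0 z"
proof -
  have "closed_segment 0 z \<subseteq> unit_disc" using z by (intro closed_segment_subset) auto
  then show ?thesis
    by (intro contour_integrable_continuous_linepath continuous_on_subset[OF holomorphic_on_imp_continuous_on[OF h]])
qed

lemma
  assumes f: "f holomorphic_on unit_disc" and g: "g holomorphic_on unit_disc"
  shows I_op_holomorphic: "I_op g f holomorphic_on unit_disc"
    and deriv_I_op: "z \<in> unit_disc \<Longrightarrow> deriv (I_op g f) z = deriv f z * g z"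
    and T_op_holomorphic: "T_op g f holomorphic_on unit_disc"
    and deriv_T_op: "z \<in> unit_disc \<Longrightarrow> deriv (T_op g f) z = f z * deriv g z"
proof -
  have "(\<lambda>w. deriv f w * g w) holomorphic_on unit_disc" "(\<lambda>w. f w * deriv g w) holomorphic_on unit_disc"
    by (intro holomorphic_intros f g open_ball)+
  note d = this[THEN contour_integral_linepath_primitive, folded I_op_def T_op_def]
  show "I_op g f holomorphic_on unit_disc" "T_op g f holomorphic_on unit_disc"
    unfolding holomorphic_on_open[OF open_ball] using d by blast+
  show "deriv (I_op g f) z = deriv f z * g z" "deriv (T_op g f) z = f z * deriv g z" if "z \<in> unit_disc"
    using d[OF that] by (auto intro: DERIV_imp_deriv)
qed

lemma T_op_0 [simp]: "T_op g f 0 = 0"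
  by (simp add: T_op_def)

lemma T_op_linear:
  assumes f: "f holomorphic_on unit_disc" and h: "h holomorphic_on unit_disc"
    and g: "g holomorphic_on unit_disc" and z: "z \<in> unit_disc"
  shows "T_op g (\<lambda>w. a * f w + b * h w) z = a * T_op g f z + b * T_op g h z"
proof -
  have int: "(\<lambda>w. f w * deriv g w) contour_integrable_on linepath 0 z" "(\<lambda>w. h w * deriv g w) contour_integrable_on linepath 0 z"
    by (rule contour_integrable_on_linepath_0[OF _ z], intro holomorphic_intros f h g open_ball)+
  have "T_op g (\<lambda>w. a * f w + b * h w) z = contour_integral (linepath 0 z) (\<lambda>w. a * (f w * deriv g w) + b * (h w * deriv g w))"
    unfolding T_op_def by (rule arg_cong[where f = "contour_integral _"]) (simp add: fun_eq_iff algebra_simps)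
  also have "\<dots> = a * T_op g f z + b * T_op g h z"
    unfolding T_op_def using int
    by (simp add: contour_integral_add contour_integrable_lmul contour_integral_lmul)
  finally show ?thesis .
qed

section \<open>Estimates in the Bloch space\<close>

lemma bloch_norm_ge:
  assumes "f \<in> bloch_space" "z \<in> unit_disc"
  shows "(1 - (cmod z)\<^sup>2) * cmod (deriv f z) \<le> bloch_norm f"
proof -
  have "(1 - (cmod z)\<^sup>2) * cmod (deriv f z) \<le> (SUP z\<in>unit_disc. (1 - (cmod z)\<^sup>2) * cmod (deriv f z))"
    using assms by (intro cSUP_upper) (auto simp: bloch_space_def)
  then show ?thesis by (simp add: bloch_norm_def add_increasing)
qed

lemma bloch_norm_nonneg: "f \<in> bloch_space \<Longrightarrow> 0 \<le> bloch_norm f"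
  using bloch_norm_ge[of f 0] by (simp add: order_trans[OF norm_ge_zero])

lemma bloch_spaceI:
  assumes "f holomorphic_on unit_disc" "\<And>z. z \<in> unit_disc \<Longrightarrow> (1 - (cmod z)\<^sup>2) * cmod (deriv f z) \<le> K"
  shows "f \<in> bloch_space"
  unfolding bloch_space_def using assms by (auto intro!: bdd_aboveI2[of _ _ K])

lemma bloch_norm_le:
  assumes "f 0 = 0" "\<And>z. z \<in> unit_disc \<Longrightarrow> (1 - (cmod z)\<^sup>2) * cmod (deriv f z) \<le> K"
  shows "bloch_norm f \<le> K"
  unfolding bloch_norm_def using assms by (auto intro!: cSUP_least)

lemma deriv_eq_on_disc:
  assumes "\<And>w. w \<in> unit_disc \<Longrightarrow> f w = h w" "z \<in> unit_disc"
  shows "deriv f z = deriv h z"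
proof (rule deriv_cong_ev)
  have "eventually (\<lambda>w. w \<in> unit_disc) (nhds z)"
    by (rule eventually_nhds_in_open[OF open_ball assms(2)])
  then show "eventually (\<lambda>w. f w = h w) (nhds z)"
    by eventually_elim (rule assms(1))
qed simp

lemma bloch_norm_zero:
  assumes "\<And>z. z \<in> unit_disc \<Longrightarrow> f z = 0"
  shows "f \<in> bloch_space" "bloch_norm f = 0"
proof -
  have d: "deriv f z = 0" if "z \<in> unit_disc" for z
    using deriv_eq_on_disc[of f "\<lambda>_. 0" z] assms that by simp
  have "f holomorphic_on unit_disc"
    using holomorphic_transform[of "\<lambda>_. 0" unit_disc f] assms by simp
  then show fb: "f \<in> bloch_space" by (rule bloch_spaceI[of _ 0]) (simp add: d)
  have "bloch_norm f \<le> 0" by (rule bloch_norm_le) (simp_all add: assms d)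
  then show "bloch_norm f = 0" using bloch_norm_nonneg[OF fb] by simp
qed

lemma morrey_holomorphic: "f \<in> morrey_space lam \<Longrightarrow> f holomorphic_on unit_disc"
  by (simp add: morrey_space_def hardy2_def)

lemma morrey_norm_nonneg:
  "f \<in> morrey_space lam \<Longrightarrow> 0 < lam \<Longrightarrow> lam < 1 \<Longrightarrow> 0 \<le> morrey_norm lam f"
  by (rule order_trans[OF norm_ge_zero morrey_norm_facts(1)])

text \<open>Boundedness alone forces \<open>g = 0\<close>: testing on \<open>cauchy_test\<close> gives
  $|w|\,|g(w)| \lesssim (1-|w|^2)^{(1-\lambda)/2}$, which tends to 0 at the circle.\<close>

lemma I_op_bounded_imp_zero:
  assumes lam: "0 < lam" "lam < 1" and g: "g holomorphic_on unit_disc"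
    and bd: "bounded_linear_operator (morrey_space lam) (morrey_norm lam) bloch_space bloch_norm (I_op g)"
    and z: "z \<in> unit_disc"
  shows "g z = 0"
proof -
  obtain C where into: "\<And>f. f \<in> morrey_space lam \<Longrightarrow> I_op g f \<in> bloch_space"
    and C: "\<And>f. f \<in> morrey_space lam \<Longrightarrow> bloch_norm (I_op g f) \<le> C * morrey_norm lam f"
    using bd unfolding bounded_linear_operator_def by blast
  define M where "M = \<bar>C\<bar> * (1 + sqrt 800)"
  have M0: "0 \<le> M" by (simp add: M_def)
  have key: "cmod w * cmod (g w) \<le> M * (1 - (cmod w)\<^sup>2) powr ((1 - lam) / 2)" if w: "cmod w < 1" for w
  proof -
    define \<delta> where "\<delta> = 1 - (cmod w)\<^sup>2"
    have \<delta>: "0 < \<delta>" using w by (simp add: \<delta>_def power_less_one_iff)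
    let ?f = "cauchy_test ((1 + lam) / 2) w"
    have f: "?f \<in> morrey_space lam" by (rule cauchy_test_in_morrey[OF w lam])
    have "bloch_norm (I_op g ?f) \<le> C * morrey_norm lam ?f" by (rule C[OF f])
    also have "\<dots> \<le> \<bar>C\<bar> * (1 + sqrt 800)"
      using cauchy_test_morrey_norm_le[OF w lam] morrey_norm_nonneg[OF f lam] by (intro mult_mono) auto
    finally have "\<delta> * cmod (deriv ?f w * g w) \<le> M"
      using bloch_norm_ge[OF into[OF f], of w] w deriv_I_op[OF morrey_holomorphic[OF f] g, of w]
      by (simp add: M_def \<delta>_def)
    moreover have "deriv ?f w = cnj w * of_real (\<delta> powr ((1 + lam) / 2) / \<delta>\<^sup>2)"
    proof -
      have "1 - cnj w * w = of_real \<delta>" using complex_norm_square[of w] by (simp add: \<delta>_def mult.commute)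
      then show ?thesis using deriv_cauchy_test[OF w w, of "(1 + lam) / 2"] by (simp add: \<delta>_def)
    qed
    ultimately have "\<delta> * (cmod w * (\<delta> powr ((1 + lam) / 2) / \<delta>\<^sup>2) * cmod (g w)) \<le> M"
      by (simp add: norm_mult norm_divide norm_power)
    also have "\<delta> * (cmod w * (\<delta> powr ((1 + lam) / 2) / \<delta>\<^sup>2) * cmod (g w)) = cmod w * cmod (g w) * (\<delta> powr ((1 + lam) / 2) / \<delta> powr 1)"
      using \<delta> by (simp add: power2_eq_square)
    also have "\<delta> powr ((1 + lam) / 2) / \<delta> powr 1 = \<delta> powr (- ((1 - lam) / 2))"
    proof -
      have "(1 + lam) / 2 - 1 = - ((1 - lam) / 2)" by (simp add: field_simps)
      then show ?thesis by (simp only: powr_diff[symmetric])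
    qed
    finally show ?thesis
      using \<delta> unfolding \<delta>_def[symmetric] by (simp add: powr_minus field_simps)
  qed
  \<comment> \<open>On a circle |w| = r near the boundary the bound \<open>key\<close> is small, and
    the maximum principle carries this to \<open>z\<close>.\<close>
  have "cmod (g z) \<le> 0 + \<epsilon>" if \<epsilon>: "0 < \<epsilon>" for \<epsilon>
  proof -
    have "((\<lambda>r::real. 1 - r\<^sup>2) \<longlongrightarrow> 1 - 1\<^sup>2) (at_left 1)" by (intro tendsto_intros)
    moreover have "eventually (\<lambda>r::real. 0 \<le> 1 - r\<^sup>2) (at_left 1)"
      by (rule eventually_at_leftI[of 0]) (auto simp: power_le_one)
    ultimately have "((\<lambda>r. (1 - r\<^sup>2) powr ((1 - lam) / 2)) \<longlongrightarrow> 0) (at_left (1::real))"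
      using lam by (intro tendsto_zero_powrI[OF _ tendsto_const]) auto
    then have "((\<lambda>r. 2 * M * (1 - r\<^sup>2) powr ((1 - lam) / 2)) \<longlongrightarrow> 0) (at_left (1::real))"
      by (rule tendsto_mult_right_zero)
    then have "eventually (\<lambda>r. 2 * M * (1 - r\<^sup>2) powr ((1 - lam) / 2) < \<epsilon>) (at_left (1::real))"
      using \<epsilon> by (intro order_tendstoD(2)) auto
    \<comment> \<open>r > 1/2 removes the factor |w| at the cost of the 2 in front of
      \<open>M\<close>; r > |z| places z inside the circle.\<close>
    moreover have "eventually (\<lambda>r. r \<in> {max (1/2) (cmod z)<..<1}) (at_left (1::real))"
      using z by (intro eventually_at_leftI[of "max (1/2) (cmod z)"]) auto
    ultimately have "eventually (\<lambda>r. 2 * M * (1 - r\<^sup>2) powr ((1 - lam) / 2) < \<epsilon> \<and> r \<in> {max (1/2) (cmod z)<..<1}) (at_left (1::real))"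
      by (rule eventually_conj)
    then obtain r where r: "2 * M * (1 - r\<^sup>2) powr ((1 - lam) / 2) < \<epsilon>" "1/2 < r" "cmod z < r" "r < 1"
      using eventually_happens[of _ "at_left (1::real)"] by (auto simp: trivial_limit_at_left_real)
    have "norm (g z) \<le> \<epsilon>"
    proof (rule maximum_modulus_frontier[of g "cball (0::complex) r"])
      show "g holomorphic_on interior (cball (0::complex) r)"
        using r by (intro holomorphic_on_subset[OF g]) auto
      show "continuous_on (closure (cball (0::complex) r)) g"
        using r by (intro continuous_on_subset[OF holomorphic_on_imp_continuous_on[OF g]]) auto
      fix w assume "w \<in> frontier (cball (0::complex) r)"
      then have w: "cmod w = r" using r by simp
      have "1/2 * cmod (g w) \<le> cmod w * cmod (g w)" using w r by (intro mult_right_mono) auto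
      also have "\<dots> \<le> M * (1 - r\<^sup>2) powr ((1 - lam) / 2)" using key[of w] w r by simp
      finally show "norm (g w) \<le> \<epsilon>" using r by simp
    qed (use r in auto)
    then show ?thesis by simp
  qed
  then have "cmod (g z) \<le> 0" by (rule field_le_epsilon)
  then show ?thesis by simp
qed

lemma I_op_zero_compact:
  assumes g: "\<forall>z\<in>unit_disc. g z = 0"
  shows "compact_operator X normX bloch_space bloch_norm (I_op g)"
proof -
  have I0: "I_op g f z = 0" if "z \<in> unit_disc" for f z
  proof -
    have seg: "closed_segment 0 z \<subseteq> unit_disc" using that by (intro closed_segment_subset) auto
    have "I_op g f z = contour_integral (linepath 0 z) (\<lambda>w. 0)"
      unfolding I_op_def by (rule contour_integral_eq) (use g seg in auto)
    then show ?thesis by simp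
  qed
  have I: "I_op g f \<in> bloch_space" "bloch_norm (I_op g f) = 0" for f
    using bloch_norm_zero[of "I_op g f"] I0 by blast+
  have "bounded_linear_operator X normX bloch_space bloch_norm (I_op g)"
    unfolding bounded_linear_operator_def
    by (intro conjI ballI allI exI[of _ 0]) (simp_all add: I0 I)
  moreover have "(\<lambda>z. 0) \<in> bloch_space" by (rule bloch_norm_zero(1)) simp
  ultimately show ?thesis
    unfolding compact_operator_def
    by (auto intro!: bexI[of _ "\<lambda>_. 0"] exI[of _ "\<lambda>n. n"] simp: strict_mono_def I)
qed

text \<open>If the decay fails along points w_n tending to the circle, the test functions at w_n are
  bounded in norm and tend to 0 pointwise. A Bloch limit h of a subsequence of their images then has
  h' = 0, while evaluation at w_n itself keeps the images at distance at least \<epsilon> from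
  h.\<close>

lemma T_op_compact_imp_little_weighted:
  assumes lam: "0 < lam" "lam < 1" and g: "g holomorphic_on unit_disc"
    and comp: "compact_operator (morrey_space lam) (morrey_norm lam) bloch_space bloch_norm (T_op g)"
  shows "little_weighted ((1 + lam) / 2) g"
proof (rule ccontr)
  assume "\<not> little_weighted ((1 + lam) / 2) g"
  then obtain \<epsilon> where \<epsilon>: "0 < \<epsilon>" and
    "\<And>\<delta>. \<delta> > 0 \<Longrightarrow> \<exists>z\<in>unit_disc. 1 - cmod z < \<delta> \<and> \<epsilon> < (1 - cmod z) powr ((1 + lam) / 2) * cmod (deriv g z)"
    unfolding little_weighted_def by (auto simp: not_le)
  then have "\<forall>n::nat. \<exists>z\<in>unit_disc. 1 - cmod z < 1 / real (Suc n) \<and> \<epsilon> < (1 - cmod z) powr ((1 + lam) / 2) * cmod (deriv g z)"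
    by simp
  then obtain w where w: "\<And>n. w n \<in> unit_disc" "\<And>n. 1 - cmod (w n) < 1 / real (Suc n)"
    "\<And>n. \<epsilon> < (1 - cmod (w n)) powr ((1 + lam) / 2) * cmod (deriv g (w n))"
    by metis
  have w1: "cmod (w n) < 1" for n using w(1) by simp
  define F where "F n = cauchy_test ((1 + lam) / 2) (w n)" for n
  have F: "F n \<in> morrey_space lam" for n unfolding F_def by (rule cauchy_test_in_morrey[OF w1 lam])
  have "morrey_norm lam (F n) \<le> 1 + sqrt 800" for n
    unfolding F_def by (rule cauchy_test_morrey_norm_le[OF w1 lam])
  then obtain h r where h: "h \<in> bloch_space" and r: "strict_mono (r :: nat \<Rightarrow> nat)"
    and lim: "(\<lambda>n. bloch_norm (\<lambda>z. T_op g (F (r n)) z - h z)) \<longlonglongrightarrow> 0"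
    using comp F unfolding compact_operator_def by blast
  have hF: "F n holomorphic_on unit_disc" for n by (rule morrey_holomorphic[OF F])
  have hh: "h holomorphic_on unit_disc" using h by (simp add: bloch_space_def)
  define N where "N n = bloch_norm (\<lambda>z. T_op g (F (r n)) z - h z)" for n
  let ?T = "\<lambda>n z. T_op g (F n) z - h z"
  have dd: "deriv (?T n) z = F n z * deriv g z - deriv h z" if "z \<in> unit_disc" for n z
  proof -
    have "T_op g (F n) field_differentiable at z" "h field_differentiable at z"
      using holomorphic_on_imp_differentiable_at[OF _ open_ball that] T_op_holomorphic[OF hF g] hh by blast+
    then show ?thesis using deriv_T_op[OF hF g that] by simp
  qed
  have TB: "T_op g (F n) \<in> bloch_space" for n
    using comp F by (auto simp: compact_operator_def bounded_linear_operator_def)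
  \<comment> \<open>The norm bounds the weighted derivative only after the difference is known to be
    a Bloch function.\<close>
  have diffB: "(?T n) \<in> bloch_space" for n
  proof (rule bloch_spaceI)
    show "(?T n) holomorphic_on unit_disc"
      by (intro holomorphic_intros T_op_holomorphic hF g hh)
    fix z assume z: "z \<in> unit_disc"
    have nn: "0 \<le> 1 - (cmod z)\<^sup>2" using z by (simp add: power_le_one)
    have "(1 - (cmod z)\<^sup>2) * cmod (deriv (?T n) z) \<le> (1 - (cmod z)\<^sup>2) * (cmod (deriv (T_op g (F n)) z) + cmod (deriv h z))"
      unfolding dd[OF z] deriv_T_op[OF hF g z] using nn by (intro mult_left_mono norm_triangle_ineq4)
    also have "\<dots> \<le> bloch_norm (T_op g (F n)) + bloch_norm h"
      using bloch_norm_ge[OF TB z, of n] bloch_norm_ge[OF h z] by (simp add: distrib_left)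
    finally show "(1 - (cmod z)\<^sup>2) * cmod (deriv (?T n) z) \<le> bloch_norm (T_op g (F n)) + bloch_norm h" .
  qed
  have le: "(1 - (cmod z)\<^sup>2) * cmod (F (r n) z * deriv g z - deriv h z) \<le> N n" if "z \<in> unit_disc" for n z
    using bloch_norm_ge[OF diffB that, of "r n"] dd[OF that] by (simp add: N_def)
  have N0: "N \<longlonglongrightarrow> 0" using lim by (simp add: N_def[abs_def])
  \<comment> \<open>For fixed z the denominator is at least 1 - |z|, while the numerator tends to 0
    as w_n approaches the circle.\<close>
  have Fz: "(\<lambda>n. F n z) \<longlonglongrightarrow> 0" if z: "z \<in> unit_disc" for z
  proof (rule Lim_null_comparison)
    have wl: "(\<lambda>n. 1 - cmod (w n)) \<longlonglongrightarrow> 0"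
    proof (rule tendsto_sandwich[of "\<lambda>_. 0" _ _ "\<lambda>n. 1 / real (Suc n)"])
      show "(\<lambda>n. 1 / real (Suc n)) \<longlonglongrightarrow> 0" by (intro LIMSEQ_Suc lim_const_over_n)
    qed (use w1 w(2) in \<open>auto intro!: always_eventually less_imp_le\<close>)
    have "(\<lambda>n. (2 * (1 - cmod (w n))) powr ((1 + lam) / 2)) \<longlonglongrightarrow> 0"
      using lam w1 tendsto_mult_right_zero[OF wl, of 2]
      by (intro tendsto_zero_powrI[OF _ tendsto_const]) (auto intro!: always_eventually less_imp_le)
    then show "(\<lambda>n. (2 * (1 - cmod (w n))) powr ((1 + lam) / 2) / (1 - cmod z)) \<longlonglongrightarrow> 0"
      by (rule tendsto_divide_zero)
    have "norm (F n z) \<le> (2 * (1 - cmod (w n))) powr ((1 + lam) / 2) / (1 - cmod z)" for n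
      unfolding F_def cauchy_test_def norm_divide norm_of_real
    proof (rule frac_le)
      have "(1 - (cmod (w n))\<^sup>2) powr ((1 + lam) / 2) \<le> (2 * (1 - cmod (w n))) powr ((1 + lam) / 2)"
        using w1[of n] lam weight_sq_le[of "w n"] by (intro powr_mono2) (auto simp: power_le_one)
      then show "\<bar>(1 - (cmod (w n))\<^sup>2) powr ((1 + lam) / 2)\<bar> \<le> (2 * (1 - cmod (w n))) powr ((1 + lam) / 2)" by simp
      show "1 - cmod z \<le> cmod (1 - cnj (w n) * z)" using w1[of n] by (intro cauchy_denom_ge') simp
    qed (use z in auto)
    then show "eventually (\<lambda>n. norm (F n z) \<le> (2 * (1 - cmod (w n))) powr ((1 + lam) / 2) / (1 - cmod z)) sequentially"
      by simp
  qed
  \<comment> \<open>Convergence in the Bloch norm forces pointwise convergence of the derivatives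
    F_n g', and these tend to 0.\<close>
  have dh: "deriv h z = 0" if z: "z \<in> unit_disc" for z
  proof -
    have "(\<lambda>n. F (r n) z) \<longlonglongrightarrow> 0" using LIMSEQ_subseq_LIMSEQ[OF Fz[OF z] r] by (simp add: o_def)
    then have "(\<lambda>n. (1 - (cmod z)\<^sup>2) * cmod (F (r n) z * deriv g z - deriv h z)) \<longlonglongrightarrow> (1 - (cmod z)\<^sup>2) * cmod (0 * deriv g z - deriv h z)"
      by (intro tendsto_intros)
    then have "(1 - (cmod z)\<^sup>2) * cmod (0 * deriv g z - deriv h z) \<le> 0"
      by (rule LIMSEQ_le[OF _ N0]) (use le[OF z] in blast)
    moreover have "0 < 1 - (cmod z)\<^sup>2" using z by (simp add: power_less_one_iff)
    ultimately show ?thesis by (simp add: mult_le_0_iff)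
  qed
  \<comment> \<open>Evaluate at the node \<open>v\<close> of the test function itself, where the
    Bloch weight \<delta> times the value of the test function is \<delta>^((1+lam)/2).\<close>
  have "\<epsilon> \<le> N n" for n
  proof -
    define v where "v = w (r n)"
    have v: "v \<in> unit_disc" using w(1) by (simp add: v_def)
    define \<delta> where "\<delta> = 1 - (cmod v)\<^sup>2"
    have "(cmod v)\<^sup>2 \<le> cmod v" using v by (simp add: power2_eq_square mult_left_le)
    then have \<delta>: "0 < \<delta>" "1 - cmod v \<le> \<delta>" using v by (auto simp: \<delta>_def power_less_one_iff)
    have "1 - cnj v * v = of_real \<delta>" using complex_norm_square[of v] by (simp add: \<delta>_def mult.commute)
    then have "cmod (F (r n) v) = \<delta> powr ((1 + lam) / 2) / \<delta>"
      using \<delta> by (simp add: F_def cauchy_test_def norm_divide flip: v_def \<delta>_def)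
    then have "\<delta> powr ((1 + lam) / 2) * cmod (deriv g v) = \<delta> * cmod (F (r n) v * deriv g v - deriv h v)"
      using \<delta> dh[OF v] by (simp add: norm_mult)
    also have "\<dots> \<le> N n" unfolding \<delta>_def by (rule le[OF v])
    finally have 1: "\<delta> powr ((1 + lam) / 2) * cmod (deriv g v) \<le> N n" .
    have "\<epsilon> \<le> (1 - cmod v) powr ((1 + lam) / 2) * cmod (deriv g v)" using w(3)[of "r n"] by (simp add: v_def)
    also have "\<dots> \<le> \<delta> powr ((1 + lam) / 2) * cmod (deriv g v)"
      using \<delta> v lam by (intro mult_right_mono powr_mono2) auto
    finally show ?thesis using 1 by simp
  qed
  then have "\<epsilon> \<le> 0" using LIMSEQ_le_const[OF N0] by blast
  with \<epsilon> show False by simp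
qed

text \<open>The exponents balance: 1 - (1-lam)/2 = (1+lam)/2. The Bloch weight absorbs the growth of
  the first factor and leaves exactly the weight attached to the second.\<close>

lemma weighted_product_bound:
  assumes z: "z \<in> unit_disc" and A: "cmod a \<le> A * (1 - cmod z) powr (- (1 - lam) / 2)" "0 \<le> A"
    and K: "(1 - cmod z) powr ((1 + lam) / 2) * cmod b \<le> K"
  shows "(1 - (cmod z)\<^sup>2) * cmod (a * b) \<le> 2 * A * K"
proof -
  define d where "d = 1 - cmod z"
  have d: "0 < d" using z by (simp add: d_def)
  have "(1 - (cmod z)\<^sup>2) * cmod (a * b) \<le> (2 * d) * (A * d powr (- (1 - lam) / 2) * cmod b)"
    unfolding norm_mult using A weight_sq_le[of z] d unfolding d_def by (intro mult_mono) auto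
  also have "\<dots> = 2 * A * (d powr 1 * d powr (- (1 - lam) / 2) * cmod b)" using d by simp
  also have "d powr 1 * d powr (- (1 - lam) / 2) = d powr ((1 + lam) / 2)"
  proof -
    have "1 + - (1 - lam) / 2 = (1 + lam) / 2" by (simp add: field_simps)
    then show ?thesis by (simp only: powr_add[symmetric])
  qed
  also have "2 * A * (d powr ((1 + lam) / 2) * cmod b) \<le> 2 * A * K"
    using K A(2) unfolding d_def by (intro mult_left_mono) auto
  finally show ?thesis .
qed

text \<open>The growth estimate makes a norm-bounded sequence locally bounded, so Montel's theorem
  yields a locally uniform limit h. The weighted derivative of T_g(F_n - h) is small near the circle
  by the decay of g', uniformly in n, and small on the remaining compact disc by uniform
  convergence.\<close>

lemma little_weighted_imp_T_op_compact:
  assumes lam: "0 < lam" "lam < 1" and g: "g holomorphic_on unit_disc"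
    and lw: "little_weighted ((1 + lam) / 2) g"
  shows "compact_operator (morrey_space lam) (morrey_norm lam) bloch_space bloch_norm (T_op g)"
proof -
  define c where "c = 1 + 8 / (1 - lam)"
  have c: "0 < c" using lam by (simp add: c_def add_pos_pos)
  have growth: "cmod (f z) \<le> c * morrey_norm lam f * (1 - cmod z) powr (- (1 - lam) / 2)"
    if "f \<in> morrey_space lam" "z \<in> unit_disc" for f z
    unfolding c_def by (rule morrey_growth[OF that(1) lam that(2)])
  obtain K where K: "0 < K" "\<And>z. z \<in> unit_disc \<Longrightarrow> (1 - cmod z) powr ((1 + lam) / 2) * cmod (deriv g z) \<le> K"
    using weighted_deriv_bounded[OF g lw] lam by auto
  \<comment> \<open>Stated for functions with a growth bound because it is also applied to the
    Montel limit, which inherits this bound but is not shown to lie in the Morrey space.\<close>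
  have into: "T_op g f \<in> bloch_space"
    if hf: "f holomorphic_on unit_disc" and A: "0 \<le> A" "\<And>z. z \<in> unit_disc \<Longrightarrow> cmod (f z) \<le> A * (1 - cmod z) powr (- (1 - lam) / 2)" for f A
    by (rule bloch_spaceI[OF T_op_holomorphic[OF hf g]], subst deriv_T_op[OF hf g])
       (auto intro: weighted_product_bound[OF _ A(2) A(1) K(2)])
  have bdd: "bounded_linear_operator (morrey_space lam) (morrey_norm lam) bloch_space bloch_norm (T_op g)"
    unfolding bounded_linear_operator_def
  proof (intro conjI ballI allI exI)
    fix f assume f: "f \<in> morrey_space lam"
    have A: "0 \<le> c * morrey_norm lam f" using c morrey_norm_nonneg[OF f lam] by simp
    show "T_op g f \<in> bloch_space"
      by (rule into[OF morrey_holomorphic[OF f] A growth[OF f]])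
    show "bloch_norm (T_op g f) \<le> (2 * c * K) * morrey_norm lam f"
    proof (rule bloch_norm_le)
      fix z assume z: "z \<in> unit_disc"
      have "(1 - (cmod z)\<^sup>2) * cmod (f z * deriv g z) \<le> 2 * (c * morrey_norm lam f) * K"
        by (rule weighted_product_bound[OF z growth[OF f z] A K(2)[OF z]])
      then show "(1 - (cmod z)\<^sup>2) * cmod (deriv (T_op g f) z) \<le> (2 * c * K) * morrey_norm lam f"
        unfolding deriv_T_op[OF morrey_holomorphic[OF f] g z] by (simp add: mult_ac)
    qed simp
  next
    fix f h a b z assume "f \<in> morrey_space lam" "h \<in> morrey_space lam" "z \<in> unit_disc"
    then show "T_op g (\<lambda>w. a * f w + b * h w) z = a * T_op g f z + b * T_op g h z"
      by (intro T_op_linear morrey_holomorphic g)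
  qed
  show ?thesis
    unfolding compact_operator_def
  proof (intro conjI bdd allI impI)
    fix F :: "nat \<Rightarrow> complex \<Rightarrow> complex"
    assume "(\<forall>n. F n \<in> morrey_space lam) \<and> (\<exists>M. \<forall>n. morrey_norm lam (F n) \<le> M)"
    then obtain M where F: "\<And>n. F n \<in> morrey_space lam" and M: "\<And>n. morrey_norm lam (F n) \<le> M" by blast
    have M0: "0 \<le> M" using morrey_norm_nonneg[OF F lam, of 0] M[of 0] by simp
    define A where "A = c * M"
    have A0: "0 \<le> A" using c M0 by (simp add: A_def)
    define B where "B z = A * (1 - cmod z) powr (- (1 - lam) / 2)" for z
    have FB: "cmod (F n z) \<le> B z" if "z \<in> unit_disc" for n z
    proof -
      have "cmod (F n z) \<le> c * morrey_norm lam (F n) * (1 - cmod z) powr (- (1 - lam) / 2)" by (rule growth[OF F that])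
      also have "\<dots> \<le> B z" unfolding B_def A_def using c M by (intro mult_right_mono mult_left_mono) auto
      finally show ?thesis .
    qed
    define H where "H = {f. f holomorphic_on unit_disc \<and> (\<forall>z\<in>unit_disc. cmod (f z) \<le> B z)}"
    have Bc: "continuous_on unit_disc B" unfolding B_def by (intro continuous_intros) auto
    obtain h r where h: "h holomorphic_on unit_disc" and r: "strict_mono (r :: nat \<Rightarrow> nat)"
      and ptw: "\<And>x. x \<in> unit_disc \<Longrightarrow> (\<lambda>n. F (r n) x) \<longlonglongrightarrow> h x"
      and unif: "\<And>K. compact K \<Longrightarrow> K \<subseteq> unit_disc \<Longrightarrow> uniform_limit K (F \<circ> r) h sequentially"
    proof (rule Montel[of unit_disc H F])
      show "range F \<subseteq> H" using morrey_holomorphic[OF F] FB by (auto simp: H_def)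
      fix K :: "complex set" assume K: "compact K" "K \<subseteq> unit_disc"
      then have "bounded (B ` K)"
        by (intro compact_imp_bounded compact_continuous_image continuous_on_subset[OF Bc])
      then obtain b where b: "\<And>z. z \<in> K \<Longrightarrow> \<bar>B z\<bar> \<le> b" by (auto simp: bounded_iff)
      have "norm (f z) \<le> b" if "f \<in> H" "z \<in> K" for f z
      proof -
        have "norm (f z) \<le> B z" using that K(2) unfolding H_def by blast
        then show ?thesis using b[OF that(2)] by linarith
      qed
      then show "\<exists>b. \<forall>f\<in>H. \<forall>z\<in>K. norm (f z) \<le> b" by blast
    qed (auto simp: H_def)
    have hB: "cmod (h z) \<le> B z" if z: "z \<in> unit_disc" for z
      by (rule Lim_bounded[OF tendsto_norm[OF ptw[OF z]], of 0]) (use FB[OF z] in auto)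
    have hF: "F n holomorphic_on unit_disc" for n by (rule morrey_holomorphic[OF F])
    have FhB: "cmod (F n z - h z) \<le> 2 * A * (1 - cmod z) powr (- (1 - lam) / 2)" if z: "z \<in> unit_disc" for n z
      using norm_triangle_ineq4[of "F n z" "h z"] FB[OF z, of n] hB[OF z] by (simp add: B_def)
    let ?T = "\<lambda>n z. T_op g (F n) z - T_op g h z"
    have dd: "deriv (?T n) z = (F n z - h z) * deriv g z" if z: "z \<in> unit_disc" for n z
    proof -
      have "T_op g (F n) field_differentiable at z" "T_op g h field_differentiable at z"
        using holomorphic_on_imp_differentiable_at[OF _ open_ball z] T_op_holomorphic[OF hF g] T_op_holomorphic[OF h g] by blast+
      then show ?thesis using deriv_T_op[OF hF g z] deriv_T_op[OF h g z] by (simp add: algebra_simps)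
    qed
    have nonneg: "0 \<le> bloch_norm (?T n)" for n
    proof (rule bloch_norm_nonneg, rule bloch_spaceI)
      show "(?T n) holomorphic_on unit_disc"
        by (intro holomorphic_intros T_op_holomorphic hF h g)
      show "(1 - (cmod z)\<^sup>2) * cmod (deriv (?T n) z) \<le> 2 * (2 * A) * K" if "z \<in> unit_disc" for z
        unfolding dd[OF that] using A0 by (intro weighted_product_bound[OF that FhB[OF that] _ K(2)[OF that]]) simp
    qed
    have "(\<lambda>n. bloch_norm (?T (r n))) \<longlonglongrightarrow> 0"
    proof (rule LIMSEQ_I)
      fix \<epsilon> :: real assume \<epsilon>: "0 < \<epsilon>"
      \<comment> \<open>Near the circle the estimate reads 2 * (2 * A) * \<eta> \<le> \<epsilon>/2;
        the summand 8 keeps the denominator positive when A = 0.\<close>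
      define \<eta> where "\<eta> = \<epsilon> / (8 * A + 8)"
      have \<eta>: "0 < \<eta>" using \<epsilon> A0 by (simp add: \<eta>_def)
      obtain \<delta> where \<delta>: "0 < \<delta>" "\<And>z. z \<in> unit_disc \<Longrightarrow> 1 - cmod z < \<delta> \<Longrightarrow> (1 - cmod z) powr ((1 + lam) / 2) * cmod (deriv g z) \<le> \<eta>"
        using lw \<eta> by (auto simp: little_weighted_def)
      let ?C = "cball (0::complex) (1 - \<delta>)"
      have Csub: "?C \<subseteq> unit_disc" using \<delta>(1) by auto
      have "continuous_on ?C (deriv g)"
        using g Csub by (intro holomorphic_on_imp_continuous_on holomorphic_on_subset[OF holomorphic_deriv]) auto
      then have "bounded (deriv g ` ?C)" by (intro compact_imp_bounded compact_continuous_image) auto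
      then obtain b where b: "0 < b" "\<And>z. z \<in> ?C \<Longrightarrow> cmod (deriv g z) \<le> b" by (auto simp: bounded_pos)
      have "eventually (\<lambda>n. \<forall>z\<in>?C. dist ((F \<circ> r) n z) (h z) < \<epsilon> / (2 * b)) sequentially"
        using uniform_limitD[OF unif[OF compact_cball Csub], of "\<epsilon> / (2 * b)"] \<epsilon> b(1) by simp
      then obtain n0 where n0: "\<And>n z. n \<ge> n0 \<Longrightarrow> z \<in> ?C \<Longrightarrow> cmod (F (r n) z - h z) < \<epsilon> / (2 * b)"
        unfolding eventually_sequentially dist_norm o_def by blast
      \<comment> \<open>A supremum yields only a non-strict bound, so \<epsilon>/2 is aimed at to
        end strictly below \<epsilon>.\<close>
      have "bloch_norm (?T (r n)) \<le> \<epsilon> / 2" if n: "n \<ge> n0" for n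
      proof (rule bloch_norm_le)
        fix z assume z: "z \<in> unit_disc"
        show "(1 - (cmod z)\<^sup>2) * cmod (deriv (?T (r n)) z) \<le> \<epsilon> / 2"
          unfolding dd[OF z]
        proof (cases "1 - cmod z < \<delta>")
          case True
          have "(1 - (cmod z)\<^sup>2) * cmod ((F (r n) z - h z) * deriv g z) \<le> 2 * (2 * A) * \<eta>"
            using A0 by (intro weighted_product_bound[OF z FhB[OF z] _ \<delta>(2)[OF z True]]) simp
          also have "\<dots> \<le> \<epsilon> / 2" using \<epsilon> A0 by (simp add: \<eta>_def field_simps)
          finally show "(1 - (cmod z)\<^sup>2) * cmod ((F (r n) z - h z) * deriv g z) \<le> \<epsilon> / 2" .
        next
          case False
          then have zC: "z \<in> ?C" by simp
          have "(1 - (cmod z)\<^sup>2) * cmod ((F (r n) z - h z) * deriv g z) \<le> 1 * (\<epsilon> / (2 * b) * b)"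
            unfolding norm_mult using n0[OF n zC] b(2)[OF zC] z \<epsilon> b(1) by (intro mult_mono) (auto simp: power_le_one)
          then show "(1 - (cmod z)\<^sup>2) * cmod ((F (r n) z - h z) * deriv g z) \<le> \<epsilon> / 2" using b by simp
        qed
      qed simp
      then show "\<exists>n0. \<forall>n\<ge>n0. norm (bloch_norm (?T (r n)) - 0) < \<epsilon>"
        using nonneg \<epsilon> by (intro exI[of _ n0]) (force simp: abs_of_nonneg)
    qed
    moreover have "T_op g h \<in> bloch_space"
      by (rule into[OF h A0]) (use hB in \<open>simp add: B_def\<close>)
    ultimately show "\<exists>h\<in>bloch_space. \<exists>r. strict_mono r \<and> (\<lambda>n. bloch_norm (\<lambda>z. T_op g (F (r n)) z - h z)) \<longlonglongrightarrow> 0"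
      using r by blast
  qed
qed

theorem corollary4p1:
  fixes lam p :: real and g :: "complex \<Rightarrow> complex"
  assumes "0 < lam" "lam < 1" and "p > 1" and "g holomorphic_on unit_disc"
  shows "(compact_operator (morrey_space lam) (morrey_norm lam) bloch_space bloch_norm (I_op g)
            \<longleftrightarrow> (\<forall>z\<in>unit_disc. g z = 0)) \<and>
         (compact_operator (morrey_space lam) (morrey_norm lam) bloch_space bloch_norm (T_op g)
            \<longleftrightarrow> g \<in> little_bloch_morrey p lam)"
proof
  let ?C = "compact_operator (morrey_space lam) (morrey_norm lam) bloch_space bloch_norm"
  show "?C (I_op g) \<longleftrightarrow> (\<forall>z\<in>unit_disc. g z = 0)"
  proof
    assume "?C (I_op g)"
    then have "bounded_linear_operator (morrey_space lam) (morrey_norm lam) bloch_space bloch_norm (I_op g)"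
      by (simp add: compact_operator_def)
    then show "\<forall>z\<in>unit_disc. g z = 0"
      using I_op_bounded_imp_zero[OF assms(1,2,4)] by blast
  qed (rule I_op_zero_compact)
  show "?C (T_op g) \<longleftrightarrow> g \<in> little_bloch_morrey p lam"
    unfolding little_bloch_morrey_iff[OF assms(4,3,1,2)]
    using T_op_compact_imp_little_weighted little_weighted_imp_T_op_compact assms by blast
qed

end
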